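(* Suppose that $\omega>\omega_0\ge 0$. For any $\tau>0$, let $\phi^n$ $(n\ge 0)$ be obtained from the GFDN-BF scheme: $\phi^0=\phi_0\in\mathcal N_\omega$ and, for $n\ge 0$, $$\frac{\tilde\phi^{n+1}-\phi^n}{\tau}=\Delta\tilde\phi^{n+1}-\omega\tilde\phi^{n+1}-V\phi^n+|\phi^n|^{2\alpha}\phi^n\quad\text{on }\mathbb R^d,$$ $$\phi^{n+1}=\lambda_{n+1}\tilde\phi^{n+1},\qquad \lambda_{n+1}=\left(\frac{I_\omega^*(\tilde\phi^{n+1})}{\|\tilde\phi^{n+1}\|_{L^{2\alpha+2}}^{2\alpha+2}}\right)^{\frac1{2\alpha}}.$$ Then $$S_\omega(\phi^{n+1})\le S_\omega(\phi^n),\qquad n\ge 0.$$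
   Context: Let $d\ge 1$ and $0<\alpha<\frac{2}{(d-2)_+}$, where $(d-2)_+=\max\{0,d-2\}$ (so $\alpha>0$ is arbitrary for $d\le 2$). All norms and spaces are over $\mathbb R^d$; functions may be complex-valued. Standing assumptions on the real-valued potential $V$: (i) $V\in L^q(\mathbb R^d)+L^\infty(\mathbb R^d)$ with $q=1$ if $d=1$, some $q>1$ if $d=2$, $q=d/2$ if $d\ge 3$; when $d=1$, $V$ may also be the sum of a bounded Borel measure and an $L^\infty$ function vanishing at infinity. (ii) $V$ vanishes at infinity: $|\{x\in\mathbb R^d:|V(x)|>a\}|<\infty$ for all $a>0$. (iii) $V$ is non-positive in the sense that $\int_{\mathbb R^d}V|\psi|^2\,dx\le 0$ for all $\psi\in H^1$. (If $V$ involves a measure, integrals against $V$ are understood accordingly, and $V\phi$ as an element of $H^{-1}$.) Definitions: $\omega_0=-\inf\{\int(|\nabla\phi|^2+V|\phi|^2)\,dx:\phi\in H^1,\ \|\phi\|_{L^2}=1\}$; $S_\omega(\phi)=\int\big(|\nabla\phi|^2+V|\phi|^2+\omega|\phi|^2-\frac{1}{\alpha+1}|\phi|^{2\alpha+2}\big)dx$ (action); $I_\omega^*(\phi)=\int\big(|\nabla\phi|^2+V|\phi|^2+\omega|\phi|^2\big)dx$; $I_\omega(\phi)=I_\omega^*(\phi)-\|\phi\|_{L^{2\alpha+2}}^{2\alpha+2}$; $\mathcal N_\omega=\{0\ne\phi\in H^1: I_\omega(\phi)=0\}$. The elliptic equation for $\tilde\phi^{n+1}$ is understood weakly, i.e.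 in $H^{-1}$, with $\tilde\phi^{n+1}\in H^1$. The scheme is well defined: each $\tilde\phi^{n+1}$ exists, is unique and nonzero, and the normalization step gives $\phi^{n+1}\in\mathcal N_\omega$. *)

theory Defs
  imports "HOL-Analysis.Analysis"
begin

text \<open>
  The type \<open>'a :: euclidean_space\<close> plays the role of \<open>\<real>\<^sup>d\<close> with \<open>d = DIM('a) \<ge> 1\<close>.  Elements of
  function spaces are represented by functions, and equality in such a space is equality almost
  everywhere.
\<close>

section \<open>Lebesgue and Sobolev spaces\<close>

definition Lp_space :: "real \<Rightarrow> ('a::euclidean_space \<Rightarrow> 'b::{banach,second_countable_topology}) set" where
  "Lp_space p = {f. f \<in> borel_measurable lebesgue \<and> integrable lebesgue (\<lambda>x. norm (f x) powr p)}"

definition Linf_space :: "('a::euclidean_space \<Rightarrow> 'b::{banach,second_countable_topology}) set" where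
  "Linf_space = {f. f \<in> borel_measurable lebesgue \<and> (\<exists>C. AE x in lebesgue. norm (f x) \<le> C)}"

definition Lp_norm :: "real \<Rightarrow> ('a::euclidean_space \<Rightarrow> 'b::{banach,second_countable_topology}) \<Rightarrow> real" where
  "Lp_norm p f = (\<integral>x. norm (f x) powr p \<partial>lebesgue) powr (1 / p)"

definition partial_deriv :: "'a::euclidean_space \<Rightarrow> ('a \<Rightarrow> real) \<Rightarrow> 'a \<Rightarrow> real" where
  "partial_deriv b f x = frechet_derivative f (at x) b"

primrec Ck :: "nat \<Rightarrow> ('a::euclidean_space \<Rightarrow> real) \<Rightarrow> bool" where
  "Ck 0 f \<longleftrightarrow> continuous_on UNIV f"
| "Ck (Suc k) f \<longleftrightarrow> (\<forall>x. f differentiable (at x)) \<and> (\<forall>b\<in>Basis. Ck k (partial_deriv b f))"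

definition test_function :: "('a::euclidean_space \<Rightarrow> real) \<Rightarrow> bool" where
  "test_function \<eta> \<longleftrightarrow> (\<forall>k. Ck k \<eta>) \<and> compact (closure {x. \<eta> x \<noteq> 0})"

definition is_weak_partial :: "'a::euclidean_space \<Rightarrow> ('a \<Rightarrow> complex) \<Rightarrow> ('a \<Rightarrow> complex) \<Rightarrow> bool" where
  "is_weak_partial b \<phi> g \<longleftrightarrow>
     (\<forall>\<eta>. test_function \<eta> \<longrightarrow>
        (\<integral>x. partial_deriv b \<eta> x *\<^sub>R \<phi> x \<partial>lebesgue) = - (\<integral>x. \<eta> x *\<^sub>R g x \<partial>lebesgue))"

definition H1 :: "('a::euclidean_space \<Rightarrow> complex) set" where
  "H1 = {\<phi>. \<phi> \<in> Lp_space 2 \<and> (\<forall>b\<in>Basis. \<exists>g\<in>Lp_space 2. is_weak_partial b \<phi> g)}"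

text \<open>For \<open>\<phi> \<in> H1\<close> the following is determined up to a null set.\<close>

definition weak_partial :: "'a::euclidean_space \<Rightarrow> ('a \<Rightarrow> complex) \<Rightarrow> 'a \<Rightarrow> complex" where
  "weak_partial b \<phi> = (SOME g. g \<in> Lp_space 2 \<and> is_weak_partial b \<phi> g)"

text \<open>\<open>L2_inner \<phi> v\<close> is \<open>\<integral> \<phi> v\<^sup>* dx\<close>, \<open>grad_inner \<phi> v\<close> is \<open>\<integral> \<nabla>\<phi> \<cdot> (\<nabla>v)\<^sup>* dx\<close>,
  where the star denotes complex conjugation.\<close>

definition L2_inner :: "('a::euclidean_space \<Rightarrow> complex) \<Rightarrow> ('a \<Rightarrow> complex) \<Rightarrow> complex" where
  "L2_inner \<phi> v = (\<integral>x. \<phi> x * cnj (v x) \<partial>lebesgue)"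

definition grad_inner :: "('a::euclidean_space \<Rightarrow> complex) \<Rightarrow> ('a \<Rightarrow> complex) \<Rightarrow> complex" where
  "grad_inner \<phi> v = (\<Sum>b\<in>Basis. L2_inner (weak_partial b \<phi>) (weak_partial b v))"

definition grad_norm_sq :: "('a::euclidean_space \<Rightarrow> complex) \<Rightarrow> real" where
  "grad_norm_sq \<phi> = (\<Sum>b\<in>Basis. \<integral>x. (cmod (weak_partial b \<phi> x))\<^sup>2 \<partial>lebesgue)"

section \<open>The potential\<close>

text \<open>
  A potential is a real function, or (admissible only for \<open>d = 1\<close>) a bounded signed Borel measure
  plus a function.  The signed measure is given as the difference of two finite positive measures:
  \<open>MeasPot \<mu> \<nu> W\<close> stands for \<open>V = \<mu> - \<nu> + W\<close>.
\<close>

datatype 'a potential =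
    FunPot "'a \<Rightarrow> real"
  | MeasPot "'a measure" "'a measure" "'a \<Rightarrow> real"

text \<open>The continuous representative, which exists for elements of \<open>H1\<close> when \<open>d = 1\<close>.  Integrals
  against a measure are taken of this representative.\<close>

definition cont_rep :: "('a::euclidean_space \<Rightarrow> complex) \<Rightarrow> 'a \<Rightarrow> complex" where
  "cont_rep \<phi> = (THE g. continuous_on UNIV g \<and> (AE x in lebesgue. g x = \<phi> x))"

text \<open>\<open>pot_quad V \<phi>\<close> is \<open>\<integral> V |\<phi>|\<^sup>2 dx\<close>, and \<open>pot_pairing V \<phi> v\<close> is \<open>\<integral> V \<phi> v\<^sup>* dx\<close>, i.e. the
  element \<open>V \<phi>\<close> of the dual space of \<open>H1\<close> applied to \<open>v\<^sup>*\<close>.\<close>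

fun pot_quad :: "'a::euclidean_space potential \<Rightarrow> ('a \<Rightarrow> complex) \<Rightarrow> real" where
  "pot_quad (FunPot f) \<phi> = (\<integral>x. f x * (cmod (\<phi> x))\<^sup>2 \<partial>lebesgue)"
| "pot_quad (MeasPot \<mu> \<nu> W) \<phi> =
     (\<integral>x. (cmod (cont_rep \<phi> x))\<^sup>2 \<partial>\<mu>) - (\<integral>x. (cmod (cont_rep \<phi> x))\<^sup>2 \<partial>\<nu>)
     + (\<integral>x. W x * (cmod (\<phi> x))\<^sup>2 \<partial>lebesgue)"

fun pot_pairing :: "'a::euclidean_space potential \<Rightarrow> ('a \<Rightarrow> complex) \<Rightarrow> ('a \<Rightarrow> complex) \<Rightarrow> complex" where
  "pot_pairing (FunPot f) \<phi> v = (\<integral>x. of_real (f x) * \<phi> x * cnj (v x) \<partial>lebesgue)"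
| "pot_pairing (MeasPot \<mu> \<nu> W) \<phi> v =
     (\<integral>x. cont_rep \<phi> x * cnj (cont_rep v x) \<partial>\<mu>) - (\<integral>x. cont_rep \<phi> x * cnj (cont_rep v x) \<partial>\<nu>)
     + (\<integral>x. of_real (W x) * \<phi> x * cnj (v x) \<partial>lebesgue)"

definition vanishes_at_infinity :: "('a::euclidean_space \<Rightarrow> real) \<Rightarrow> bool" where
  "vanishes_at_infinity f \<longleftrightarrow> (\<forall>a>0. emeasure lebesgue {x. \<bar>f x\<bar> > a} < \<infinity>)"

definition in_Lq_plus_Linf :: "real \<Rightarrow> ('a::euclidean_space \<Rightarrow> real) \<Rightarrow> bool" where
  "in_Lq_plus_Linf q f \<longleftrightarrow>
     (\<exists>g\<in>Lp_space q. \<exists>h\<in>Linf_space. f = (\<lambda>x. g x + h x))"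

definition finite_borel_measure :: "'a::euclidean_space measure \<Rightarrow> bool" where
  "finite_borel_measure \<mu> \<longleftrightarrow> sets \<mu> = sets borel \<and> finite_measure \<mu>"

fun regular_potential :: "'a::euclidean_space potential \<Rightarrow> bool" where
  "regular_potential (FunPot f) \<longleftrightarrow>
     (\<exists>q. (if DIM('a) = 1 then q = 1 else if DIM('a) = 2 then q > 1 else q = real DIM('a) / 2) \<and>
          in_Lq_plus_Linf q f) \<and>
     vanishes_at_infinity f"
| "regular_potential (MeasPot \<mu> \<nu> W) \<longleftrightarrow>
     DIM('a) = 1 \<and> finite_borel_measure \<mu> \<and> finite_borel_measure \<nu> \<and>
     W \<in> Linf_space \<and> vanishes_at_infinity W"

definition nonpositive_potential :: "'a::euclidean_space potential \<Rightarrow> bool" where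
  "nonpositive_potential V \<longleftrightarrow> (\<forall>\<psi>\<in>H1. pot_quad V \<psi> \<le> 0)"

section \<open>Action, Nehari manifold and the GFDN-BF scheme\<close>

text \<open>Extended-real valued, so that no boundedness of the infimum is presupposed.\<close>

definition omega0 :: "'a::euclidean_space potential \<Rightarrow> ereal" where
  "omega0 V = - (INF \<phi> \<in> {\<phi> \<in> H1. Lp_norm 2 \<phi> = 1}. ereal (grad_norm_sq \<phi> + pot_quad V \<phi>))"

definition Istar :: "'a::euclidean_space potential \<Rightarrow> real \<Rightarrow> ('a \<Rightarrow> complex) \<Rightarrow> real" where
  "Istar V \<omega> \<phi> =
     grad_norm_sq \<phi> + pot_quad V \<phi> + \<omega> * (\<integral>x. (cmod (\<phi> x))\<^sup>2 \<partial>lebesgue)"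

definition action :: "'a::euclidean_space potential \<Rightarrow> real \<Rightarrow> real \<Rightarrow> ('a \<Rightarrow> complex) \<Rightarrow> real" where
  "action V \<alpha> \<omega> \<phi> =
     grad_norm_sq \<phi> + pot_quad V \<phi> + \<omega> * (\<integral>x. (cmod (\<phi> x))\<^sup>2 \<partial>lebesgue)
     - 1 / (\<alpha> + 1) * (\<integral>x. cmod (\<phi> x) powr (2 * \<alpha> + 2) \<partial>lebesgue)"

definition Ifun :: "'a::euclidean_space potential \<Rightarrow> real \<Rightarrow> real \<Rightarrow> ('a \<Rightarrow> complex) \<Rightarrow> real" where
  "Ifun V \<alpha> \<omega> \<phi> = Istar V \<omega> \<phi> - Lp_norm (2 * \<alpha> + 2) \<phi> powr (2 * \<alpha> + 2)"

definition Nehari :: "'a::euclidean_space potential \<Rightarrow> real \<Rightarrow> real \<Rightarrow> ('a \<Rightarrow> complex) set" where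
  "Nehari V \<alpha> \<omega> =
     {\<phi> \<in> H1. \<not> (AE x in lebesgue. \<phi> x = 0) \<and> Ifun V \<alpha> \<omega> \<phi> = 0}"

text \<open>One semi-implicit step \<open>(\<psi> - \<phi>) / \<tau> = \<Delta>\<psi> - \<omega> \<psi> - V \<phi> + |\<phi>|\<^bsup>2\<alpha>\<^esup> \<phi>\<close> with \<open>\<psi> \<in> H1\<close>, as an
  equation between functionals on \<open>H1\<close>.\<close>

definition weak_step ::
  "'a::euclidean_space potential \<Rightarrow> real \<Rightarrow> real \<Rightarrow> real \<Rightarrow> ('a \<Rightarrow> complex) \<Rightarrow> ('a \<Rightarrow> complex) \<Rightarrow> bool" where
  "weak_step V \<alpha> \<omega> \<tau> \<phi> \<psi> \<longleftrightarrow> \<psi> \<in> H1 \<and>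
     (\<forall>v\<in>H1. L2_inner (\<lambda>x. (\<psi> x - \<phi> x) / of_real \<tau>) v =
        - grad_inner \<psi> v - of_real \<omega> * L2_inner \<psi> v - pot_pairing V \<phi> v
        + L2_inner (\<lambda>x. of_real (cmod (\<phi> x) powr (2 * \<alpha>)) * \<phi> x) v)"

definition norm_factor :: "'a::euclidean_space potential \<Rightarrow> real \<Rightarrow> real \<Rightarrow> ('a \<Rightarrow> complex) \<Rightarrow> real" where
  "norm_factor V \<alpha> \<omega> \<psi> =
     (Istar V \<omega> \<psi> / Lp_norm (2 * \<alpha> + 2) \<psi> powr (2 * \<alpha> + 2)) powr (1 / (2 * \<alpha>))"

text \<open>In \<open>GFDN_BF\<close>, \<open>\<phi> n\<close> is the \<open>n\<close>-th iterate and \<open>\<phi>t n\<close> (used for \<open>n \<ge> 1\<close> only) the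
  intermediate iterate before normalization.\<close>

definition GFDN_BF ::
  "'a::euclidean_space potential \<Rightarrow> real \<Rightarrow> real \<Rightarrow> real \<Rightarrow> ('a \<Rightarrow> complex) \<Rightarrow>
   (nat \<Rightarrow> 'a \<Rightarrow> complex) \<Rightarrow> (nat \<Rightarrow> 'a \<Rightarrow> complex) \<Rightarrow> bool" where
  "GFDN_BF V \<alpha> \<omega> \<tau> \<phi>0 \<phi> \<phi>t \<longleftrightarrow>
     \<phi> 0 = \<phi>0 \<and>
     (\<forall>n. weak_step V \<alpha> \<omega> \<tau> (\<phi> n) (\<phi>t (Suc n)) \<and>
          (AE x in lebesgue. \<phi> (Suc n) x = of_real (norm_factor V \<alpha> \<omega> (\<phi>t (Suc n))) * \<phi>t (Suc n) x))"

end

theory Submission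
  imports Defs "HOL-Probability.Probability_Measure"
begin

text \<open>
  Write \<open>u = \<phi>\<^sup>n\<close>, \<open>v\<close> for the intermediate iterate, \<open>p = 2\<alpha> + 2\<close>, \<open>I\<^sup>*\<close> for the quadratic part of
  the action and \<open>N = Re \<integral> |u|\<^bsup>2\<alpha>\<^esup> u v\<^sup>*\<close>.  Testing the step equation with \<open>u\<close> and with \<open>v\<close>, and using
  \<open>\<integral> V |v - u|\<^sup>2 \<le> 0\<close>, gives \<open>I\<^sup>*(v) \<le> 2 N - \<parallel>u\<parallel>\<^sub>p\<^sup>p\<close>.  By Hoelder's inequality and
  \<open>2 Y X - Y\<^sup>2 \<le> X\<^sup>2\<close> for \<open>Y = \<parallel>u\<parallel>\<^sub>p\<close>, \<open>X = \<parallel>v\<parallel>\<^sub>p\<close> this yields \<open>I\<^sup>*(v) / X\<^sup>2 \<le> Y\<^bsup>p - 2\<^esup>\<close>, which is the claim,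
  since the action on the Nehari manifold is a multiple of \<open>\<parallel>\<cdot>\<parallel>\<^sub>p\<^sup>p\<close>.

  Expanding \<open>\<integral> V |v - u|\<^sup>2\<close> requires \<open>V |u|\<^sup>2\<close> to be integrable for \<open>u \<in> H\<^sup>1\<close>.  Instead of a Sobolev
  embedding this uses \<open>V \<le> 0\<close> almost everywhere, the inequality \<open>\<integral> |V| |w|\<^sup>2 \<le> \<parallel>\<nabla>w\<parallel>\<^sup>2 + \<omega> \<parallel>w\<parallel>\<^sup>2\<close>
  contained in \<open>\<omega> > \<omega>\<^sub>0\<close>, and Fatou's lemma along bounded \<open>w\<close> obtained by averaging \<open>u\<close> over
  small balls.  If \<open>|v|\<^sup>p\<close> is not integrable, the formal value of \<open>\<parallel>v\<parallel>\<^sub>p\<close> is \<open>0\<close>, hence so are the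
  normalization factor and all later iterates, and the inequality holds trivially.
\<close>

section \<open>Smooth functions with compact support\<close>

text \<open>Integrals are total and equal 0 when they diverge, so every expansion of a quadratic
  form must come with integrability; most of the analysis below serves this. The sign of V is given
  only as a quadratic form. Turning it into a sign almost everywhere needs explicit elements of
  \<open>H1\<close> approximating indicators, hence bump functions smooth in the sense of
  \<open>Ck\<close>, and integration by parts for them. Convergence of averages and regularity in
  \<open>H1\<close> both rest on one formula: u(x + y) - u(x) is the integral over s in [0,1] of y .
  grad u(x + s y). It gives ||u(. + y) - u|| \<le> |y| ||grad u|| in L2, so ball averages converge;
  in dimension one it gives Hoelder continuity of order 1/2, hence the bounded continuous
  representative against which measure potentials are integrated. Ball averages suit Fatou's lemma
  because, by Jensen, neither mass nor gradient energy grows, so the bound on the integral of |V|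
  |w|^2 is uniform. Any step size is admissible because 1/\<open>\<tau>\<close> enters only through
  the nonnegative term (2/\<open>\<tau>\<close>) ||v - u||^2.\<close>

lemma partial_deriv_eqI:
  assumes "\<And>x. (f has_derivative D x) (at x)"
  shows "partial_deriv b f = (\<lambda>x. D x b)"
  unfolding partial_deriv_def using frechet_derivative_at[OF assms] by metis

lemma Ck_const: "Ck k (\<lambda>x. c)"
  by (induction k arbitrary: c) (auto simp: partial_deriv_eqI[of _ "\<lambda>x h. 0"])

text \<open>\<open>Ck (Suc k)\<close> speaks only of derivatives, so lower orders are recovered by
  descending to the partial derivatives; at the bottom, differentiability supplies
  continuity.\<close>

lemma Ck_Suc_imp: "Ck (Suc k) f \<Longrightarrow> Ck k f"
proof (induction k arbitrary: f)
  case 0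
  then show ?case
    by (auto intro: continuous_at_imp_continuous_on differentiable_imp_continuous_within)
next
  case (Suc k)
  then show ?case by (metis Ck.simps(2))
qed

lemma Ck_SucD: "Ck (Suc k) f \<Longrightarrow> f differentiable (at x)"
  and Ck_SucD2: "Ck (Suc k) f \<Longrightarrow> b \<in> Basis \<Longrightarrow> Ck k (partial_deriv b f)"
  by auto

lemma has_derivative_frechet: "f differentiable (at x) \<Longrightarrow> (f has_derivative frechet_derivative f (at x)) (at x)"
  by (simp add: frechet_derivative_works)

lemma partial_deriv_add:
  assumes "\<And>x. f differentiable (at x)" "\<And>x. g differentiable (at x)"
  shows "partial_deriv b (\<lambda>x. f x + g x) = (\<lambda>x. partial_deriv b f x + partial_deriv b g x)"
  by (subst partial_deriv_eqI[OF has_derivative_add[OF has_derivative_frechet has_derivative_frechet]])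
    (use assms in \<open>auto simp: partial_deriv_def\<close>)

lemma partial_deriv_mult:
  assumes "\<And>x. f differentiable (at x)" "\<And>x. g differentiable (at x)"
  shows "partial_deriv b (\<lambda>x. f x * g x) = (\<lambda>x. f x * partial_deriv b g x + partial_deriv b f x * g x)"
  by (subst partial_deriv_eqI[OF has_derivative_mult[OF has_derivative_frechet has_derivative_frechet]])
    (use assms in \<open>auto simp: partial_deriv_def\<close>)

lemma Ck_add: "Ck k f \<Longrightarrow> Ck k g \<Longrightarrow> Ck k (\<lambda>x. f x + g x)"
proof (induction k arbitrary: f g)
  case 0
  then show ?case by (auto intro: continuous_intros)
next
  case (Suc k)
  then show ?case by (auto simp: partial_deriv_add)
qed

lemma Ck_mult: "Ck k f \<Longrightarrow> Ck k g \<Longrightarrow> Ck k (\<lambda>x. f x * g x)"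
proof (induction k arbitrary: f g)
  case 0
  then show ?case by (auto intro: continuous_intros)
next
  case (Suc k)
  have "Ck k f" "Ck k g" using Suc.prems Ck_Suc_imp by auto
  with Suc show ?case by (auto simp: partial_deriv_mult intro!: Ck_add)
qed

lemma Ck_prod: "(\<And>i. i \<in> A \<Longrightarrow> Ck k (f i)) \<Longrightarrow> Ck k (\<lambda>x. \<Prod>i\<in>A. f i x)"
  by (induction A rule: infinite_finite_induct) (auto intro: Ck_const Ck_mult)

lemma has_derivative_translate:
  assumes "f differentiable (at (x + a))"
  shows "((\<lambda>x. f (x + a)) has_derivative frechet_derivative f (at (x + a))) (at x)"
  by (rule has_derivative_compose[where f="\<lambda>x. x + a" and f'="\<lambda>h. h", OF _ has_derivative_frechet[OF assms]])
    (auto intro!: derivative_eq_intros)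

lemma partial_deriv_translate:
  assumes "\<And>x. f differentiable (at x)"
  shows "partial_deriv b (\<lambda>x. f (x + a)) = (\<lambda>x. partial_deriv b f (x + a))"
  by (subst partial_deriv_eqI[OF has_derivative_translate[OF assms]]) (simp add: partial_deriv_def)

lemma Ck_translate: "Ck k f \<Longrightarrow> Ck k (\<lambda>x. f (x + a))"
proof (induction k arbitrary: f)
  case 0
  then show ?case by (auto intro!: continuous_intros continuous_on_compose2[of UNIV f])
next
  case (Suc k)
  have "(\<lambda>x. f (x + a)) differentiable (at x)" for x
    using has_derivative_translate[OF Ck_SucD[OF Suc.prems]] by (auto simp: differentiable_def)
  then show ?case
    using Suc partial_deriv_translate[OF Ck_SucD[OF Suc.prems]] by auto
qed

section \<open>Flat exponentials and smooth bumps on boxes\<close>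

definition flat_exp :: "real poly \<Rightarrow> real \<Rightarrow> real" where
  "flat_exp p t = (if t > 0 then poly p (1 / t) * exp (- (1 / t)) else 0)"

lemma poly_mult_exp_tendsto_0: "((\<lambda>s::real. poly p s * exp (- s)) \<longlongrightarrow> 0) at_top"
proof -
  have "((\<lambda>s. \<Sum>i\<le>degree p. coeff p i * (s ^ i / exp s)) \<longlongrightarrow> (\<Sum>i\<le>degree p. coeff p i * 0)) at_top"
    by (intro tendsto_intros tendsto_power_div_exp_0)
  then show ?thesis
    by (simp add: poly_altdef exp_minus field_simps sum_divide_distrib)
qed

lemma flat_exp_tendsto_0: "((\<lambda>t. flat_exp p t) \<longlongrightarrow> 0) (at 0)"
proof -
  have "((\<lambda>t. poly p (1 / t) * exp (- (1 / t))) \<longlongrightarrow> 0) (at_right 0)"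
    using filterlim_compose[OF poly_mult_exp_tendsto_0[of p] filterlim_inverse_at_top_right]
    by (simp add: inverse_eq_divide)
  then have "((\<lambda>t. flat_exp p t) \<longlongrightarrow> 0) (at_right 0)"
    by (rule Lim_transform_eventually)
      (auto simp: eventually_at_filter flat_exp_def)
  moreover have "((\<lambda>t. flat_exp p t) \<longlongrightarrow> 0) (at_left 0)"
    by (rule Lim_transform_eventually[OF tendsto_const])
      (auto simp: eventually_at_filter flat_exp_def)
  ultimately show ?thesis by (simp add: filterlim_split_at)
qed

text \<open>With s = 1/t, the t-derivative of p(s) exp(-s) is s^2 (p(s) - p'(s)) exp(-s): the family
  is closed under differentiation, which is why \<open>flat_exp\<close> carries a
  polynomial.\<close>

lemma flat_exp_has_derivative:
  "(flat_exp p has_field_derivative flat_exp ((p - pderiv p) * monom 1 2) t) (at t)"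
proof (cases t "0::real" rule: linorder_cases)
  case greater
  have "((\<lambda>t. poly p (1 / t) * exp (- (1 / t))) has_field_derivative
     flat_exp ((p - pderiv p) * monom 1 2) t) (at t)"
    using greater
    by (auto intro!: derivative_eq_intros DERIV_chain2[OF poly_DERIV]
        simp: flat_exp_def poly_monom field_simps power2_eq_square)
  then show ?thesis
    by (rule has_field_derivative_transform_within_open[of _ _ _ "{0<..}"])
      (use greater in \<open>auto simp: flat_exp_def\<close>)
next
  case less
  have "((\<lambda>t. 0) has_field_derivative 0) (at t)" by simp
  then have "(flat_exp p has_field_derivative 0) (at t)"
    by (rule has_field_derivative_transform_within_open[of _ _ _ "{..<0}"])
      (use less in \<open>auto simp: flat_exp_def\<close>)
  then show ?thesis using less by (simp add: flat_exp_def)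
next
  case equal
  \<comment> \<open>Dividing by h multiplies p(1/h) by its variable 1/h, and
    \<open>pCons 0 p\<close> is that product.\<close>
  have "((\<lambda>h. (flat_exp p (0 + h) - flat_exp p 0) / h) \<longlongrightarrow> 0) (at 0)"
    using flat_exp_tendsto_0[of "pCons 0 p"]
    by (rule Lim_transform_eventually) (auto simp: eventually_at_filter flat_exp_def)
  then show ?thesis using equal by (simp add: DERIV_def flat_exp_def)
qed

text \<open>Generalizing over p closes the induction, since each partial derivative is a constant
  times a \<open>flat_exp\<close> with another polynomial. The affine argument covers every factor
  of a bump.\<close>

lemma Ck_flat_exp: "Ck k (\<lambda>x::'a::euclidean_space. flat_exp p (x \<bullet> u + c))"
proof (induction k arbitrary: p)
  case 0
  have "continuous_on UNIV (flat_exp p)"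
    by (auto intro: continuous_at_imp_continuous_on DERIV_isCont[OF flat_exp_has_derivative])
  then show ?case by (auto intro!: continuous_intros continuous_on_compose2[of UNIV "flat_exp p"])
next
  case (Suc k)
  let ?q = "(p - pderiv p) * monom 1 2"
  have d: "((\<lambda>x::'a. flat_exp p (x \<bullet> u + c)) has_derivative (\<lambda>h. (h \<bullet> u) * flat_exp ?q (x \<bullet> u + c))) (at x)" for x
  proof -
    have "((\<lambda>x::'a. x \<bullet> u + c) has_derivative (\<lambda>h. h \<bullet> u)) (at x)"
      by (auto intro!: derivative_eq_intros)
    from has_derivative_compose[OF this flat_exp_has_derivative[unfolded has_field_derivative_def]]
    show ?thesis by (simp add: mult.commute)
  qed
  then have "(\<lambda>x. flat_exp p (x \<bullet> u + c)) differentiable (at x)" for x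
    by (auto simp: differentiable_def)
  moreover have "partial_deriv b (\<lambda>x. flat_exp p (x \<bullet> u + c)) = (\<lambda>x. (b \<bullet> u) * flat_exp ?q (x \<bullet> u + c))" for b
    by (subst partial_deriv_eqI[OF d]) simp
  ultimately show ?case using Suc by (auto intro!: Ck_mult Ck_const)
qed

text \<open>Inside the box the factors are exp(-1/(n d)), where d is the distance of x to a face
  hyperplane; growing n sharpens the bump towards the indicator of the box. The arguments have the
  shape \<open>x \<bullet> u + c\<close> so that \<open>Ck_flat_exp\<close> applies
  literally.\<close>

definition box_bump :: "'a::euclidean_space \<Rightarrow> 'a \<Rightarrow> real \<Rightarrow> 'a \<Rightarrow> real" where
  "box_bump l u n x = (\<Prod>b\<in>Basis. flat_exp 1 (x \<bullet> (n *\<^sub>R b) + (- n * (l \<bullet> b)))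
     * flat_exp 1 (x \<bullet> (- n *\<^sub>R b) + n * (u \<bullet> b)))"

lemma flat_exp_1_bounds: "0 \<le> flat_exp 1 t" "flat_exp 1 t \<le> 1"
  by (auto simp: flat_exp_def)

lemma Ck_box_bump: "Ck k (box_bump l u n)"
  unfolding box_bump_def[abs_def] by (intro Ck_prod Ck_mult Ck_flat_exp)

lemma box_bump_bounds: "0 \<le> box_bump l u n x" "box_bump l u n x \<le> 1"
  unfolding box_bump_def
  by (auto intro!: prod_nonneg prod_le_1 mult_nonneg_nonneg mult_le_one flat_exp_1_bounds)

lemma box_bump_outside: "n > 0 \<Longrightarrow> x \<notin> box l u \<Longrightarrow> box_bump l u n x = 0"
proof -
  assume n: "n > 0" and "x \<notin> box l u"
  then obtain b where b: "b \<in> Basis" "x \<bullet> b \<le> l \<bullet> b \<or> u \<bullet> b \<le> x \<bullet> b"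
    by (force simp: mem_box)
  then have "x \<bullet> (n *\<^sub>R b) + (- n * (l \<bullet> b)) \<le> 0 \<or> x \<bullet> (- n *\<^sub>R b) + n * (u \<bullet> b) \<le> 0"
    using n by (auto simp: mult_left_mono)
  then have "flat_exp 1 (x \<bullet> (n *\<^sub>R b) + (- n * (l \<bullet> b))) * flat_exp 1 (x \<bullet> (- n *\<^sub>R b) + n * (u \<bullet> b)) = 0"
    by (auto simp: flat_exp_def simp del: inner_simps)
  with b(1) show ?thesis unfolding box_bump_def by (intro prod_zero) auto
qed

lemma box_bump_tendsto: "x \<in> box l u \<Longrightarrow> ((\<lambda>n. box_bump l u n x) \<longlongrightarrow> 1) at_top"
proof -
  assume x: "x \<in> box l u"
  have *: "((\<lambda>n. flat_exp 1 (n * c)) \<longlongrightarrow> 1) at_top" if "c > 0" for c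
  proof -
    have "((\<lambda>n::real. exp (- (1 / (n * c)))) \<longlongrightarrow> exp (- 0)) at_top"
      by (intro tendsto_intros tendsto_divide_0[OF tendsto_const] filterlim_at_top_imp_at_infinity
          filterlim_at_top_mult_tendsto_pos[OF tendsto_const that filterlim_ident, THEN filterlim_cong[THEN iffD1, rotated -1]])
        (auto simp: mult.commute)
    then have "((\<lambda>n::real. exp (- (1 / (n * c)))) \<longlongrightarrow> 1) at_top" by simp
    moreover have "\<forall>\<^sub>F n::real in at_top. exp (- (1 / (n * c))) = flat_exp 1 (n * c)"
      using eventually_gt_at_top[of 0] by eventually_elim (use that in \<open>simp add: flat_exp_def\<close>)
    ultimately show ?thesis by (rule Lim_transform_eventually)
  qed
  have "((\<lambda>n. \<Prod>b\<in>Basis. flat_exp 1 (n * (x \<bullet> b - l \<bullet> b)) * flat_exp 1 (n * (u \<bullet> b - x \<bullet> b)))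
     \<longlongrightarrow> (\<Prod>b\<in>(Basis::'a set). 1 * 1)) at_top"
    using x by (intro tendsto_prod tendsto_mult *) (auto simp: mem_box)
  then show ?thesis unfolding box_bump_def by (simp add: algebra_simps)
qed

lemma test_functionI:
  assumes "\<And>k. Ck k \<eta>" "bounded U" "\<And>x. x \<notin> U \<Longrightarrow> \<eta> x = 0"
  shows "test_function \<eta>"
  unfolding test_function_def compact_closure using assms
  by (auto intro: bounded_subset[of U])

text \<open>With an open set written as a union of boxes \<open>B\<^sub>i\<close> and bumps \<open>\<beta>\<^sub>i\<close> on them, the functions
  \<open>1 - (1 - \<beta>\<^sub>0) \<cdots> (1 - \<beta>\<^sub>k)\<close> do the job.\<close>

lemma open_indicator_test_limit:
  fixes U :: "'a::euclidean_space set"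
  assumes "open U" "bounded U"
  obtains \<eta> :: "nat \<Rightarrow> 'a \<Rightarrow> real" where
    "\<And>k. test_function (\<eta> k)" "\<And>k x. 0 \<le> \<eta> k x" "\<And>k x. \<eta> k x \<le> 1"
    "\<And>k x. x \<notin> U \<Longrightarrow> \<eta> k x = 0"
    "\<And>x. x \<in> U \<Longrightarrow> (\<lambda>k. \<eta> k x) \<longlonglongrightarrow> 1"
proof (cases "U = {}")
  case True
  have "test_function (\<lambda>_::'a. 0::real)" by (intro test_functionI[of _ "{}"]) (auto intro: Ck_const)
  with True show ?thesis by (intro that[of "\<lambda>_ _. 0"]) auto
next
  case False
  obtain D where D: "countable D" "D \<subseteq> Pow U" "\<And>X. X \<in> D \<Longrightarrow> \<exists>a b. X = box a b" "\<Union>D = U"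
    using open_countable_Union_open_box[OF assms(1)] by metis
  have "D \<noteq> {}" using False D(4) by auto
  then obtain X where X: "D = range (X :: nat \<Rightarrow> _)" using D(1) by (metis range_from_nat_into)
  have "\<exists>l u. X i = box l u" for i using D(3) X by auto
  then obtain l u where lu: "\<And>i. X i = box (l i) (u i)" by metis
  \<comment> \<open>Writing \<open>1 + (- 1) * _\<close> for a difference lets closure of
    \<open>Ck\<close> under sums and products suffice. The sharpness \<open>Suc k\<close> grows
    together with the number of boxes.\<close>
  define \<eta> where "\<eta> k x = 1 + (- 1) * (\<Prod>i<Suc k. 1 + (- 1) * box_bump (l i) (u i) (real (Suc k)) x)" for k x
  have b: "0 \<le> (\<Prod>i<Suc k. 1 + (- 1) * box_bump (l i) (u i) (real (Suc k)) x)"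
     "(\<Prod>i<Suc k. 1 + (- 1) * box_bump (l i) (u i) (real (Suc k)) x) \<le> 1" for k x
    using box_bump_bounds by (auto intro!: prod_nonneg prod_le_1 simp del: prod.lessThan_Suc)
  have out: "\<eta> k x = 0" if "x \<notin> U" for k x
  proof -
    have "x \<notin> box (l i) (u i)" for i using that D(4) X lu by auto
    then show ?thesis unfolding \<eta>_def by (simp add: box_bump_outside del: prod.lessThan_Suc)
  qed
  show ?thesis
  proof (rule that[of \<eta>])
    show "test_function (\<eta> k)" for k
      by (rule test_functionI[OF _ assms(2)]) 
        (use out in \<open>unfold \<eta>_def[abs_def], (intro Ck_add Ck_mult Ck_const Ck_prod Ck_box_bump | blast)+\<close>)
    show "0 \<le> \<eta> k x" "\<eta> k x \<le> 1" for k x using b[of k x] unfolding \<eta>_def by linarith+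
    show "\<eta> k x = 0" if "x \<notin> U" for k x using out[OF that] .
    show "(\<lambda>k. \<eta> k x) \<longlonglongrightarrow> 1" if x: "x \<in> U" for x
    proof -
      obtain j where j: "x \<in> box (l j) (u j)" using x D(4) X lu by auto
      have lim: "(\<lambda>k. box_bump (l j) (u j) (real (Suc k)) x) \<longlonglongrightarrow> 1"
        using filterlim_compose[OF box_bump_tendsto[OF j] filterlim_compose[OF filterlim_real_sequentially filterlim_Suc]] .
      have "\<forall>\<^sub>F k in sequentially. box_bump (l j) (u j) (real (Suc k)) x \<le> \<eta> k x"
        using eventually_ge_at_top[of j]
      proof eventually_elim
        case (elim k)
        let ?f = "\<lambda>i. 1 + (- 1) * box_bump (l i) (u i) (real (Suc k)) x"
        \<comment> \<open>Isolating the factor of the box that contains x bounds the product by 1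
          minus the bump of that box, so \<open>\<eta> k x\<close> lies above a quantity tending to
          1.\<close>
        have "(\<Prod>i<Suc k. ?f i) = ?f j * (\<Prod>i\<in>{..<Suc k} - {j}. ?f i)"
          using elim by (intro prod.remove) auto
        also have "\<dots> \<le> ?f j * 1"
          using box_bump_bounds by (intro mult_left_mono prod_le_1) auto
        finally show ?case unfolding \<eta>_def by (simp del: prod.lessThan_Suc of_nat_Suc)
      qed
      then show ?thesis
        by (rule tendsto_sandwich[OF _ _ lim tendsto_const])
          (use b in \<open>auto simp: \<eta>_def simp del: prod.lessThan_Suc of_nat_Suc\<close>)
    qed
  qed
qed

section \<open>Weak derivatives\<close>

definition loc_integrable :: "('a::euclidean_space \<Rightarrow> 'b::{banach,second_countable_topology}) \<Rightarrow> bool" where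
  "loc_integrable f \<longleftrightarrow> f \<in> borel_measurable lebesgue \<and> (\<forall>R. set_integrable lebesgue (ball 0 R) f)"

lemma test_function_continuous: "test_function \<eta> \<Longrightarrow> continuous_on UNIV \<eta>"
  unfolding test_function_def using Ck.simps(1) by blast

lemma test_function_measurable: "test_function \<eta> \<Longrightarrow> \<eta> \<in> borel_measurable lebesgue"
  using measurable_completion[of \<eta> lborel borel] borel_measurable_continuous_onI[OF test_function_continuous, of \<eta>] by simp

lemma test_function_Ck: "test_function \<eta> \<Longrightarrow> Ck k \<eta>"
  unfolding test_function_def by blast

lemma test_function_differentiable: "test_function \<eta> \<Longrightarrow> \<eta> differentiable (at x)"
  using Ck_SucD[OF test_function_Ck] .

lemma test_function_support:
  fixes \<eta> :: "'a::euclidean_space \<Rightarrow> real"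
  assumes "test_function \<eta>"
  obtains R where "R > 0" "\<And>x. x \<notin> ball 0 R \<Longrightarrow> \<eta> x = 0"
proof -
  have "bounded {x. \<eta> x \<noteq> 0}"
    using assms bounded_subset closure_subset compact_imp_bounded unfolding test_function_def by metis
  then obtain R where "0 < R" "{x. \<eta> x \<noteq> 0} \<subseteq> ball 0 R"
    by (meson bounded_subset_ballD)
  then show ?thesis by (intro that[of R]) auto
qed

lemma test_function_bounded:
  assumes "test_function \<eta>"
  obtains M where "M > 0" "\<And>x. \<bar>\<eta> x\<bar> \<le> M"
proof -
  obtain R where R: "\<And>x. x \<notin> ball 0 R \<Longrightarrow> \<eta> x = 0"
    using test_function_support[OF assms] by metis
  have "compact (\<eta> ` cball 0 R)"
    by (intro compact_continuous_image continuous_on_subset[OF test_function_continuous[OF assms]]) auto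
  then obtain M where M: "M > 0" "\<And>x. x \<in> \<eta> ` cball 0 R \<Longrightarrow> norm x \<le> M"
    using compact_imp_bounded bounded_pos by metis
  show ?thesis
  proof (rule that[of M])
    show "\<bar>\<eta> x\<bar> \<le> M" for x
      using M R[of x] by (cases "x \<in> ball 0 R") auto
  qed fact
qed

lemma test_function_mult: "test_function \<eta> \<Longrightarrow> test_function \<zeta> \<Longrightarrow> test_function (\<lambda>x. \<eta> x * \<zeta> x)"
proof -
  assume *: "test_function \<eta>" "test_function \<zeta>"
  obtain R where R: "\<And>x. x \<notin> ball 0 R \<Longrightarrow> \<eta> x = 0"
    using test_function_support[OF *(1)] by metis
  show ?thesis
    by (rule test_functionI[of _ "ball 0 R"]) (use R * in \<open>auto intro: Ck_mult test_function_Ck\<close>)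
qed

lemma test_function_partial_deriv:
  fixes \<eta> :: "'a::euclidean_space \<Rightarrow> real"
  assumes "test_function \<eta>" "b \<in> Basis"
  shows "test_function (partial_deriv b \<eta>)"
proof -
  obtain R where R: "\<And>x. x \<notin> ball 0 R \<Longrightarrow> \<eta> x = 0"
    using test_function_support[OF assms(1)] by metis
  show ?thesis
  proof (rule test_functionI[of _ "cball 0 R"])
    show "Ck k (partial_deriv b \<eta>)" for k
      using Ck_SucD2[OF test_function_Ck[OF assms(1)] assms(2)] .
    fix x :: 'a assume x: "x \<notin> cball 0 R"
    have "((\<lambda>_. 0) has_derivative (\<lambda>_. 0)) (at x)" by simp
    then have "(\<eta> has_derivative (\<lambda>_. 0)) (at x)"
      by (rule has_derivative_transform_within_open[of _ _ _ _ "- cball 0 R"]) (use x R in auto)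
    then show "partial_deriv b \<eta> x = 0"
      unfolding partial_deriv_def using frechet_derivative_at by metis
  qed auto
qed

lemma test_function_translate:
  assumes "test_function \<eta>"
  shows "test_function (\<lambda>x. \<eta> (x + a))"
proof -
  obtain R where R: "\<And>x. x \<notin> ball 0 R \<Longrightarrow> \<eta> x = 0"
    using test_function_support[OF assms] by metis
  show ?thesis
  proof (rule test_functionI[of _ "ball (-a) R"])
    show "\<eta> (x + a) = 0" if "x \<notin> ball (- a) R" for x
      by (rule R) (use that in \<open>simp add: dist_norm norm_minus_commute add.commute\<close>)
  qed (use assms in \<open>auto intro: Ck_translate test_function_Ck\<close>)
qed

lemma loc_integrable_test:
  assumes "loc_integrable f" "test_function \<eta>"
  shows "integrable lebesgue (\<lambda>x. \<eta> x *\<^sub>R f x)"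
proof -
  obtain R where R: "\<And>x. x \<notin> ball 0 R \<Longrightarrow> \<eta> x = 0"
    using test_function_support[OF assms(2)] by metis
  obtain M where M: "\<And>x. \<bar>\<eta> x\<bar> \<le> M" 
    using test_function_bounded[OF assms(2)] by metis
  have [measurable]: "f \<in> borel_measurable lebesgue" "\<eta> \<in> borel_measurable lebesgue"
    using assms by (auto simp: loc_integrable_def intro: test_function_measurable)
  have *: "integrable lebesgue (\<lambda>x. M *\<^sub>R (indicator (ball 0 R) x *\<^sub>R f x))"
    using assms(1) unfolding loc_integrable_def set_integrable_def by (intro integrable_scaleR_right) auto
  show ?thesis
  proof (rule Bochner_Integration.integrable_bound[OF *])
    show "AE x in lebesgue. norm (\<eta> x *\<^sub>R f x) \<le> norm (M *\<^sub>R (indicator (ball 0 R) x *\<^sub>R f x))"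
    proof (intro AE_I2)
      fix x
      have "\<bar>\<eta> x\<bar> * norm (f x) \<le> \<bar>M\<bar> * norm (f x)" using M[of x] by (intro mult_right_mono) auto
      then show "norm (\<eta> x *\<^sub>R f x) \<le> norm (M *\<^sub>R (indicator (ball 0 R) x *\<^sub>R f x))"
        using R[of x] by (cases "x \<in> ball 0 R") auto
    qed
  qed measurable
qed

lemma loc_integrable_const: "loc_integrable (\<lambda>x::'a::euclidean_space. 1::real)"
  unfolding loc_integrable_def set_integrable_def
  using emeasure_lborel_ball_finite[of "0::'a"] by (auto intro!: integrable_real_indicator simp: less_top)

text \<open>Squares appear in the hypothesis because the sign of a potential is known only against
  squared moduli. Squares of functions tending to the indicator of U tend to it as well, with |f| on
  a ball as majorant.\<close>

lemma integral_open_nonpos: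
  fixes f :: "'a::euclidean_space \<Rightarrow> real"
  assumes f: "loc_integrable f" 
    and le: "\<And>\<eta>. test_function \<eta> \<Longrightarrow> (\<integral>x. (\<eta> x)\<^sup>2 * f x \<partial>lebesgue) \<le> 0"
    and U: "open U" "bounded U"
  shows "(\<integral>x. indicator U x * f x \<partial>lebesgue) \<le> 0"
proof -
  obtain \<eta> :: "nat \<Rightarrow> 'a \<Rightarrow> real" where \<eta>:
    "\<And>k. test_function (\<eta> k)" "\<And>k x. 0 \<le> \<eta> k x" "\<And>k x. \<eta> k x \<le> 1"
    "\<And>k x. x \<notin> U \<Longrightarrow> \<eta> k x = 0" "\<And>x. x \<in> U \<Longrightarrow> (\<lambda>k. \<eta> k x) \<longlonglongrightarrow> 1"
    using open_indicator_test_limit[OF U] by metis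
  obtain R where R: "U \<subseteq> ball 0 R" using U(2) by (meson bounded_subset_ballD)
  have [measurable]: "f \<in> borel_measurable lebesgue" "\<eta> k \<in> borel_measurable lebesgue" "U \<in> sets lebesgue" for k
    using f U by (auto simp: loc_integrable_def intro: test_function_measurable[OF \<eta>(1)])
  have int: "integrable lebesgue (\<lambda>x. indicator (ball 0 R) x *\<^sub>R \<bar>f x\<bar>)"
    using f unfolding loc_integrable_def set_integrable_def
    by (metis (no_types, lifting) ext integrable_abs abs_scaleR abs_indicator)
  have "(\<lambda>k. \<integral>x. (\<eta> k x)\<^sup>2 * f x \<partial>lebesgue) \<longlonglongrightarrow> (\<integral>x. indicator U x * f x \<partial>lebesgue)"
  proof (rule integral_dominated_convergence[OF _ _ int])
    show "AE x in lebesgue. (\<lambda>k. (\<eta> k x)\<^sup>2 * f x) \<longlonglongrightarrow> indicator U x * f x"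
    proof (intro AE_I2)
      fix x
      show "(\<lambda>k. (\<eta> k x)\<^sup>2 * f x) \<longlonglongrightarrow> indicator U x * f x"
      proof (cases "x \<in> U")
        case True
        have "(\<lambda>k. (\<eta> k x)\<^sup>2 * f x) \<longlonglongrightarrow> 1\<^sup>2 * f x" by (intro tendsto_intros \<eta> True)
        then show ?thesis using True by simp
      qed (simp add: \<eta>)
    qed
    show "AE x in lebesgue. norm ((\<eta> k x)\<^sup>2 * f x) \<le> indicator (ball 0 R) x *\<^sub>R \<bar>f x\<bar>" for k
    proof (intro AE_I2)
      fix x
      have "(\<eta> k x)\<^sup>2 * \<bar>f x\<bar> \<le> 1 * \<bar>f x\<bar>" using \<eta> by (intro mult_right_mono power_le_one) auto
      then show "norm ((\<eta> k x)\<^sup>2 * f x) \<le> indicator (ball 0 R) x *\<^sub>R \<bar>f x\<bar>"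
        using R \<eta>(4)[of x k] by (cases "x \<in> U") (auto simp: abs_mult)
    qed
  qed measurable
  then show ?thesis by (rule LIMSEQ_le_const2) (use le \<eta>(1) in auto)
qed

text \<open>Outer regularity carries the sign of the integral from bounded open sets to bounded
  parts of the set where f is positive; there the integral can only vanish, so these parts are
  null.\<close>

lemma AE_nonpos_if_test_nonpos:
  fixes f :: "'a::euclidean_space \<Rightarrow> real"
  assumes f: "loc_integrable f" 
    and le: "\<And>\<eta>. test_function \<eta> \<Longrightarrow> (\<integral>x. (\<eta> x)\<^sup>2 * f x \<partial>lebesgue) \<le> 0"
  shows "AE x in lebesgue. f x \<le> 0"
proof -
  have [measurable]: "f \<in> borel_measurable lebesgue" using f by (auto simp: loc_integrable_def)
  have "AE x in lebesgue. x \<in> ball 0 (real R) \<longrightarrow> f x \<le> 0" for R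
  proof -
    define S where "S = {x \<in> space lebesgue. f x > 0} \<inter> ball 0 (real R)"
    have S[measurable]: "S \<in> sets lebesgue" unfolding S_def by (intro sets.Int, measurable) auto
    \<comment> \<open>C is an outer hull of S, up to a null set, given by countably many open sets.
      Their finite intersections, cut with the ball, are bounded, open and decrease to the part of C
      in the ball.\<close>
    obtain C T where C: "gdelta C" "T \<in> null_sets lebesgue" "S \<union> T = C" "disjnt S T"
      using lebesgue_set_almost_gdelta[OF S] by metis
    obtain G :: "nat \<Rightarrow> 'a set" where G: "\<And>n. open (G n)" "C = \<Inter> (range G)"
      using C(1) unfolding gdelta.simps by blast
    define U where "U n = ball 0 (real R) \<inter> (\<Inter>i\<le>n. G i)" for n
    have U: "open (U n)" "bounded (U n)" for n
      using G unfolding U_def by (auto intro!: open_Int open_INT)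
    then have [measurable]: "U n \<in> sets lebesgue" for n by auto
    have int: "integrable lebesgue (\<lambda>x. indicator (ball 0 R) x *\<^sub>R \<bar>f x\<bar>)"
      using f unfolding loc_integrable_def set_integrable_def
      by (metis (no_types, lifting) ext integrable_abs abs_scaleR abs_indicator)
    have [measurable]: "C \<in> sets lebesgue" "ball 0 (real R) \<in> sets (lebesgue :: 'a measure)"
      using G by auto
    have "(\<lambda>n. \<integral>x. indicator (U n) x * f x \<partial>lebesgue) \<longlonglongrightarrow> (\<integral>x. indicator (ball 0 R \<inter> C) x * f x \<partial>lebesgue)"
    proof (rule integral_dominated_convergence[OF _ _ int])
      show "AE x in lebesgue. (\<lambda>k. indicator (U k) x * f x) \<longlonglongrightarrow> indicator (ball 0 R \<inter> C) x * f x"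
      proof (intro AE_I2)
        fix x
        have "\<forall>\<^sub>F k in sequentially. indicator (U k) x * f x = indicator (ball 0 R \<inter> C) x * f x"
        proof (cases "x \<in> C")
          case True
          then show ?thesis using G(2) by (intro always_eventually) (auto simp: U_def indicator_def)
        next
          case False
          then obtain j where "x \<notin> G j" using G(2) by auto
          then show ?thesis using False
            by (intro eventually_sequentiallyI[of j]) (auto simp: U_def indicator_def)
        qed
        then show "(\<lambda>k. indicator (U k) x * f x) \<longlonglongrightarrow> indicator (ball 0 R \<inter> C) x * f x"
          by (rule tendsto_eventually)
      qed
      show "AE x in lebesgue. norm (indicator (U k) x * f x) \<le> indicator (ball 0 R) x *\<^sub>R \<bar>f x\<bar>" for k
        by (intro AE_I2) (auto simp: U_def indicator_def)
    qed measurable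
    then have "(\<integral>x. indicator (ball 0 R \<inter> C) x * f x \<partial>lebesgue) \<le> 0"
      by (rule LIMSEQ_le_const2) (use integral_open_nonpos[OF f le] U in auto)
    also have "(\<integral>x. indicator (ball 0 R \<inter> C) x * f x \<partial>lebesgue) = (\<integral>x. indicator S x * f x \<partial>lebesgue)"
    proof (rule integral_cong_AE)
      show "AE x in lebesgue. indicator (ball 0 R \<inter> C) x * f x = indicator S x * f x"
        using AE_not_in[OF C(2)] C(3) by (elim eventually_mono) (auto simp: indicator_def S_def)
    qed measurable
    finally have le0: "(\<integral>x. indicator S x * f x \<partial>lebesgue) \<le> 0" .
    have nn: "AE x in lebesgue. 0 \<le> indicator S x * f x"
      by (intro AE_I2) (auto simp: indicator_def S_def)
    have i: "integrable lebesgue (\<lambda>x. indicator S x * f x)"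
      by (rule Bochner_Integration.integrable_bound[OF int], measurable) (auto simp: S_def indicator_def)
    have "(\<integral>x. indicator S x * f x \<partial>lebesgue) = 0"
      using le0 integral_nonneg_AE[OF nn] by linarith
    then have "AE x in lebesgue. indicator S x * f x = 0"
      using integral_nonneg_eq_0_iff_AE[OF i nn] by simp
    then show ?thesis by (elim eventually_mono) (auto simp: S_def indicator_def split: if_splits)
  qed
  then have "AE x in lebesgue. \<forall>R::nat. x \<in> ball 0 (real R) \<longrightarrow> f x \<le> 0"
    unfolding AE_all_countable by blast
  then show ?thesis
  proof eventually_elim
    case (elim x)
    obtain n where "norm x < real n" using reals_Archimedean2 by blast
    with elim show ?case by auto
  qed
qed

text \<open>The sign criterion is applied to plus and minus the real and imaginary parts; the square
  of a test function is again one, so the hypothesis covers the squares required there.\<close>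

lemma AE_zero_if_test_zero:
  fixes f :: "'a::euclidean_space \<Rightarrow> complex"
  assumes f: "loc_integrable f" 
    and eq: "\<And>\<eta>. test_function \<eta> \<Longrightarrow> (\<integral>x. \<eta> x *\<^sub>R f x \<partial>lebesgue) = 0"
  shows "AE x in lebesgue. f x = 0"
proof -
  have [measurable]: "f \<in> borel_measurable lebesgue" using f by (auto simp: loc_integrable_def)
  have *: "AE x in lebesgue. l (f x) \<le> 0" if l: "bounded_linear l" for l :: "complex \<Rightarrow> real"
  proof (rule AE_nonpos_if_test_nonpos)
    have [measurable]: "l \<in> borel_measurable borel"
      by (intro borel_measurable_continuous_onI linear_continuous_on l)
    show "loc_integrable (\<lambda>x. l (f x))"
      unfolding loc_integrable_def set_integrable_def
    proof (intro conjI allI)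
      fix R
      have "integrable lebesgue (\<lambda>x. l (indicator (ball 0 R) x *\<^sub>R f x))"
        using f unfolding loc_integrable_def set_integrable_def by (intro integrable_bounded_linear[OF l]) auto
      then show "integrable lebesgue (\<lambda>x. indicator (ball 0 R) x *\<^sub>R l (f x))"
        by (simp add: linear_cmul[OF bounded_linear.linear[OF l]])
    qed measurable
    fix \<eta> :: "'a \<Rightarrow> real" assume \<eta>: "test_function \<eta>"
    note \<eta>2 = test_function_mult[OF \<eta> \<eta>]
    have "(\<integral>x. (\<eta> x)\<^sup>2 * l (f x) \<partial>lebesgue) = (\<integral>x. l ((\<eta> x * \<eta> x) *\<^sub>R f x) \<partial>lebesgue)"
      by (simp add: linear_cmul[OF bounded_linear.linear[OF l]] power2_eq_square)
    also have "\<dots> = l (\<integral>x. (\<eta> x * \<eta> x) *\<^sub>R f x \<partial>lebesgue)"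
      by (rule integral_bounded_linear[OF l loc_integrable_test[OF f \<eta>2]])
    finally show "(\<integral>x. (\<eta> x)\<^sup>2 * l (f x) \<partial>lebesgue) \<le> 0"
      using eq[OF \<eta>2] linear_0[OF bounded_linear.linear[OF l]] by simp
  qed
  have "AE x in lebesgue. Re (f x) \<le> 0" "AE x in lebesgue. - Re (f x) \<le> 0"
    "AE x in lebesgue. Im (f x) \<le> 0" "AE x in lebesgue. - Im (f x) \<le> 0"
    by (intro *[of Re] *[of Im] *[of "\<lambda>z. - Re z"] *[of "\<lambda>z. - Im z"] bounded_linear_minus bounded_linear_Re bounded_linear_Im)+
  then show ?thesis by eventually_elim (auto simp: complex_eq_iff)
qed

section \<open>Square-integrable functions and the linear structure of weak derivatives\<close>

lemma Lp_space_2_iff: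
  "f \<in> Lp_space 2 \<longleftrightarrow> f \<in> borel_measurable lebesgue \<and> integrable lebesgue (\<lambda>x. (norm (f x))\<^sup>2)"
  by (simp add: Lp_space_def)

lemma loc_integrable_L2:
  fixes f :: "'a::euclidean_space \<Rightarrow> 'b::{banach,second_countable_topology}"
  assumes "f \<in> Lp_space 2"
  shows "loc_integrable f"
  unfolding loc_integrable_def set_integrable_def
proof (intro conjI allI)
  have f[measurable]: "f \<in> borel_measurable lebesgue" and i: "integrable lebesgue (\<lambda>x. (norm (f x))\<^sup>2)"
    using assms by (auto simp: Lp_space_2_iff)
  show "f \<in> borel_measurable lebesgue" by fact
  fix R
  have [measurable]: "ball 0 R \<in> sets (lebesgue :: 'a measure)" by auto
  have "integrable lebesgue (\<lambda>x. indicator (ball 0 R) x + (norm (f x))\<^sup>2)"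
    using i emeasure_lborel_ball_finite[of "0::'a" R] by (intro Bochner_Integration.integrable_add) 
      (auto intro!: integrable_real_indicator simp: less_top)
  then show "integrable lebesgue (\<lambda>x. indicat_real (ball 0 R) x *\<^sub>R f x)"
  proof (rule Bochner_Integration.integrable_bound)
    show "AE x in lebesgue. norm (indicat_real (ball 0 R) x *\<^sub>R f x) \<le> norm (indicator (ball 0 R) x + (norm (f x))\<^sup>2)"
    proof (intro AE_I2)
      fix x
      have "norm (f x) \<le> 1 + (norm (f x))\<^sup>2"
        using zero_le_power2[of "norm (f x) - 1"] norm_ge_zero[of "f x"] unfolding power2_diff by (simp del: norm_ge_zero)
      then show "norm (indicat_real (ball 0 R) x *\<^sub>R f x) \<le> norm (indicator (ball 0 R) x + (norm (f x))\<^sup>2)"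
        by (auto simp: indicator_def)
    qed
  qed measurable
qed

lemma L2_add: 
  assumes "f \<in> Lp_space 2" "g \<in> Lp_space 2"
  shows "(\<lambda>x. f x + g x) \<in> Lp_space 2"
proof -
  have [measurable]: "f \<in> borel_measurable lebesgue" "g \<in> borel_measurable lebesgue"
    and i: "integrable lebesgue (\<lambda>x. (norm (f x))\<^sup>2)" "integrable lebesgue (\<lambda>x. (norm (g x))\<^sup>2)"
    using assms by (auto simp: Lp_space_2_iff)
  have "integrable lebesgue (\<lambda>x. 2 * (norm (f x))\<^sup>2 + 2 * (norm (g x))\<^sup>2)"
    using i by auto
  then have "integrable lebesgue (\<lambda>x. (norm (f x + g x))\<^sup>2)"
  proof (rule Bochner_Integration.integrable_bound)
    have "(norm (f x + g x))\<^sup>2 \<le> 2 * (norm (f x))\<^sup>2 + 2 * (norm (g x))\<^sup>2" for x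
    proof -
      have "(norm (f x + g x))\<^sup>2 \<le> (norm (f x) + norm (g x))\<^sup>2"
        by (intro power_mono norm_triangle_ineq) auto
      also have "\<dots> \<le> 2 * (norm (f x))\<^sup>2 + 2 * (norm (g x))\<^sup>2"
        using zero_le_power2[of "norm (f x) - norm (g x)"] by (simp add: power2_sum power2_diff)
      finally show ?thesis .
    qed
    then show "AE x in lebesgue. norm ((norm (f x + g x))\<^sup>2) \<le> norm (2 * (norm (f x))\<^sup>2 + 2 * (norm (g x))\<^sup>2)"
      by (intro AE_I2) simp
  qed measurable
  then show ?thesis by (simp add: Lp_space_2_iff)
qed

lemma L2_scaleR: "f \<in> Lp_space 2 \<Longrightarrow> (\<lambda>x. c *\<^sub>R f x) \<in> Lp_space 2"
  by (auto simp: Lp_space_2_iff power_mult_distrib)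

lemma L2_diff: "f \<in> Lp_space 2 \<Longrightarrow> g \<in> Lp_space 2 \<Longrightarrow> (\<lambda>x. f x - g x) \<in> Lp_space 2"
  using L2_add[of f "\<lambda>x. (-1) *\<^sub>R g x"] L2_scaleR[of g "-1"] by simp

lemma L2_cong_AE:
  assumes "f \<in> Lp_space 2" "AE x in lebesgue. f x = g x" "g \<in> borel_measurable lebesgue"
  shows "g \<in> Lp_space 2"
proof -
  have "AE x in lebesgue. (norm (f x))\<^sup>2 = (norm (g x))\<^sup>2"
    using assms(2) by eventually_elim simp
  with assms integrable_cong_AE[of "\<lambda>x. (norm (f x))\<^sup>2" lebesgue "\<lambda>x. (norm (g x))\<^sup>2"]
  show ?thesis by (auto simp: Lp_space_2_iff simp del: power2_eq_iff_nonneg)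
qed

lemma L2_mult_integrable:
  fixes f g :: "'a::euclidean_space \<Rightarrow> complex"
  assumes "f \<in> Lp_space 2" "g \<in> Lp_space 2"
  shows "integrable lebesgue (\<lambda>x. f x * g x)"
proof -
  have [measurable]: "f \<in> borel_measurable lebesgue" "g \<in> borel_measurable lebesgue"
    and i: "integrable lebesgue (\<lambda>x. (norm (f x))\<^sup>2)" "integrable lebesgue (\<lambda>x. (norm (g x))\<^sup>2)"
    using assms by (auto simp: Lp_space_2_iff)
  have "integrable lebesgue (\<lambda>x. (norm (f x))\<^sup>2 + (norm (g x))\<^sup>2)"
    using i by auto
  then show ?thesis
  proof (rule Bochner_Integration.integrable_bound)
    have "norm (f x * g x) \<le> (norm (f x))\<^sup>2 + (norm (g x))\<^sup>2" for x
      using zero_le_power2[of "norm (f x) - norm (g x)"] mult_nonneg_nonneg[OF norm_ge_zero[of "f x"] norm_ge_zero[of "g x"]]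
      unfolding power2_diff norm_mult by linarith
    then show "AE x in lebesgue. norm (f x * g x) \<le> norm ((norm (f x))\<^sup>2 + (norm (g x))\<^sup>2)"
      by (intro AE_I2) simp
  qed measurable
qed

text \<open>Since \<open>weak_partial\<close> is a Hilbert choice, every rule about it comes from
  here: some weak derivative is exhibited, and uniqueness identifies the chosen one with it almost
  everywhere.\<close>

lemma weak_partial_unique:
  assumes "is_weak_partial b \<phi> g" "is_weak_partial b \<phi> h" "g \<in> Lp_space 2" "h \<in> Lp_space 2"
  shows "AE x in lebesgue. g x = h x"
proof -
  have "AE x in lebesgue. g x - h x = 0"
  proof (rule AE_zero_if_test_zero[OF loc_integrable_L2[OF L2_diff[OF assms(3,4)]]])
    fix \<eta> :: "'a \<Rightarrow> real" assume \<eta>: "test_function \<eta>"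
    have "(\<integral>x. \<eta> x *\<^sub>R g x \<partial>lebesgue) = (\<integral>x. \<eta> x *\<^sub>R h x \<partial>lebesgue)"
      using assms(1,2) \<eta> unfolding is_weak_partial_def by (metis neg_equal_iff_equal)
    then show "(\<integral>x. \<eta> x *\<^sub>R (g x - h x) \<partial>lebesgue) = 0"
      unfolding scaleR_right_diff_distrib using assms(3,4)
      by (subst Bochner_Integration.integral_diff) (auto intro: loc_integrable_test[OF loc_integrable_L2 \<eta>])
  qed
  then show ?thesis by simp
qed

lemma weak_partial_props:
  assumes "\<phi> \<in> H1" "b \<in> Basis"
  shows "weak_partial b \<phi> \<in> Lp_space 2" "is_weak_partial b \<phi> (weak_partial b \<phi>)"
proof -
  have "\<exists>g. g \<in> Lp_space 2 \<and> is_weak_partial b \<phi> g" using assms unfolding H1_def by blast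
  from someI_ex[OF this] show "weak_partial b \<phi> \<in> Lp_space 2" "is_weak_partial b \<phi> (weak_partial b \<phi>)"
    unfolding weak_partial_def by auto
qed

lemma H1_L2: "\<phi> \<in> H1 \<Longrightarrow> \<phi> \<in> Lp_space 2"
  by (simp add: H1_def)

lemma weak_partial_AE_eq:
  assumes "\<phi> \<in> H1" "b \<in> Basis" "is_weak_partial b \<phi> g" "g \<in> Lp_space 2"
  shows "AE x in lebesgue. weak_partial b \<phi> x = g x"
  using weak_partial_unique weak_partial_props assms by metis

lemma is_weak_partial_add:
  assumes "is_weak_partial b \<phi> g" "is_weak_partial b \<psi> h" "b \<in> Basis"
    "g \<in> Lp_space 2" "h \<in> Lp_space 2" "\<phi> \<in> Lp_space 2" "\<psi> \<in> Lp_space 2"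
  shows "is_weak_partial b (\<lambda>x. \<phi> x + \<psi> x) (\<lambda>x. g x + h x)"
  unfolding is_weak_partial_def scaleR_right_distrib
proof (intro allI impI)
  fix \<eta> :: "'a \<Rightarrow> real" assume \<eta>: "test_function \<eta>"
  note i = loc_integrable_test[OF loc_integrable_L2 \<eta>]
    loc_integrable_test[OF loc_integrable_L2 test_function_partial_deriv[OF \<eta> assms(3)]]
  show "(\<integral>x. partial_deriv b \<eta> x *\<^sub>R \<phi> x + partial_deriv b \<eta> x *\<^sub>R \<psi> x \<partial>lebesgue) =
    - (\<integral>x. \<eta> x *\<^sub>R g x + \<eta> x *\<^sub>R h x \<partial>lebesgue)"
    using assms(1,2) \<eta> unfolding is_weak_partial_def
    by (simp add: Bochner_Integration.integral_add[OF i(1)[OF assms(4)] i(1)[OF assms(5)]]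
        Bochner_Integration.integral_add[OF i(2)[OF assms(6)] i(2)[OF assms(7)]])
qed

lemma is_weak_partial_scaleR:
  assumes "is_weak_partial b \<phi> g"
  shows "is_weak_partial b (\<lambda>x. c *\<^sub>R \<phi> x) (\<lambda>x. c *\<^sub>R g x)"
  using assms unfolding is_weak_partial_def
  by (simp only: scaleR_left_commute[of _ c] integral_scaleR_right scaleR_minus_right simp_thms) simp

lemma is_weak_partial_cong_AE:
  assumes "is_weak_partial b \<phi> g" "b \<in> Basis" "AE x in lebesgue. \<phi> x = \<psi> x" "AE x in lebesgue. g x = h x"
    "\<phi> \<in> borel_measurable lebesgue" "\<psi> \<in> borel_measurable lebesgue" 
    "g \<in> borel_measurable lebesgue" "h \<in> borel_measurable lebesgue" 
  shows "is_weak_partial b \<psi> h"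
  unfolding is_weak_partial_def
proof (intro allI impI)
  fix \<eta> :: "'a \<Rightarrow> real" assume \<eta>: "test_function \<eta>"
  note [measurable] = test_function_measurable[OF \<eta>] test_function_measurable[OF test_function_partial_deriv[OF \<eta> assms(2)]]
  note [measurable] = assms(5-)
  have "(\<integral>x. partial_deriv b \<eta> x *\<^sub>R \<psi> x \<partial>lebesgue) = (\<integral>x. partial_deriv b \<eta> x *\<^sub>R \<phi> x \<partial>lebesgue)"
    using assms(3) by (intro integral_cong_AE) auto
  moreover have "(\<integral>x. \<eta> x *\<^sub>R h x \<partial>lebesgue) = (\<integral>x. \<eta> x *\<^sub>R g x \<partial>lebesgue)"
    using assms(4) by (intro integral_cong_AE) auto
  ultimately show "(\<integral>x. partial_deriv b \<eta> x *\<^sub>R \<psi> x \<partial>lebesgue) = - (\<integral>x. \<eta> x *\<^sub>R h x \<partial>lebesgue)"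
    using assms(1) \<eta> unfolding is_weak_partial_def by simp
qed

lemma H1_add: 
  assumes "\<phi> \<in> H1" "\<psi> \<in> H1"
  shows "(\<lambda>x. \<phi> x + \<psi> x) \<in> H1"
    and "b \<in> Basis \<Longrightarrow> AE x in lebesgue. weak_partial b (\<lambda>x. \<phi> x + \<psi> x) x = weak_partial b \<phi> x + weak_partial b \<psi> x"
proof -
  have *: "is_weak_partial b (\<lambda>x. \<phi> x + \<psi> x) (\<lambda>x. weak_partial b \<phi> x + weak_partial b \<psi> x)"
    "(\<lambda>x. weak_partial b \<phi> x + weak_partial b \<psi> x) \<in> Lp_space 2" if "b \<in> Basis" for b
    using assms that weak_partial_props by (auto intro!: is_weak_partial_add L2_add dest: H1_L2)
  show "(\<lambda>x. \<phi> x + \<psi> x) \<in> H1"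
    using * L2_add[OF H1_L2 H1_L2] assms unfolding H1_def by blast
  with * show "b \<in> Basis \<Longrightarrow> AE x in lebesgue. weak_partial b (\<lambda>x. \<phi> x + \<psi> x) x = weak_partial b \<phi> x + weak_partial b \<psi> x"
    by (intro weak_partial_AE_eq) auto
qed

lemma H1_scaleR: 
  assumes "\<phi> \<in> H1"
  shows "(\<lambda>x. c *\<^sub>R \<phi> x) \<in> H1"
    and "b \<in> Basis \<Longrightarrow> AE x in lebesgue. weak_partial b (\<lambda>x. c *\<^sub>R \<phi> x) x = c *\<^sub>R weak_partial b \<phi> x"
proof -
  have *: "is_weak_partial b (\<lambda>x. c *\<^sub>R \<phi> x) (\<lambda>x. c *\<^sub>R weak_partial b \<phi> x)"
    "(\<lambda>x. c *\<^sub>R weak_partial b \<phi> x) \<in> Lp_space 2" if "b \<in> Basis" for b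
    using assms that weak_partial_props by (auto intro!: is_weak_partial_scaleR L2_scaleR)
  show "(\<lambda>x. c *\<^sub>R \<phi> x) \<in> H1"
    using * L2_scaleR[OF H1_L2] assms unfolding H1_def by blast
  with * show "b \<in> Basis \<Longrightarrow> AE x in lebesgue. weak_partial b (\<lambda>x. c *\<^sub>R \<phi> x) x = c *\<^sub>R weak_partial b \<phi> x"
    by (intro weak_partial_AE_eq) auto
qed

lemma H1_diff: 
  assumes "\<phi> \<in> H1" "\<psi> \<in> H1"
  shows "(\<lambda>x. \<phi> x - \<psi> x) \<in> H1"
    and "b \<in> Basis \<Longrightarrow> AE x in lebesgue. weak_partial b (\<lambda>x. \<phi> x - \<psi> x) x = weak_partial b \<phi> x - weak_partial b \<psi> x"
proof -
  note s = H1_scaleR[OF assms(2), where c="-1", simplified]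
  show "(\<lambda>x. \<phi> x - \<psi> x) \<in> H1" using H1_add(1)[OF assms(1) s(1)] by simp
  assume b: "b \<in> Basis"
  from H1_add(2)[OF assms(1) s(1) b] s(2)[OF b]
  show "AE x in lebesgue. weak_partial b (\<lambda>x. \<phi> x - \<psi> x) x = weak_partial b \<phi> x - weak_partial b \<psi> x"
    by (simp, eventually_elim) simp
qed

lemma H1_cong_AE:
  assumes "\<phi> \<in> H1" "AE x in lebesgue. \<phi> x = \<psi> x"
  shows "\<psi> \<in> H1"
    and "b \<in> Basis \<Longrightarrow> AE x in lebesgue. weak_partial b \<psi> x = weak_partial b \<phi> x"
proof -
  have m: "\<phi> \<in> borel_measurable lebesgue" using H1_L2[OF assms(1)] by (simp add: Lp_space_2_iff)
  then have m': "\<psi> \<in> borel_measurable lebesgue"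
    using assms(2) by (rule borel_measurable_AE)
  have *: "is_weak_partial b \<psi> (weak_partial b \<phi>)" "weak_partial b \<phi> \<in> Lp_space 2" if "b \<in> Basis" for b
    using is_weak_partial_cong_AE[OF weak_partial_props(2)[OF assms(1) that] that assms(2) AE_I2 m m']
      weak_partial_props(1)[OF assms(1) that] by (auto simp: Lp_space_2_iff)
  show "\<psi> \<in> H1"
    using * L2_cong_AE[OF H1_L2[OF assms(1)] assms(2) m'] unfolding H1_def by blast
  with * show "b \<in> Basis \<Longrightarrow> AE x in lebesgue. weak_partial b \<psi> x = weak_partial b \<phi> x"
    by (intro weak_partial_AE_eq) auto
qed

section \<open>Averages of square-integrable functions\<close>

text \<open>Averaging needs joint measurability of f(x + z) in x and z. Borel functions provide it;
  functions that are merely Lebesgue measurable need not, as \<open>\<nu>\<close> may be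
  concentrated on a null set.\<close>

lemma L2_borel_representative:
  fixes f :: "'a::euclidean_space \<Rightarrow> complex"
  assumes "f \<in> Lp_space 2"
  obtains g where "g \<in> borel_measurable borel" "AE x in lebesgue. f x = g x" "g \<in> Lp_space 2"
proof -
  have [measurable]: "f \<in> borel_measurable lebesgue" using assms by (simp add: Lp_space_2_iff)
  have "(\<lambda>x. Re (f x)) \<in> borel_measurable lebesgue" "(\<lambda>x. Im (f x)) \<in> borel_measurable lebesgue"
    by measurable
  then obtain u v where [measurable]: "u \<in> borel_measurable borel" "v \<in> borel_measurable borel"
    and uv: "AE x in lborel. Re (f x) = u x" "AE x in lborel. Im (f x) = v x"
    using completion_ex_borel_measurable_real[of "\<lambda>x. Re (f x)" lborel] completion_ex_borel_measurable_real[of "\<lambda>x. Im (f x)" lborel]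
    by auto
  have m: "(\<lambda>x. Complex (u x) (v x)) \<in> borel_measurable borel" 
    unfolding Complex_eq by measurable
  have ae: "AE x in lebesgue. f x = Complex (u x) (v x)"
    using AE_completion[OF uv(1)] AE_completion[OF uv(2)] by eventually_elim (simp add: complex_eq_iff)
  have "(\<lambda>x. Complex (u x) (v x)) \<in> borel_measurable lebesgue"
    using m measurable_completion[of _ lborel borel] by simp
  from that[OF m ae L2_cong_AE[OF assms ae this]] show thesis .
qed

lemma borel_L2_iff:
  fixes f :: "'a::euclidean_space \<Rightarrow> 'b::{banach,second_countable_topology}"
  assumes [measurable]: "f \<in> borel_measurable borel"
  shows "f \<in> Lp_space 2 \<longleftrightarrow> (\<integral>\<^sup>+x. ennreal ((norm (f x))\<^sup>2) \<partial>lborel) < \<infinity>"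
proof -
  have "f \<in> borel_measurable lebesgue" by (rule measurable_completion) measurable
  then show ?thesis
    by (simp add: Lp_space_2_iff integrable_completion integrable_iff_bounded nn_integral_completion)
qed

lemma borel_L2_nn_integral:
  fixes f :: "'a::euclidean_space \<Rightarrow> 'b::{banach,second_countable_topology}"
  assumes [measurable]: "f \<in> borel_measurable borel" and "f \<in> Lp_space 2"
  shows "(\<integral>\<^sup>+x. ennreal ((norm (f x))\<^sup>2) \<partial>lborel) = ennreal (\<integral>x. (norm (f x))\<^sup>2 \<partial>lebesgue)"
  using assms by (subst nn_integral_eq_integral) (auto simp: Lp_space_2_iff integrable_completion integral_completion)

lemma nn_integral_lborel_translate:
  assumes [measurable]: "h \<in> borel_measurable borel"
  shows "(\<integral>\<^sup>+x. h (x + a) \<partial>(lborel :: 'a::euclidean_space measure)) = (\<integral>\<^sup>+x. h x \<partial>lborel)"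
proof -
  have "(\<integral>\<^sup>+x. h x \<partial>distr lborel borel ((+) a)) = (\<integral>\<^sup>+x. h (a + x) \<partial>lborel)"
    by (rule nn_integral_distr) auto
  then show ?thesis by (simp add: lborel_distr_plus add.commute)
qed

lemma integral_lborel_translate:
  fixes h :: "'a::euclidean_space \<Rightarrow> 'b::{banach,second_countable_topology}"
  assumes [measurable]: "h \<in> borel_measurable borel"
  shows "(\<integral>x. h (x + a) \<partial>lborel) = (\<integral>x. h x \<partial>lborel)"
proof -
  have "(\<integral>x. h x \<partial>distr lborel borel ((+) a)) = (\<integral>x. h (a + x) \<partial>lborel)"
    by (rule integral_distr) auto
  then show ?thesis by (simp add: lborel_distr_plus add.commute)
qed

text \<open>Jensen's inequality for the square, from the nonnegative variance of the norm. An
  infinite right-hand side makes it trivial, so no integrability has to be assumed.\<close>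

lemma (in prob_space) norm_integral_sq_le:
  fixes f :: "'a \<Rightarrow> 'b::{banach,second_countable_topology}"
  assumes [measurable]: "f \<in> borel_measurable M"
  shows "ennreal ((norm (\<integral>x. f x \<partial>M))\<^sup>2) \<le> (\<integral>\<^sup>+x. ennreal ((norm (f x))\<^sup>2) \<partial>M)"
    and "(\<integral>\<^sup>+x. ennreal ((norm (f x))\<^sup>2) \<partial>M) < \<infinity> \<Longrightarrow> integrable M f"
proof -
  have i: "integrable M f" "integrable M (\<lambda>x. (norm (f x))\<^sup>2)" if "(\<integral>\<^sup>+x. ennreal ((norm (f x))\<^sup>2) \<partial>M) < \<infinity>"
  proof -
    show 2: "integrable M (\<lambda>x. (norm (f x))\<^sup>2)" using that by (simp add: integrable_iff_bounded)
    have "integrable M (\<lambda>x. 1 + (norm (f x))\<^sup>2)" using 2 by auto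
    then show "integrable M f"
    proof (rule Bochner_Integration.integrable_bound)
      have "norm (f x) \<le> 1 + (norm (f x))\<^sup>2" for x
        using zero_le_power2[of "norm (f x) - 1"] norm_ge_zero[of "f x"] unfolding power2_diff by (simp del: norm_ge_zero)
      then show "AE x in M. norm (f x) \<le> norm (1 + (norm (f x))\<^sup>2)" by (intro AE_I2) auto
    qed measurable
  qed
  then show "(\<integral>\<^sup>+x. ennreal ((norm (f x))\<^sup>2) \<partial>M) < \<infinity> \<Longrightarrow> integrable M f" by blast
  show "ennreal ((norm (\<integral>x. f x \<partial>M))\<^sup>2) \<le> (\<integral>\<^sup>+x. ennreal ((norm (f x))\<^sup>2) \<partial>M)"
  proof (cases "(\<integral>\<^sup>+x. ennreal ((norm (f x))\<^sup>2) \<partial>M) < \<infinity>")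
    case False
    then have "(\<integral>\<^sup>+x. ennreal ((norm (f x))\<^sup>2) \<partial>M) = \<infinity>" by (simp add: less_top[symmetric])
    then show ?thesis by simp
  next
    case True
    note i = i[OF this]
    let ?m = "\<integral>x. norm (f x) \<partial>M"
    have "0 \<le> (\<integral>x. (norm (f x) - ?m)\<^sup>2 \<partial>M)" by simp
    also have "\<dots> = (\<integral>x. (norm (f x))\<^sup>2 - 2 * ?m * norm (f x) + ?m\<^sup>2 \<partial>M)"
      by (simp add: power2_diff algebra_simps)
    also have "\<dots> = (\<integral>x. (norm (f x))\<^sup>2 \<partial>M) - ?m\<^sup>2"
      using i by (simp add: prob_space power2_eq_square)
    finally have "?m\<^sup>2 \<le> (\<integral>x. (norm (f x))\<^sup>2 \<partial>M)" by simp
    moreover have "(norm (\<integral>x. f x \<partial>M))\<^sup>2 \<le> ?m\<^sup>2"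
      using integral_norm_bound by (intro power_mono) auto
    ultimately have "(norm (\<integral>x. f x \<partial>M))\<^sup>2 \<le> (\<integral>x. (norm (f x))\<^sup>2 \<partial>M)" by linarith
    then show ?thesis using i by (subst nn_integral_eq_integral) (auto intro: ennreal_leI)
  qed
qed

text \<open>|u v| \<le> u^2 + |v|^2 on each slice supplies the hypothesis of Fubini's theorem.
  Bounds uniform in z are natural because the slices in question are copies or translates of one
  function.\<close>

lemma integrable_pair_L2_mult:
  fixes u :: "'a::euclidean_space \<times> 'b \<Rightarrow> real" and v :: "'a \<times> 'b \<Rightarrow> complex"
  assumes "prob_space \<nu>"
    and [measurable]: "u \<in> borel_measurable (lborel \<Otimes>\<^sub>M \<nu>)" "v \<in> borel_measurable (lborel \<Otimes>\<^sub>M \<nu>)"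
    and "\<And>z. (\<integral>\<^sup>+x. ennreal ((u (x, z))\<^sup>2) \<partial>lborel) \<le> A" "\<And>z. (\<integral>\<^sup>+x. ennreal ((norm (v (x, z)))\<^sup>2) \<partial>lborel) \<le> B"
    and "A < \<infinity>" "B < \<infinity>"
  shows "integrable (lborel \<Otimes>\<^sub>M \<nu>) (\<lambda>p. u p *\<^sub>R v p)"
proof (rule integrableI_bounded)
  interpret \<nu>: prob_space \<nu> by fact
  interpret pair_sigma_finite lborel \<nu> ..
  have "(\<integral>\<^sup>+p. ennreal (norm (u p *\<^sub>R v p)) \<partial>(lborel \<Otimes>\<^sub>M \<nu>))
    = (\<integral>\<^sup>+z. (\<integral>\<^sup>+x. ennreal (norm (u (x, z) *\<^sub>R v (x, z))) \<partial>lborel) \<partial>\<nu>)"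
    by (rule nn_integral_snd[symmetric]) measurable
  also have "\<dots> \<le> (\<integral>\<^sup>+z. (\<integral>\<^sup>+x. ennreal ((u (x, z))\<^sup>2) + ennreal ((norm (v (x, z)))\<^sup>2) \<partial>lborel) \<partial>\<nu>)"
  proof (intro nn_integral_mono)
    fix z x
    have "\<bar>u (x, z)\<bar> * norm (v (x, z)) \<le> (u (x, z))\<^sup>2 + (norm (v (x, z)))\<^sup>2"
      using zero_le_power2[of "\<bar>u (x,z)\<bar> - norm (v (x,z))"] 
        mult_nonneg_nonneg[OF abs_ge_zero[of "u (x,z)"] norm_ge_zero[of "v (x,z)"]]
      unfolding power2_diff power2_abs by linarith
    then show "ennreal (norm (u (x, z) *\<^sub>R v (x, z))) \<le> ennreal ((u (x, z))\<^sup>2) + ennreal ((norm (v (x, z)))\<^sup>2)"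
      by (simp add: ennreal_plus[symmetric] ennreal_leI del: ennreal_plus)
  qed
  also have "\<dots> \<le> (\<integral>\<^sup>+z. A + B \<partial>\<nu>)"
  proof (intro nn_integral_mono)
    fix z assume z: "z \<in> space \<nu>"
    have [measurable]: "(\<lambda>x. u (x, z)) \<in> borel_measurable lborel" "(\<lambda>x. v (x, z)) \<in> borel_measurable lborel"
      using z by measurable
    show "(\<integral>\<^sup>+x. ennreal ((u (x, z))\<^sup>2) + ennreal ((norm (v (x, z)))\<^sup>2) \<partial>lborel) \<le> A + B"
      using assms(4,5) by (subst nn_integral_add) (auto intro: add_mono)
  qed
  also have "\<dots> < \<infinity>" using assms(6,7) by (simp add: \<nu>.emeasure_space_1)
  finally show "(\<integral>\<^sup>+p. ennreal (norm (u p *\<^sub>R v p)) \<partial>(lborel \<Otimes>\<^sub>M \<nu>)) < \<infinity>" .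
qed measurable

text \<open>Convolution with the reflection of \<open>\<nu>\<close>. The measure stays general
  because two choices matter: the segment from 0 to y, for the fundamental theorem of calculus, and
  small balls, for regularization.\<close>

definition average :: "'a::euclidean_space measure \<Rightarrow> ('a \<Rightarrow> complex) \<Rightarrow> 'a \<Rightarrow> complex" where
  "average \<nu> f x = (\<integral>z. f (x + z) \<partial>\<nu>)"

locale averaging = prob_space \<nu> for \<nu> :: "'a::euclidean_space measure" +
  assumes sets_eq [measurable_cong, simp]: "sets \<nu> = sets borel"
begin

sublocale pair: pair_sigma_finite lborel \<nu> ..

lemma average_measurable [measurable]:
  assumes [measurable]: "f \<in> borel_measurable borel"
  shows "average \<nu> f \<in> borel_measurable borel"
  unfolding average_def[abs_def] by measurable

lemma nn_integral_average_sq: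
  assumes [measurable]: "f \<in> borel_measurable borel"
  shows "(\<integral>\<^sup>+x. (\<integral>\<^sup>+z. ennreal ((norm (f (x + z)))\<^sup>2) \<partial>\<nu>) \<partial>lborel) = (\<integral>\<^sup>+x. ennreal ((norm (f x))\<^sup>2) \<partial>lborel)"
proof -
  have "(\<integral>\<^sup>+x. (\<integral>\<^sup>+z. ennreal ((norm (f (x + z)))\<^sup>2) \<partial>\<nu>) \<partial>lborel)
     = (\<integral>\<^sup>+z. (\<integral>\<^sup>+x. ennreal ((norm (f (x + z)))\<^sup>2) \<partial>lborel) \<partial>\<nu>)"
    by (rule pair.Fubini'[symmetric]) measurable
  also have "\<dots> = (\<integral>\<^sup>+z. (\<integral>\<^sup>+x. ennreal ((norm (f x))\<^sup>2) \<partial>lborel) \<partial>\<nu>)"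
    by (intro nn_integral_cong nn_integral_lborel_translate) measurable
  finally show ?thesis by (simp add: emeasure_space_1)
qed

lemma average_sq_le:
  assumes [measurable]: "f \<in> borel_measurable borel"
  shows "ennreal ((norm (average \<nu> f x))\<^sup>2) \<le> (\<integral>\<^sup>+z. ennreal ((norm (f (x + z)))\<^sup>2) \<partial>\<nu>)"
  unfolding average_def by (rule norm_integral_sq_le) measurable

lemma nn_integral_average_le:
  assumes [measurable]: "f \<in> borel_measurable borel"
  shows "(\<integral>\<^sup>+x. ennreal ((norm (average \<nu> f x))\<^sup>2) \<partial>lborel) \<le> (\<integral>\<^sup>+x. ennreal ((norm (f x))\<^sup>2) \<partial>lborel)"
  unfolding nn_integral_average_sq[OF assms, symmetric] by (intro nn_integral_mono average_sq_le) measurable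

text \<open>All three claims come from Jensen and translation invariance. The last one is recorded
  because a divergent average is 0 by convention: only where it converges may a constant be
  subtracted under it.\<close>

lemma average_L2:
  assumes [measurable]: "f \<in> borel_measurable borel" and "f \<in> Lp_space 2"
  shows "average \<nu> f \<in> Lp_space 2" 
    and "(\<integral>x. (norm (average \<nu> f x))\<^sup>2 \<partial>lebesgue) \<le> (\<integral>x. (norm (f x))\<^sup>2 \<partial>lebesgue)"
    and "AE x in lborel. integrable \<nu> (\<lambda>z. f (x + z))"
proof -
  have fin: "(\<integral>\<^sup>+x. ennreal ((norm (f x))\<^sup>2) \<partial>lborel) < \<infinity>"
    using assms borel_L2_iff by blast
  show *: "average \<nu> f \<in> Lp_space 2" 
    using le_less_trans[OF nn_integral_average_le[OF assms(1)] fin] by (simp add: borel_L2_iff)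
  show "(\<integral>x. (norm (average \<nu> f x))\<^sup>2 \<partial>lebesgue) \<le> (\<integral>x. (norm (f x))\<^sup>2 \<partial>lebesgue)"
    using nn_integral_average_le[OF assms(1)] assms(2) * by (simp add: borel_L2_nn_integral ennreal_le_iff)
  have "AE x in lborel. (\<integral>\<^sup>+z. ennreal ((norm (f (x + z)))\<^sup>2) \<partial>\<nu>) \<noteq> \<infinity>"
    by (rule nn_integral_PInf_AE) (use fin nn_integral_average_sq[OF assms(1)] in \<open>auto simp: less_top\<close>)
  then show "AE x in lborel. integrable \<nu> (\<lambda>z. f (x + z))"
  proof eventually_elim
    case (elim x)
    then show ?case by (intro norm_integral_sq_le(2)) (auto simp: less_top)
  qed
qed

lemma integral_mult_average:
  assumes [measurable]: "f \<in> borel_measurable borel" "\<eta> \<in> borel_measurable borel"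
    and "f \<in> Lp_space 2" "\<eta> \<in> Lp_space 2"
  shows "(\<integral>x. \<eta> x *\<^sub>R average \<nu> f x \<partial>lborel) = (\<integral>z. (\<integral>x. \<eta> x *\<^sub>R f (x + z) \<partial>lborel) \<partial>\<nu>)"
proof -
  have fin: "(\<integral>\<^sup>+x. ennreal ((norm (f x))\<^sup>2) \<partial>lborel) < \<infinity>" "(\<integral>\<^sup>+x. ennreal ((norm (\<eta> x))\<^sup>2) \<partial>lborel) < \<infinity>"
    using assms(3,4) by (simp_all only: borel_L2_iff[OF assms(1)] borel_L2_iff[OF assms(2)])
  have "integrable (lborel \<Otimes>\<^sub>M \<nu>) (\<lambda>p. \<eta> (fst p) *\<^sub>R f (fst p + snd p))"
  proof (rule integrable_pair_L2_mult[OF prob_space_axioms])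
    show "(\<integral>\<^sup>+x. ennreal ((\<eta> (fst (x, z)))\<^sup>2) \<partial>lborel) \<le> (\<integral>\<^sup>+x. ennreal ((norm (\<eta> x))\<^sup>2) \<partial>lborel)" for z by simp
    show "(\<integral>\<^sup>+x. ennreal ((norm (f (fst (x, z) + snd (x, z))))\<^sup>2) \<partial>lborel) \<le> (\<integral>\<^sup>+x. ennreal ((norm (f x))\<^sup>2) \<partial>lborel)" for z 
      using nn_integral_lborel_translate[of "\<lambda>x. ennreal ((norm (f x))\<^sup>2)" z] by simp
  qed (use fin in measurable)
  from pair.Fubini_integral[of "\<lambda>x z. \<eta> x *\<^sub>R f (x + z)"] this
  show ?thesis by (simp add: average_def split_beta' integral_scaleR_right)
qed

text \<open>Fubini again, with the average now on the test function. The bound M makes it integrable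
  for the probability measure, so that \<open>f x\<close> can be pulled out of the inner
  integral.\<close>

lemma integral_averaged_mult:
  fixes f :: "'a \<Rightarrow> complex"
  assumes [measurable]: "f \<in> borel_measurable borel" "\<eta> \<in> borel_measurable borel"
    and "f \<in> Lp_space 2" "\<eta> \<in> Lp_space 2" and bd: "\<And>x. \<bar>\<eta> x\<bar> \<le> M"
  shows "(\<integral>x. (\<integral>z. \<eta> (x - z) \<partial>\<nu>) *\<^sub>R f x \<partial>lborel) = (\<integral>z. (\<integral>x. \<eta> (x - z) *\<^sub>R f x \<partial>lborel) \<partial>\<nu>)"
    (is "_ = ?r")
    and "integrable lborel (\<lambda>x. (\<integral>z. \<eta> (x - z) \<partial>\<nu>) *\<^sub>R f x)"
proof -
  have fin: "(\<integral>\<^sup>+x. ennreal ((norm (f x))\<^sup>2) \<partial>lborel) < \<infinity>" "(\<integral>\<^sup>+x. ennreal ((norm (\<eta> x))\<^sup>2) \<partial>lborel) < \<infinity>"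
    using assms(3,4) by (simp_all only: borel_L2_iff[OF assms(1)] borel_L2_iff[OF assms(2)])
  have "integrable (lborel \<Otimes>\<^sub>M \<nu>) (\<lambda>p. \<eta> (fst p - snd p) *\<^sub>R f (fst p))"
  proof (rule integrable_pair_L2_mult[OF prob_space_axioms])
    show "(\<integral>\<^sup>+x. ennreal ((\<eta> (fst (x, z) - snd (x, z)))\<^sup>2) \<partial>lborel) \<le> (\<integral>\<^sup>+x. ennreal ((norm (\<eta> x))\<^sup>2) \<partial>lborel)" for z 
      using nn_integral_lborel_translate[of "\<lambda>x. ennreal ((norm (\<eta> x))\<^sup>2)" "-z"] by simp
    show "(\<integral>\<^sup>+x. ennreal ((norm (f (fst (x, z))))\<^sup>2) \<partial>lborel) \<le> (\<integral>\<^sup>+x. ennreal ((norm (f x))\<^sup>2) \<partial>lborel)" for z 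
      by simp
  qed (use fin in measurable)
  then have int: "integrable (lborel \<Otimes>\<^sub>M \<nu>) (\<lambda>(x, z). \<eta> (x - z) *\<^sub>R f x)" by (simp add: split_beta')
  from pair.Fubini_integral[of "\<lambda>x z. \<eta> (x - z) *\<^sub>R f x"] this
  have "?r = (\<integral>x. (\<integral>z. \<eta> (x - z) *\<^sub>R f x \<partial>\<nu>) \<partial>lborel)" by (simp add: split_beta')
  moreover have *: "(\<integral>z. \<eta> (x - z) *\<^sub>R f x \<partial>\<nu>) = (\<integral>z. \<eta> (x - z) \<partial>\<nu>) *\<^sub>R f x" for x
    by (intro integral_scaleR_left integrable_const_bound[of _ M]) (use bd in auto)
  ultimately show "(\<integral>x. (\<integral>z. \<eta> (x - z) \<partial>\<nu>) *\<^sub>R f x \<partial>lborel) = ?r" by simp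
  show "integrable lborel (\<lambda>x. (\<integral>z. \<eta> (x - z) \<partial>\<nu>) *\<^sub>R f x)"
    using pair.integrable_fst[OF int] by (simp add: *)
qed

end

lemma test_function_borel: "test_function \<eta> \<Longrightarrow> \<eta> \<in> borel_measurable borel"
  by (intro borel_measurable_continuous_onI test_function_continuous)

lemma test_function_L2: 
  fixes \<eta> :: "'a::euclidean_space \<Rightarrow> real"
  assumes "test_function \<eta>" shows "\<eta> \<in> Lp_space 2"
proof -
  show ?thesis using test_function_measurable[OF assms] loc_integrable_test[OF loc_integrable_const test_function_mult[OF assms assms]]
    by (simp add: Lp_space_2_iff power2_eq_square)
qed

lemma integral_lebesgue_borel:
  fixes f :: "'a::euclidean_space \<Rightarrow> 'b::{banach,second_countable_topology}"
  shows "f \<in> borel_measurable borel \<Longrightarrow> (\<integral>x. f x \<partial>lebesgue) = (\<integral>x. f x \<partial>lborel)"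
  by (simp add: integral_completion)

lemma weak_partial_shifted:
  fixes \<phi> g :: "'a::euclidean_space \<Rightarrow> complex"
  assumes "is_weak_partial b \<phi> g" "test_function \<eta>" "b \<in> Basis"
    and [measurable]: "\<phi> \<in> borel_measurable borel" "g \<in> borel_measurable borel"
  shows "(\<integral>x. partial_deriv b \<eta> (x - z) *\<^sub>R \<phi> x \<partial>lborel) = - (\<integral>x. \<eta> (x - z) *\<^sub>R g x \<partial>lborel)"
proof -
  note t = test_function_translate[OF assms(2), of "-z"]
  note [measurable] = test_function_borel[OF test_function_partial_deriv[OF assms(2,3)]] test_function_borel[OF assms(2)]
  have "partial_deriv b (\<lambda>x. \<eta> (x + - z)) = (\<lambda>x. partial_deriv b \<eta> (x + - z))"
    using assms(2) by (intro partial_deriv_translate test_function_differentiable)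
  with assms(1) t have "(\<integral>x. partial_deriv b \<eta> (x - z) *\<^sub>R \<phi> x \<partial>lebesgue) = - (\<integral>x. \<eta> (x - z) *\<^sub>R g x \<partial>lebesgue)"
    unfolding is_weak_partial_def by force
  then show ?thesis by (simp add: integral_lebesgue_borel)
qed

lemma integral_shift_swap:
  fixes f :: "'a::euclidean_space \<Rightarrow> complex" and \<eta> :: "'a \<Rightarrow> real"
  assumes [measurable]: "f \<in> borel_measurable borel" "\<eta> \<in> borel_measurable borel"
  shows "(\<integral>x. \<eta> x *\<^sub>R f (x + z) \<partial>lborel) = (\<integral>x. \<eta> (x - z) *\<^sub>R f x \<partial>lborel)"
  using integral_lborel_translate[of "\<lambda>x. \<eta> (x - z) *\<^sub>R f x" z] by simp

text \<open>Fubini moves the shift by z onto the test function, whose translate is again a test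
  function; the weak derivative is then used for each z separately.\<close>

lemma (in averaging) average_weak_partial:
  assumes wp: "is_weak_partial b \<phi> g" and b: "b \<in> Basis"
    and [measurable]: "\<phi> \<in> borel_measurable borel" "g \<in> borel_measurable borel"
    and L2: "\<phi> \<in> Lp_space 2" "g \<in> Lp_space 2"
  shows "is_weak_partial b (average \<nu> \<phi>) (average \<nu> g)"
  unfolding is_weak_partial_def
proof (intro allI impI)
  fix \<eta> :: "'a \<Rightarrow> real" assume \<eta>: "test_function \<eta>"
  note \<eta>' = test_function_partial_deriv[OF \<eta> b]
  note [measurable] = test_function_borel[OF \<eta>] test_function_borel[OF \<eta>']
  have "(\<integral>x. partial_deriv b \<eta> x *\<^sub>R average \<nu> \<phi> x \<partial>lborel)
     = (\<integral>z. (\<integral>x. partial_deriv b \<eta> (x - z) *\<^sub>R \<phi> x \<partial>lborel) \<partial>\<nu>)"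
    using L2 test_function_L2[OF \<eta>'] by (simp add: integral_mult_average integral_shift_swap)
  also have "\<dots> = - (\<integral>z. (\<integral>x. \<eta> (x - z) *\<^sub>R g x \<partial>lborel) \<partial>\<nu>)"
    using wp b \<eta> by (simp add: weak_partial_shifted)
  also have "\<dots> = - (\<integral>x. \<eta> x *\<^sub>R average \<nu> g x \<partial>lborel)"
    using L2 test_function_L2[OF \<eta>] by (simp add: integral_mult_average integral_shift_swap)
  finally show "(\<integral>x. partial_deriv b \<eta> x *\<^sub>R average \<nu> \<phi> x \<partial>lebesgue) = - (\<integral>x. \<eta> x *\<^sub>R average \<nu> g x \<partial>lebesgue)"
    by (simp add: integral_lebesgue_borel)
qed

section \<open>Translation and approximation in \<open>H\<^sup>1\<close>\<close>

lemma directional_derivative_partial: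
  assumes "f differentiable (at x)"
  shows "frechet_derivative f (at x) h = (\<Sum>b\<in>Basis. (h \<bullet> b) * partial_deriv b f x)"
proof -
  have lin: "linear (frechet_derivative f (at x))" using assms by (rule linear_frechet_derivative)
  have "frechet_derivative f (at x) h = frechet_derivative f (at x) (\<Sum>b\<in>Basis. (h \<bullet> b) *\<^sub>R b)"
    by (simp add: euclidean_representation)
  also have "\<dots> = (\<Sum>b\<in>Basis. (h \<bullet> b) * partial_deriv b f x)"
    by (simp add: linear_sum[OF lin] linear_cmul[OF lin] partial_deriv_def)
  finally show ?thesis .
qed

text \<open>The law of s y for s uniform on [0,1]. It turns a mean along a segment into an
  \<open>average\<close>, so contraction in L2 and the Fubini rules apply to it.\<close>

definition segment_measure :: "'a::euclidean_space \<Rightarrow> 'a measure" where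
  "segment_measure y = distr (density lborel (\<lambda>s::real. ennreal (indicator {0..1} s))) borel (\<lambda>s. s *\<^sub>R y)"

lemma averaging_segment: "averaging (segment_measure y)"
proof -
  have "emeasure (density lborel (\<lambda>s::real. ennreal (indicator {0..1} s))) UNIV = 1"
    by (subst emeasure_density) (auto simp: ennreal_indicator)
  then have "prob_space (density lborel (\<lambda>s::real. ennreal (indicator {0..1} s)))"
    by (intro prob_spaceI) auto
  then have "prob_space (segment_measure y)"
    unfolding segment_measure_def by (rule prob_space.prob_space_distr) auto
  then show ?thesis by (simp add: averaging_def averaging_axioms_def segment_measure_def)
qed

lemma integral_segment_measure:
  fixes f :: "'a::euclidean_space \<Rightarrow> 'b::{banach,second_countable_topology}"
  assumes [measurable]: "f \<in> borel_measurable borel"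
  shows "(\<integral>z. f z \<partial>segment_measure y) = (\<integral>s. indicator {0..1} s *\<^sub>R f (s *\<^sub>R y) \<partial>lborel)"
  unfolding segment_measure_def by (subst integral_distr, measurable, subst integral_density) auto

text \<open>The fundamental theorem of calculus along s |-> x - s y, whose velocity -y causes the
  sign. The integral over \<open>segment_measure\<close> is the form that
  \<open>integral_averaged_mult\<close> accepts.\<close>

lemma test_function_increment:
  assumes \<eta>: "test_function \<eta>"
  shows "\<eta> (x - y) - \<eta> x = - (\<Sum>b\<in>Basis. (y \<bullet> b) * (\<integral>z. partial_deriv b \<eta> (x - z) \<partial>segment_measure y))"
proof -
  let ?f = "\<lambda>s. - (\<Sum>b\<in>Basis. (y \<bullet> b) * partial_deriv b \<eta> (x - s *\<^sub>R y))"
  have cont: "continuous_on UNIV (partial_deriv b \<eta>)" if "b \<in> Basis" for b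
    using test_function_partial_deriv[OF \<eta> that] test_function_continuous by blast
  have cont': "continuous_on A (\<lambda>s. partial_deriv b \<eta> (x - s *\<^sub>R y))" if "b \<in> Basis" for b A
    by (intro continuous_on_compose2[OF cont[OF that]] continuous_intros) auto
  have "(\<integral>s. indicator {0..1} s *\<^sub>R ?f s \<partial>lborel) = \<eta> (x - 1 *\<^sub>R y) - \<eta> (x - 0 *\<^sub>R y)"
  proof (rule integral_FTC_atLeastAtMost)
    fix s :: real
    have "((\<lambda>s. x - s *\<^sub>R y) has_derivative (\<lambda>h. - (h *\<^sub>R y))) (at s within {0..1})"
      by (auto intro!: derivative_eq_intros)
    from has_derivative_compose[OF this has_derivative_frechet[OF test_function_differentiable[OF \<eta>]]]
    show "((\<lambda>s. \<eta> (x - s *\<^sub>R y)) has_vector_derivative ?f s) (at s within {0..1})"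
      unfolding has_vector_derivative_def
      by (simp add: directional_derivative_partial[OF test_function_differentiable[OF \<eta>]]
          sum_negf sum_distrib_left mult.assoc)
  qed (use cont' in \<open>auto intro!: continuous_intros\<close>)
  also have "(\<integral>s. indicator {0..1} s *\<^sub>R ?f s \<partial>lborel)
    = - (\<Sum>b\<in>Basis. (y \<bullet> b) * (\<integral>s. indicator {0..1} s *\<^sub>R partial_deriv b \<eta> (x - s *\<^sub>R y) \<partial>lborel))"
  proof -
    have i: "integrable lborel (\<lambda>s. indicator {0..1} s *\<^sub>R partial_deriv b \<eta> (x - s *\<^sub>R y))" if "b \<in> Basis" for b
      by (intro borel_integrable_compact cont' that) auto
    have "(\<integral>s. indicator {0..1} s *\<^sub>R ?f s \<partial>lborel) = (\<integral>s. - (\<Sum>b\<in>Basis. (y \<bullet> b) * (indicator {0..1} s *\<^sub>R partial_deriv b \<eta> (x - s *\<^sub>R y))) \<partial>lborel)"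
      by (simp add: sum_distrib_left algebra_simps)
    also have "\<dots> = - (\<Sum>b\<in>Basis. \<integral>s. (y \<bullet> b) * (indicator {0..1} s *\<^sub>R partial_deriv b \<eta> (x - s *\<^sub>R y)) \<partial>lborel)"
      using i by (subst integral_minus, subst Bochner_Integration.integral_sum) (auto intro!: integrable_mult_right)
    finally show ?thesis by simp
  qed
  also have "\<dots> = - (\<Sum>b\<in>Basis. (y \<bullet> b) * (\<integral>z. partial_deriv b \<eta> (x - z) \<partial>segment_measure y))"
  proof -
    have "(\<integral>z. partial_deriv b \<eta> (x - z) \<partial>segment_measure y) = (\<integral>s. indicator {0..1} s *\<^sub>R partial_deriv b \<eta> (x - s *\<^sub>R y) \<partial>lborel)"
      if "b \<in> Basis" for b
    proof -
      note [measurable] = test_function_borel[OF test_function_partial_deriv[OF \<eta> that]]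
      show ?thesis by (rule integral_segment_measure) measurable
    qed
    then show ?thesis by simp
  qed
  finally show ?thesis by simp
qed

lemma L2_sum: 
  "(\<And>i. i \<in> A \<Longrightarrow> f i \<in> Lp_space 2) \<Longrightarrow> (\<lambda>x. \<Sum>i\<in>A. f i x) \<in> Lp_space 2"
proof (induction A rule: infinite_finite_induct)
  case (insert i A)
  then show ?case using L2_add[of "f i" "\<lambda>x. \<Sum>i\<in>A. f i x"] by simp
qed (simp_all add: Lp_space_2_iff)

lemma L2_translate:
  fixes f :: "'a::euclidean_space \<Rightarrow> 'b::{banach,second_countable_topology}"
  assumes [measurable]: "f \<in> borel_measurable borel" and "f \<in> Lp_space 2"
  shows "(\<lambda>x. f (x + a)) \<in> Lp_space 2"
proof -
  have "(\<lambda>x. f (x + a)) \<in> borel_measurable borel" by measurable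
  from borel_L2_iff[OF this] show ?thesis
    using assms(2) unfolding borel_L2_iff[OF assms(1)]
    using nn_integral_lborel_translate[of "\<lambda>x. ennreal ((norm (f x))\<^sup>2)" a] by simp
qed

locale borel_H1 =
  fixes \<phi> :: "'a::euclidean_space \<Rightarrow> complex" and g :: "'a \<Rightarrow> 'a \<Rightarrow> complex"
  assumes borel_\<phi> [measurable]: "\<phi> \<in> borel_measurable borel"
    and borel_g [measurable]: "\<And>b. b \<in> Basis \<Longrightarrow> g b \<in> borel_measurable borel"
    and L2_\<phi>: "\<phi> \<in> Lp_space 2" and L2_g: "\<And>b. b \<in> Basis \<Longrightarrow> g b \<in> Lp_space 2"
    and weak_partial_g: "\<And>b. b \<in> Basis \<Longrightarrow> is_weak_partial b \<phi> (g b)"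
begin

text \<open>The fundamental theorem of calculus in \<open>H1\<close>, by duality: against a test
  function the increment is shifted onto that function, expanded there classically, integrated by
  parts through the weak derivative for each point of the segment, and shifted back. The exceptional
  null set depends on y.\<close>

lemma increment_eq_average:
  "AE x in lborel. \<phi> (x + y) - \<phi> x = (\<Sum>b\<in>Basis. (y \<bullet> b) *\<^sub>R average (segment_measure y) (g b) x)"
proof -
  interpret averaging "segment_measure y" by (rule averaging_segment)
  let ?A = "average (segment_measure y)"
  let ?R = "\<lambda>x. \<Sum>b\<in>Basis. (y \<bullet> b) *\<^sub>R ?A (g b) x"
  have t: "(\<lambda>x. \<phi> (x + y)) \<in> Lp_space 2" by (rule L2_translate[OF borel_\<phi> L2_\<phi>])
  have a: "?A (g b) \<in> Lp_space 2" if "b \<in> Basis" for b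
    by (rule average_L2(1)[OF borel_g[OF that] L2_g[OF that]])
  have R: "?R \<in> Lp_space 2" by (intro L2_sum L2_scaleR a)
  have m[measurable]: "?A (g b) \<in> borel_measurable borel" if "b \<in> Basis" for b
    by (rule average_measurable[OF borel_g[OF that]])
  have [measurable]: "?R \<in> borel_measurable borel" by (intro borel_measurable_sum borel_measurable_scaleR m) auto
  have "AE x in lebesgue. \<phi> (x + y) - \<phi> x - ?R x = 0"
  proof (rule AE_zero_if_test_zero)
    show "loc_integrable (\<lambda>x. \<phi> (x + y) - \<phi> x - ?R x)"
      by (intro loc_integrable_L2 L2_diff t L2_\<phi> R)
    fix \<eta> :: "'a \<Rightarrow> real" assume \<eta>: "test_function \<eta>"
    note [measurable] = test_function_borel[OF \<eta>]
    have i: "integrable lborel (\<lambda>x. \<eta> x *\<^sub>R f x)" if "f \<in> Lp_space 2" and [measurable]: "f \<in> borel_measurable borel"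
      for f :: "'a \<Rightarrow> complex"
      using loc_integrable_test[OF loc_integrable_L2[OF that(1)] \<eta>] 
        integrable_completion[of "\<lambda>x. \<eta> x *\<^sub>R f x" lborel] by simp
    have "(\<integral>x. \<eta> x *\<^sub>R (\<phi> (x + y) - \<phi> x) \<partial>lborel) = (\<integral>x. \<eta> x *\<^sub>R \<phi> (x + y) \<partial>lborel) - (\<integral>x. \<eta> x *\<^sub>R \<phi> x \<partial>lborel)"
      unfolding scaleR_diff_right by (intro Bochner_Integration.integral_diff i t L2_\<phi>) measurable
    also have "\<dots> = (\<integral>x. \<eta> (x - y) *\<^sub>R \<phi> x \<partial>lborel) - (\<integral>x. \<eta> x *\<^sub>R \<phi> x \<partial>lborel)"
      by (subst integral_shift_swap) auto
    also have "\<dots> = (\<integral>x. (\<eta> (x - y) - \<eta> x) *\<^sub>R \<phi> x \<partial>lborel)"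
    proof -
      have "integrable lborel (\<lambda>x. \<eta> (x - y) *\<^sub>R \<phi> x)"
        using loc_integrable_test[OF loc_integrable_L2[OF L2_\<phi>] test_function_translate[OF \<eta>, of "-y"]]
          integrable_completion[of "\<lambda>x. \<eta> (x - y) *\<^sub>R \<phi> x" lborel] by simp
      from Bochner_Integration.integral_diff[OF this i[OF L2_\<phi> borel_\<phi>]]
      show ?thesis by (simp add: scaleR_diff_left)
    qed
    also have "\<dots> = (\<integral>x. - (\<Sum>b\<in>Basis. (y \<bullet> b) *\<^sub>R ((\<integral>z. partial_deriv b \<eta> (x - z) \<partial>segment_measure y) *\<^sub>R \<phi> x)) \<partial>lborel)"
      unfolding test_function_increment[OF \<eta>] by (simp add: scaleR_sum_left)
    also have "\<dots> = - (\<Sum>b\<in>Basis. (y \<bullet> b) *\<^sub>R (\<integral>x. (\<integral>z. partial_deriv b \<eta> (x - z) \<partial>segment_measure y) *\<^sub>R \<phi> x \<partial>lborel))"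
    proof -
      have "integrable lborel (\<lambda>x. (\<integral>z. partial_deriv b \<eta> (x - z) \<partial>segment_measure y) *\<^sub>R \<phi> x)" if "b \<in> Basis" for b
      proof -
        note \<eta>' = test_function_partial_deriv[OF \<eta> that]
        obtain M where "\<And>x. \<bar>partial_deriv b \<eta> x\<bar> \<le> M" using test_function_bounded[OF \<eta>'] by metis
        then show ?thesis
          by (rule integral_averaged_mult(2)[OF borel_\<phi> test_function_borel[OF \<eta>'] L2_\<phi> test_function_L2[OF \<eta>']])
      qed
      then show ?thesis
        by (subst integral_minus, subst Bochner_Integration.integral_sum) (auto simp del: scaleR_scaleR)
    qed
    also have "\<dots> = (\<Sum>b\<in>Basis. (y \<bullet> b) *\<^sub>R (\<integral>x. \<eta> x *\<^sub>R ?A (g b) x \<partial>lborel))"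
    proof -
      have "(\<integral>x. (\<integral>z. partial_deriv b \<eta> (x - z) \<partial>segment_measure y) *\<^sub>R \<phi> x \<partial>lborel) = - (\<integral>x. \<eta> x *\<^sub>R ?A (g b) x \<partial>lborel)"
        if b: "b \<in> Basis" for b
      proof -
        note \<eta>' = test_function_partial_deriv[OF \<eta> b]
        obtain M where "\<And>x. \<bar>partial_deriv b \<eta> x\<bar> \<le> M" using test_function_bounded[OF \<eta>'] by metis
        then have "(\<integral>x. (\<integral>z. partial_deriv b \<eta> (x - z) \<partial>segment_measure y) *\<^sub>R \<phi> x \<partial>lborel)
          = (\<integral>z. (\<integral>x. partial_deriv b \<eta> (x - z) *\<^sub>R \<phi> x \<partial>lborel) \<partial>segment_measure y)"
          by (rule integral_averaged_mult(1)[OF borel_\<phi> test_function_borel[OF \<eta>'] L2_\<phi> test_function_L2[OF \<eta>']])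
        also have "\<dots> = - (\<integral>z. (\<integral>x. \<eta> (x - z) *\<^sub>R g b x \<partial>lborel) \<partial>segment_measure y)"
          using weak_partial_shifted[OF weak_partial_g[OF b] \<eta> b borel_\<phi> borel_g[OF b]] by simp
        also have "\<dots> = - (\<integral>x. \<eta> x *\<^sub>R ?A (g b) x \<partial>lborel)"
          using integral_mult_average[OF borel_g[OF b] test_function_borel[OF \<eta>] L2_g[OF b] test_function_L2[OF \<eta>]]
            integral_shift_swap[OF borel_g[OF b] test_function_borel[OF \<eta>]] by simp
        finally show ?thesis .
      qed
      then show ?thesis by (simp add: sum_negf)
    qed
    also have "\<dots> = (\<integral>x. \<eta> x *\<^sub>R ?R x \<partial>lborel)"
    proof -
      have "(\<integral>x. \<eta> x *\<^sub>R ?R x \<partial>lborel) = (\<integral>x. (\<Sum>b\<in>Basis. (y \<bullet> b) *\<^sub>R (\<eta> x *\<^sub>R ?A (g b) x)) \<partial>lborel)"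
        by (simp add: scaleR_sum_right mult.commute)
      also have "\<dots> = (\<Sum>b\<in>Basis. (y \<bullet> b) *\<^sub>R (\<integral>x. \<eta> x *\<^sub>R ?A (g b) x \<partial>lborel))"
        by (subst Bochner_Integration.integral_sum) (auto intro!: integrable_scaleR_right i a m simp del: scaleR_scaleR)
      finally show ?thesis by simp
    qed
    finally have "(\<integral>x. \<eta> x *\<^sub>R (\<phi> (x + y) - \<phi> x) \<partial>lborel) = (\<integral>x. \<eta> x *\<^sub>R ?R x \<partial>lborel)" .
    then have "(\<integral>x. \<eta> x *\<^sub>R (\<phi> (x + y) - \<phi> x - ?R x) \<partial>lborel) = 0"
      unfolding scaleR_diff_right[of _ "\<phi> (_ + y) - \<phi> _"]
      by (subst Bochner_Integration.integral_diff) (auto intro!: i R L2_diff t L2_\<phi>)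
    then show "(\<integral>x. \<eta> x *\<^sub>R (\<phi> (x + y) - \<phi> x - ?R x) \<partial>lebesgue) = 0"
      by (subst integral_lebesgue_borel) auto
  qed
  then show ?thesis by (simp add: AE_completion_iff)
qed

definition energy :: real where
  "energy = (\<Sum>b\<in>Basis. \<integral>x. (cmod (g b x))\<^sup>2 \<partial>lebesgue)"

lemma energy_nonneg: "0 \<le> energy"
  unfolding energy_def by (intro sum_nonneg integral_nonneg_AE) auto

text \<open>Cauchy-Schwarz over the basis directions splits off |y|^2, and averaging along the
  segment does not increase the L2 norms of the derivatives.\<close>

lemma nn_integral_increment_sq:
  "(\<integral>\<^sup>+x. ennreal ((cmod (\<phi> (x + y) - \<phi> x))\<^sup>2) \<partial>lborel) \<le> ennreal ((norm y)\<^sup>2 * energy)"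
proof -
  interpret averaging "segment_measure y" by (rule averaging_segment)
  let ?A = "average (segment_measure y)"
  have m[measurable]: "?A (g b) \<in> borel_measurable borel" if "b \<in> Basis" for b
    by (rule average_measurable[OF borel_g[OF that]])
  have "(\<integral>\<^sup>+x. ennreal ((cmod (\<phi> (x + y) - \<phi> x))\<^sup>2) \<partial>lborel) 
     \<le> (\<integral>\<^sup>+x. ennreal ((norm y)\<^sup>2) * (\<Sum>b\<in>Basis. ennreal ((cmod (?A (g b) x))\<^sup>2)) \<partial>lborel)"
  proof (rule nn_integral_mono_AE, use increment_eq_average[of y] in eventually_elim)
    fix x assume x: "\<phi> (x + y) - \<phi> x = (\<Sum>b\<in>Basis. (y \<bullet> b) *\<^sub>R ?A (g b) x)"
    have "cmod (\<phi> (x + y) - \<phi> x) \<le> (\<Sum>b\<in>Basis. \<bar>y \<bullet> b\<bar> * cmod (?A (g b) x))"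
      unfolding x by (rule order_trans[OF norm_sum]) simp
    then have "(cmod (\<phi> (x + y) - \<phi> x))\<^sup>2 \<le> (\<Sum>b\<in>Basis. \<bar>y \<bullet> b\<bar> * cmod (?A (g b) x))\<^sup>2"
      by (intro power_mono) auto
    also have "\<dots> \<le> (\<Sum>b\<in>Basis. \<bar>y \<bullet> b\<bar>\<^sup>2) * (\<Sum>b\<in>Basis. (cmod (?A (g b) x))\<^sup>2)"
      by (rule Cauchy_Schwarz_ineq_sum)
    also have "(\<Sum>b\<in>Basis. \<bar>y \<bullet> b\<bar>\<^sup>2) = (norm y)\<^sup>2"
      by (subst power2_norm_eq_inner, subst euclidean_inner) (simp add: power2_eq_square)
    finally have "(cmod (\<phi> (x + y) - \<phi> x))\<^sup>2 \<le> (norm y)\<^sup>2 * (\<Sum>b\<in>Basis. (cmod (?A (g b) x))\<^sup>2)" .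
    then show "ennreal ((cmod (\<phi> (x + y) - \<phi> x))\<^sup>2) \<le> ennreal ((norm y)\<^sup>2) * (\<Sum>b\<in>Basis. ennreal ((cmod (?A (g b) x))\<^sup>2))"
      by (simp add: sum_ennreal ennreal_mult[symmetric] sum_nonneg ennreal_leI)
  qed
  also have "\<dots> = ennreal ((norm y)\<^sup>2) * (\<Sum>b\<in>Basis. \<integral>\<^sup>+x. ennreal ((cmod (?A (g b) x))\<^sup>2) \<partial>lborel)"
    by (subst nn_integral_cmult, use m in measurable, subst nn_integral_sum) (use m in auto)
  also have "\<dots> \<le> ennreal ((norm y)\<^sup>2) * (\<Sum>b\<in>Basis. ennreal (\<integral>x. (cmod (g b x))\<^sup>2 \<partial>lebesgue))"
  proof (intro mult_left_mono sum_mono)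
    fix b :: 'a assume b: "b \<in> Basis"
    show "(\<integral>\<^sup>+x. ennreal ((cmod (?A (g b) x))\<^sup>2) \<partial>lborel) \<le> ennreal (\<integral>x. (cmod (g b x))\<^sup>2 \<partial>lebesgue)"
      using nn_integral_average_le[OF borel_g[OF b]] borel_L2_nn_integral[OF borel_g[OF b] L2_g[OF b]] by simp
  qed auto
  also have "\<dots> = ennreal ((norm y)\<^sup>2 * energy)"
    unfolding energy_def by (subst sum_ennreal) (auto simp: ennreal_mult sum_nonneg integral_nonneg_AE)
  finally show ?thesis .
qed

end

section \<open>Regularization by averages over small balls\<close>

lemma emeasure_lborel_ball_neq_0: "r > 0 \<Longrightarrow> emeasure lborel (ball c r) \<noteq> 0"
  for c :: "'a::euclidean_space"
  using content_ball_pos[of r c]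
  by (metis measure_def enn2real_0 less_irrefl measure_completion sets_lborel borel_open open_ball)

lemma averaging_ball:
  assumes "r > 0"
  shows "averaging (uniform_measure lborel (ball (0::'a::euclidean_space) r))"
proof -
  note emeasure_lborel_ball_neq_0[OF assms, of "0::'a"]
  moreover have "emeasure lborel (ball (0::'a) r) \<noteq> \<infinity>"
    using emeasure_lborel_ball_finite[of "0::'a" r] by (simp add: less_top)
  ultimately have "prob_space (uniform_measure lborel (ball (0::'a) r))"
    by (rule prob_space_uniform_measure)
  then show ?thesis by (simp add: averaging_def averaging_axioms_def)
qed

text \<open>By Jensen, the squared average is at most the squared L2 norm divided by the volume of
  the ball, wherever the ball is centred. The bound deteriorates as r shrinks, which is harmless: it
  is used for one radius at a time.\<close>

lemma (in borel_H1) ball_average_bounded: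
  assumes "r > 0"
  shows "\<exists>B. \<forall>x. cmod (average (uniform_measure lborel (ball 0 r)) \<phi> x) \<le> B"
proof -
  interpret averaging "uniform_measure lborel (ball (0::'a) r)" by (rule averaging_ball[OF assms])
  let ?v = "emeasure lborel (ball (0::'a) r)"
  have v: "?v \<noteq> 0" by (rule emeasure_lborel_ball_neq_0[OF assms])
  define C where "C = (\<integral>\<^sup>+x. ennreal ((cmod (\<phi> x))\<^sup>2) \<partial>lborel) / ?v"
  have C: "C < \<infinity>" using L2_\<phi> v unfolding C_def borel_L2_iff[OF borel_\<phi>] by (simp add: less_top[symmetric] ennreal_divide_eq_top_iff)
  have "cmod (average (uniform_measure lborel (ball 0 r)) \<phi> x) \<le> sqrt (enn2real C)" for x
  proof -
    have "ennreal ((cmod (average (uniform_measure lborel (ball 0 r)) \<phi> x))\<^sup>2)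
      \<le> (\<integral>\<^sup>+z. ennreal ((cmod (\<phi> (x + z)))\<^sup>2) \<partial>uniform_measure lborel (ball 0 r))"
      by (rule average_sq_le) measurable
    also have "\<dots> = (\<integral>\<^sup>+z. ennreal ((cmod (\<phi> (x + z)))\<^sup>2) * indicator (ball 0 r) z \<partial>lborel) / ?v"
      by (rule nn_integral_uniform_measure) measurable
    also have "\<dots> \<le> (\<integral>\<^sup>+z. ennreal ((cmod (\<phi> (z + x)))\<^sup>2) \<partial>lborel) / ?v"
      by (intro divide_right_mono_ennreal nn_integral_mono) (auto simp: indicator_def add.commute)
    also have "\<dots> = C"
      unfolding C_def using nn_integral_lborel_translate[of "\<lambda>x. ennreal ((cmod (\<phi> x))\<^sup>2)" x] by simp
    also have "C = ennreal (enn2real C)" using C by simp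
    finally have "(cmod (average (uniform_measure lborel (ball 0 r)) \<phi> x))\<^sup>2 \<le> enn2real C"
      by (subst (asm) ennreal_le_iff) auto
    then show ?thesis by (rule real_le_rsqrt)
  qed
  then show ?thesis by blast
qed

text \<open>Jensen and Fubini reduce the error to a mean, over |z| < r, of squared L2 norms of
  increments by z, to which the translation estimate applies.\<close>

lemma (in borel_H1) ball_average_close:
  assumes "r > 0"
  shows "(\<integral>\<^sup>+x. ennreal ((cmod (average (uniform_measure lborel (ball 0 r)) \<phi> x - \<phi> x))\<^sup>2) \<partial>lborel) \<le> ennreal (r\<^sup>2 * energy)"
proof -
  let ?\<nu> = "uniform_measure lborel (ball (0::'a) r)"
  interpret averaging ?\<nu> by (rule averaging_ball[OF assms])
  have [simp]: "prob UNIV = 1" using prob_space by simp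
  have "(\<integral>\<^sup>+x. ennreal ((cmod (average ?\<nu> \<phi> x - \<phi> x))\<^sup>2) \<partial>lborel)
    \<le> (\<integral>\<^sup>+x. (\<integral>\<^sup>+z. ennreal ((cmod (\<phi> (x + z) - \<phi> x))\<^sup>2) \<partial>?\<nu>) \<partial>lborel)"
  proof (rule nn_integral_mono_AE, use average_L2(3)[OF borel_\<phi> L2_\<phi>] in eventually_elim)
    fix x assume x: "integrable ?\<nu> (\<lambda>z. \<phi> (x + z))"
    have "(\<integral>z. \<phi> (x + z) - \<phi> x \<partial>?\<nu>) = average ?\<nu> \<phi> x - \<phi> x"
      unfolding average_def using x by (subst Bochner_Integration.integral_diff) (auto simp: prob_space)
    then show "ennreal ((cmod (average ?\<nu> \<phi> x - \<phi> x))\<^sup>2) \<le> (\<integral>\<^sup>+z. ennreal ((cmod (\<phi> (x + z) - \<phi> x))\<^sup>2) \<partial>?\<nu>)"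
      using norm_integral_sq_le(1)[of "\<lambda>z. \<phi> (x + z) - \<phi> x"] by simp
  qed
  also have "\<dots> = (\<integral>\<^sup>+z. (\<integral>\<^sup>+x. ennreal ((cmod (\<phi> (x + z) - \<phi> x))\<^sup>2) \<partial>lborel) \<partial>?\<nu>)"
    by (rule pair.Fubini'[symmetric]) measurable
  also have "\<dots> \<le> (\<integral>\<^sup>+z. ennreal (r\<^sup>2 * energy) \<partial>?\<nu>)"
  proof (rule nn_integral_mono_AE)
    have "AE z in ?\<nu>. z \<in> ball 0 r" by (rule AE_uniform_measureI) auto
    then show "AE z in ?\<nu>. (\<integral>\<^sup>+x. ennreal ((cmod (\<phi> (x + z) - \<phi> x))\<^sup>2) \<partial>lborel) \<le> ennreal (r\<^sup>2 * energy)"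
    proof eventually_elim
      case (elim z)
      then have "(norm z)\<^sup>2 * energy \<le> r\<^sup>2 * energy"
        using energy_nonneg by (intro mult_right_mono power_mono) auto
      then show ?case using nn_integral_increment_sq[of z] by (meson ennreal_leI order_trans)
    qed
  qed
  also have "\<dots> = ennreal (r\<^sup>2 * energy)" by (simp only: nn_integral_const emeasure_space_1 mult_1_right)
  finally show ?thesis .
qed

lemma H1_borel_representative:
  fixes \<phi> :: "'a::euclidean_space \<Rightarrow> complex"
  assumes "\<phi> \<in> H1"
  obtains \<phi>' g where "borel_H1 \<phi>' g" "AE x in lebesgue. \<phi> x = \<phi>' x"
    "\<And>b. b \<in> Basis \<Longrightarrow> AE x in lebesgue. weak_partial b \<phi> x = g b x"
proof -
  obtain \<phi>' where \<phi>': "\<phi>' \<in> borel_measurable borel" "AE x in lebesgue. \<phi> x = \<phi>' x" "\<phi>' \<in> Lp_space 2"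
    using L2_borel_representative[OF H1_L2[OF assms]] by metis
  have "\<exists>h. h \<in> borel_measurable borel \<and> (AE x in lebesgue. weak_partial b \<phi> x = h x) \<and> h \<in> Lp_space 2" if "b \<in> Basis" for b
    using L2_borel_representative[OF weak_partial_props(1)[OF assms that]] by metis
  then obtain g where g: "\<And>b. b \<in> Basis \<Longrightarrow> g b \<in> borel_measurable borel"
     "\<And>b. b \<in> Basis \<Longrightarrow> AE x in lebesgue. weak_partial b \<phi> x = g b x"
     "\<And>b. b \<in> Basis \<Longrightarrow> g b \<in> Lp_space 2"
    by metis
  have "is_weak_partial b \<phi>' (g b)" if "b \<in> Basis" for b
    by (rule is_weak_partial_cong_AE[OF weak_partial_props(2)[OF assms that] that \<phi>'(2) g(2)[OF that]])
      (use H1_L2[OF assms] \<phi>'(3) g(3)[OF that] weak_partial_props(1)[OF assms that] in \<open>auto simp: Lp_space_2_iff\<close>)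
  with \<phi>' g have "borel_H1 \<phi>' g" by (simp add: borel_H1_def)
  from that[OF this \<phi>'(2) g(2)] show thesis by blast
qed

text \<open>Averaging contracts \<open>\<phi>\<close> and, since it commutes with weak derivatives,
  also the gradient. Boundedness makes the potential energy of each approximant integrable directly
  from a majorant of the potential.\<close>

lemma H1_bounded_approximation:
  fixes \<phi> :: "'a::euclidean_space \<Rightarrow> complex"
  assumes "\<phi> \<in> H1"
  obtains u :: "nat \<Rightarrow> 'a \<Rightarrow> complex" where "\<And>n. u n \<in> H1" "\<And>n. \<exists>B. \<forall>x. cmod (u n x) \<le> B"
    "\<And>n. (\<integral>x. (cmod (u n x))\<^sup>2 \<partial>lebesgue) \<le> (\<integral>x. (cmod (\<phi> x))\<^sup>2 \<partial>lebesgue)"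
    "\<And>n. grad_norm_sq (u n) \<le> grad_norm_sq \<phi>"
    "AE x in lebesgue. (\<lambda>n. u n x) \<longlonglongrightarrow> \<phi> x"
proof -
  obtain \<phi>' g where "borel_H1 \<phi>' g" and \<phi>': "AE x in lebesgue. \<phi> x = \<phi>' x"
    and g: "\<And>b. b \<in> Basis \<Longrightarrow> AE x in lebesgue. weak_partial b \<phi> x = g b x"
    using H1_borel_representative[OF assms] by metis
  interpret borel_H1 \<phi>' g by fact
  define r where "r n = 1 / real (Suc n)" for n
  have r: "r n > 0" for n by (simp add: r_def)
  define \<nu> where "\<nu> n = uniform_measure lborel (ball (0::'a) (r n))" for n
  have av: "averaging (\<nu> n)" for n unfolding \<nu>_def by (rule averaging_ball[OF r])
  define w where "w n = average (\<nu> n) \<phi>'" for n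
  have [measurable]: "w n \<in> borel_measurable borel" for n
    unfolding w_def by (rule averaging.average_measurable[OF av borel_\<phi>])
  have wL2: "w n \<in> Lp_space 2" for n unfolding w_def by (rule averaging.average_L2(1)[OF av borel_\<phi> L2_\<phi>])
  have wp: "is_weak_partial b (w n) (average (\<nu> n) (g b))" "average (\<nu> n) (g b) \<in> Lp_space 2" if "b \<in> Basis" for b n
    unfolding w_def using that
    by (auto intro!: averaging.average_weak_partial[OF av] averaging.average_L2(1)[OF av] weak_partial_g borel_g L2_g borel_\<phi> L2_\<phi>)
  have wH1: "w n \<in> H1" for n using wL2 wp unfolding H1_def by blast
  have wgrad: "grad_norm_sq (w n) \<le> grad_norm_sq \<phi>" for n
    unfolding grad_norm_sq_def
  proof (rule sum_mono)
    fix b :: 'a assume b: "b \<in> Basis"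
    note m = wp(2)[OF b] weak_partial_props(1)[OF wH1 b] weak_partial_props(1)[OF assms b] L2_g[OF b]
    have "AE x in lebesgue. weak_partial b (w n) x = average (\<nu> n) (g b) x"
      by (rule weak_partial_AE_eq[OF wH1 b wp[OF b]])
    then have "(\<integral>x. (cmod (weak_partial b (w n) x))\<^sup>2 \<partial>lebesgue) = (\<integral>x. (cmod (average (\<nu> n) (g b) x))\<^sup>2 \<partial>lebesgue)"
      using m(1,2) by (intro integral_cong_AE) (auto simp: Lp_space_2_iff)
    also have "\<dots> \<le> (\<integral>x. (cmod (g b x))\<^sup>2 \<partial>lebesgue)"
      by (rule averaging.average_L2(2)[OF av borel_g[OF b] L2_g[OF b]])
    also have "\<dots> = (\<integral>x. (cmod (weak_partial b \<phi> x))\<^sup>2 \<partial>lebesgue)"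
      using m(3,4) g[OF b] by (intro integral_cong_AE) (auto simp: Lp_space_2_iff)
    finally show "(\<integral>x. (cmod (weak_partial b (w n) x))\<^sup>2 \<partial>lebesgue) \<le> \<dots>" .
  qed
  have wnorm: "(\<integral>x. (cmod (w n x))\<^sup>2 \<partial>lebesgue) \<le> (\<integral>x. (cmod (\<phi> x))\<^sup>2 \<partial>lebesgue)" for n
  proof -
    have "(\<integral>x. (cmod (w n x))\<^sup>2 \<partial>lebesgue) \<le> (\<integral>x. (cmod (\<phi>' x))\<^sup>2 \<partial>lebesgue)"
      unfolding w_def by (rule averaging.average_L2(2)[OF av borel_\<phi> L2_\<phi>])
    also have "\<dots> = (\<integral>x. (cmod (\<phi> x))\<^sup>2 \<partial>lebesgue)"
      using \<phi>' L2_\<phi> H1_L2[OF assms] by (intro integral_cong_AE) (auto simp: Lp_space_2_iff)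
    finally show ?thesis .
  qed
  have wbd: "\<exists>B. \<forall>x. cmod (w n x) \<le> B" for n
    unfolding w_def \<nu>_def by (rule ball_average_bounded[OF r])
  have close: "(\<integral>\<^sup>+x. ennreal ((cmod (w n x - \<phi>' x))\<^sup>2) \<partial>lborel) \<le> ennreal ((r n)\<^sup>2 * energy)" for n
    unfolding w_def \<nu>_def by (rule ball_average_close[OF r])
  have int: "integrable lborel (\<lambda>x. (cmod (w n x - \<phi>' x))\<^sup>2)" for n
    using le_less_trans[OF close[of n]] by (simp add: integrable_iff_bounded)
  have "(\<lambda>n. \<integral>x. (cmod (w n x - \<phi>' x))\<^sup>2 \<partial>lborel) \<longlonglongrightarrow> 0"
  proof (rule tendsto_sandwich[OF _ _ tendsto_const])
    show "\<forall>\<^sub>F n in sequentially. (\<integral>x. (cmod (w n x - \<phi>' x))\<^sup>2 \<partial>lborel) \<le> (r n)\<^sup>2 * energy"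
    proof (intro always_eventually allI)
      fix n
      have "ennreal (\<integral>x. (cmod (w n x - \<phi>' x))\<^sup>2 \<partial>lborel) \<le> ennreal ((r n)\<^sup>2 * energy)"
        using close[of n] nn_integral_eq_integral[OF int[of n]] by simp
      then show "(\<integral>x. (cmod (w n x - \<phi>' x))\<^sup>2 \<partial>lborel) \<le> (r n)\<^sup>2 * energy"
        using energy_nonneg by (subst (asm) ennreal_le_iff) auto
    qed
    have "(\<lambda>n. (r n)\<^sup>2 * energy) \<longlonglongrightarrow> 0\<^sup>2 * energy"
      unfolding r_def by (intro tendsto_intros lim_1_over_n[THEN LIMSEQ_Suc])
    then show "(\<lambda>n. (r n)\<^sup>2 * energy) \<longlonglongrightarrow> 0" by simp
  qed (auto intro!: always_eventually integral_nonneg_AE)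
  \<comment> \<open>Convergence in L2 gives pointwise convergence only along a subsequence; the
    other properties hold for every index and therefore survive.\<close>
  then obtain s where s: "strict_mono s" "AE x in lborel. (\<lambda>n. (cmod (w (s n) x - \<phi>' x))\<^sup>2) \<longlonglongrightarrow> 0"
    using tendsto_L1_AE_subseq[of lborel "\<lambda>n x. (cmod (w n x - \<phi>' x))\<^sup>2"] int by auto
  have "AE x in lebesgue. (\<lambda>n. w (s n) x) \<longlonglongrightarrow> \<phi> x"
    using AE_completion[OF s(2)] \<phi>'
  proof eventually_elim
    case (elim x)
    have "(\<lambda>n. sqrt ((cmod (w (s n) x - \<phi>' x))\<^sup>2)) \<longlonglongrightarrow> sqrt 0"
      by (intro tendsto_real_sqrt elim)
    then have "(\<lambda>n. w (s n) x - \<phi>' x) \<longlonglongrightarrow> 0" by (simp add: tendsto_norm_zero_iff)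
    then show ?case using elim(2) LIM_zero_cancel by auto
  qed
  from that[of "\<lambda>n. w (s n)", OF wH1 wbd wnorm wgrad this] show thesis .
qed

section \<open>Potentials and continuous representatives\<close>

lemma integrable_test_function:
  fixes \<eta> :: "'a::euclidean_space \<Rightarrow> real"
  assumes "test_function \<eta>"
  shows "integrable lborel \<eta>"
  using loc_integrable_test[OF loc_integrable_const assms] integrable_completion[of \<eta> lborel]
    test_function_borel[OF assms] by simp

text \<open>F(x) - F(x - b) is the mean of the derivative of F over the segment from x - b to x.
  Integrated over x, the left side vanishes by translation invariance, while Fubini turns the right
  side into the integral in question.\<close>

lemma integral_partial_deriv_eq_0:
  fixes F :: "'a::euclidean_space \<Rightarrow> real"
  assumes F: "test_function F" and b: "b \<in> Basis"
  shows "(\<integral>x. partial_deriv b F x \<partial>lborel) = 0"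
proof -
  interpret averaging "segment_measure b" by (rule averaging_segment)
  note F' = test_function_partial_deriv[OF F b]
  note [measurable] = test_function_borel[OF F] test_function_borel[OF F']
  obtain R where R: "\<And>x. x \<notin> ball 0 R \<Longrightarrow> partial_deriv b F x = 0"
    using test_function_support[OF F'] by metis
  have [measurable]: "ball 0 R \<in> sets (borel :: 'a measure)" by simp
  \<comment> \<open>The derivative equals its product with the indicator of a ball containing its
    support. This gives the two L2 factors of \<open>integrable_pair_L2_mult\<close>, the second one
    complex as required there.\<close>
  have 1: "integrable (lborel \<Otimes>\<^sub>M segment_measure b)
     (\<lambda>p. partial_deriv b F (fst p - snd p) *\<^sub>R (complex_of_real (indicator (ball 0 R) (fst p - snd p))))"
  proof (rule integrable_pair_L2_mult[OF prob_space_axioms])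
    show "(\<integral>\<^sup>+x. ennreal ((partial_deriv b F (fst (x, z) - snd (x, z)))\<^sup>2) \<partial>lborel) \<le> (\<integral>\<^sup>+x. ennreal ((norm (partial_deriv b F x))\<^sup>2) \<partial>lborel)" for z 
      using nn_integral_lborel_translate[of "\<lambda>x. ennreal ((norm (partial_deriv b F x))\<^sup>2)" "-z"] by simp
    show "(\<integral>\<^sup>+x. ennreal ((cmod (complex_of_real (indicator (ball 0 R) (fst (x, z) - snd (x, z)))))\<^sup>2) \<partial>lborel) \<le> (\<integral>\<^sup>+x. indicator (ball 0 R) (x::'a) \<partial>lborel)" for z :: 'a
    proof -
      have "ennreal ((cmod (complex_of_real (indicator (ball 0 R) (x - z))))\<^sup>2) = indicator (ball 0 R) (x - z)" for x
        by (auto simp: indicator_def)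
      moreover have "(indicator (ball (0::'a) R) :: 'a \<Rightarrow> ennreal) \<in> borel_measurable borel" by (intro borel_measurable_indicator) simp
      ultimately show ?thesis 
        using nn_integral_lborel_translate[of "indicator (ball (0::'a) R)" "-z"] by simp
    qed
    show "(\<integral>\<^sup>+x. ennreal ((norm (partial_deriv b F x))\<^sup>2) \<partial>lborel) < \<infinity>"
      using test_function_L2[OF F'] unfolding borel_L2_iff[OF test_function_borel[OF F']] .
    show "(\<integral>\<^sup>+x. indicator (ball 0 R) (x::'a) \<partial>lborel) < \<infinity>"
      using emeasure_lborel_ball_finite[of "0::'a" R] by simp
  qed measurable
  have "integrable (lborel \<Otimes>\<^sub>M segment_measure b) (\<lambda>p. partial_deriv b F (fst p - snd p))"
  proof -
    have *: "Re (partial_deriv b F x *\<^sub>R complex_of_real (indicator (ball 0 R) x)) = partial_deriv b F x" for x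
      using R[of x] by (cases "x \<in> ball 0 R") auto
    show ?thesis using integrable_Re[OF 1] by (simp only: *)
  qed
  then have "(\<integral>x. (\<integral>z. partial_deriv b F (x - z) \<partial>segment_measure b) \<partial>lborel)
    = (\<integral>z. (\<integral>x. partial_deriv b F (x - z) \<partial>lborel) \<partial>segment_measure b)"
    using pair.Fubini_integral[of "\<lambda>x z. partial_deriv b F (x - z)"] by (simp add: split_beta')
  also have "\<dots> = (\<integral>x. partial_deriv b F x \<partial>lborel)"
  proof -
    have "(\<integral>x. partial_deriv b F (x - z) \<partial>lborel) = (\<integral>x. partial_deriv b F x \<partial>lborel)" for z
      using integral_lborel_translate[of "partial_deriv b F" "-z"] by simp
    moreover have "prob UNIV = 1" using prob_space sets_eq_imp_space_eq[OF sets_eq] by simp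
    ultimately show ?thesis using sets_eq_imp_space_eq[OF sets_eq] by simp
  qed
  also have "(\<integral>x. (\<integral>z. partial_deriv b F (x - z) \<partial>segment_measure b) \<partial>lborel) = (\<integral>x. F x - F (x - b) \<partial>lborel)"
  proof -
    have "F x - F (x - b) = (\<Sum>i\<in>Basis. (b \<bullet> i) * (\<integral>z. partial_deriv i F (x - z) \<partial>segment_measure b))" for x
      using test_function_increment[OF F, of x b] by simp
    also have "\<dots> x = (\<Sum>i\<in>Basis. if i = b then (\<integral>z. partial_deriv b F (x - z) \<partial>segment_measure b) else 0)" for x
      by (rule sum.cong) (use b in \<open>auto simp: inner_Basis\<close>)
    finally show ?thesis using b by simp
  qed
  also have "\<dots> = (\<integral>x. F x \<partial>lborel) - (\<integral>x. F (x - b) \<partial>lborel)"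
    using integrable_test_function[OF F] integrable_test_function[OF test_function_translate[OF F, of "-b"]]
    by (intro Bochner_Integration.integral_diff) auto
  also have "\<dots> = 0" using integral_lborel_translate[of F "-b"] by simp
  finally show ?thesis by simp
qed

text \<open>The classical derivative is a weak one: the product of the two test functions has a
  partial derivative of integral 0, and the product rule splits it.\<close>

lemma test_function_H1:
  fixes \<eta> :: "'a::euclidean_space \<Rightarrow> real"
  assumes \<eta>: "test_function \<eta>"
  shows "(\<lambda>x. complex_of_real (\<eta> x)) \<in> H1"
proof -
  have L2: "(\<lambda>x. complex_of_real (\<zeta> x)) \<in> Lp_space 2" if "test_function \<zeta>" for \<zeta> :: "'a \<Rightarrow> real"
    using test_function_L2[OF that] by (auto simp: Lp_space_2_iff)
  have "is_weak_partial b (\<lambda>x. complex_of_real (\<eta> x)) (\<lambda>x. complex_of_real (partial_deriv b \<eta> x))"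
    if b: "b \<in> Basis" for b
    unfolding is_weak_partial_def
  proof (intro allI impI)
    fix \<zeta> :: "'a \<Rightarrow> real" assume \<zeta>: "test_function \<zeta>"
    note \<eta>' = test_function_partial_deriv[OF \<eta> b] and \<zeta>' = test_function_partial_deriv[OF \<zeta> b]
    note [measurable] = test_function_borel[OF \<eta>] test_function_borel[OF \<zeta>] test_function_borel[OF \<eta>'] test_function_borel[OF \<zeta>']
    have "partial_deriv b (\<lambda>x. \<zeta> x * \<eta> x) = (\<lambda>x. \<zeta> x * partial_deriv b \<eta> x + partial_deriv b \<zeta> x * \<eta> x)"
      by (intro partial_deriv_mult test_function_differentiable \<zeta> \<eta>)
    then have "0 = (\<integral>x. \<zeta> x * partial_deriv b \<eta> x + partial_deriv b \<zeta> x * \<eta> x \<partial>lborel)"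
      using integral_partial_deriv_eq_0[OF test_function_mult[OF \<zeta> \<eta>] b] by simp
    also have "\<dots> = (\<integral>x. \<zeta> x * partial_deriv b \<eta> x \<partial>lborel) + (\<integral>x. partial_deriv b \<zeta> x * \<eta> x \<partial>lborel)"
      by (intro Bochner_Integration.integral_add integrable_test_function test_function_mult \<zeta> \<eta>' \<zeta>' \<eta>)
    finally have "(\<integral>x. partial_deriv b \<zeta> x * \<eta> x \<partial>lborel) = - (\<integral>x. \<zeta> x * partial_deriv b \<eta> x \<partial>lborel)" by simp
    then have "complex_of_real (\<integral>x. partial_deriv b \<zeta> x * \<eta> x \<partial>lborel) = - complex_of_real (\<integral>x. \<zeta> x * partial_deriv b \<eta> x \<partial>lborel)"
      by simp
    then show "(\<integral>x. partial_deriv b \<zeta> x *\<^sub>R complex_of_real (\<eta> x) \<partial>lebesgue)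
      = - (\<integral>x. \<zeta> x *\<^sub>R complex_of_real (partial_deriv b \<eta> x) \<partial>lebesgue)"
      unfolding scaleR_conv_of_real of_real_mult[symmetric]
      by (subst (1 2) integral_lebesgue_borel, measurable, measurable) (simp only: integral_complex_of_real)
  qed
  then show ?thesis
    unfolding H1_def using L2[OF \<eta>] L2[OF test_function_partial_deriv[OF \<eta>]] by blast
qed

section \<open>Potentials that are functions: majorants, sign, integrability\<close>

lemma le_1_add_powr: "1 \<le> q \<Longrightarrow> 0 \<le> t \<Longrightarrow> t \<le> 1 + t powr q" for t q :: real
proof (cases "t \<le> 1")
  case False
  assume "1 \<le> q"
  with False have "t powr 1 \<le> t powr q" by (intro powr_mono) auto
  with False show ?thesis by simp
qed (simp add: add_increasing2)

text \<open>The inequality t \<le> 1 + t^q absorbs the \<open>Lp_space q\<close> part into an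
  integrable function plus a constant, a form well suited to pairing with bounded square-integrable
  functions.\<close>

lemma Lq_plus_Linf_majorant:
  assumes "in_Lq_plus_Linf q f" "1 \<le> q"
  obtains G C where "integrable lebesgue G" "\<And>x. 0 \<le> G x" "0 \<le> C" 
    "AE x in lebesgue. \<bar>f x\<bar> \<le> G x + C" "f \<in> borel_measurable lebesgue"
proof -
  obtain g h where g: "g \<in> Lp_space q" and h: "h \<in> Linf_space" and f: "f = (\<lambda>x. g x + h x)"
    using assms unfolding in_Lq_plus_Linf_def by blast
  obtain K where K: "AE x in lebesgue. norm (h x) \<le> K" using h unfolding Linf_space_def by blast
  have ae: "AE x in lebesgue. \<bar>f x\<bar> \<le> norm (g x) powr q + (1 + \<bar>K\<bar>)"
    using K
  proof eventually_elim
    case (elim x)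
    then show ?case using le_1_add_powr[OF assms(2), of "norm (g x)"] f by auto
  qed
  show thesis
    by (rule that[of "\<lambda>x. norm (g x) powr q" "1 + \<bar>K\<bar>"])
      (use g h f ae in \<open>auto simp: Lp_space_def Linf_space_def\<close>)
qed

lemma regular_FunPot_majorant:
  fixes f :: "'a::euclidean_space \<Rightarrow> real"
  assumes "regular_potential (FunPot f)"
  obtains G C where "integrable lebesgue G" "\<And>x. 0 \<le> G x" "0 \<le> C" 
    "AE x in lebesgue. \<bar>f x\<bar> \<le> G x + C" "f \<in> borel_measurable lebesgue"
proof -
  obtain q where q: "if DIM('a) = 1 then q = 1 else if DIM('a) = 2 then q > 1 else q = real DIM('a) / 2"
    "in_Lq_plus_Linf q f" using assms by auto
  have "1 \<le> q"
  proof (cases "DIM('a) = 1 \<or> DIM('a) = 2")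
    case False
    then have "DIM('a) \<ge> 2" using DIM_positive[where 'a='a] by linarith
    then show ?thesis using q(1) False by simp
  qed (use q in \<open>auto split: if_splits\<close>)
  from Lq_plus_Linf_majorant[OF q(2) this] that show thesis by blast
qed

lemma FunPot_loc_integrable:
  assumes "regular_potential (FunPot f)"
  shows "loc_integrable f"
proof -
  obtain G C where G: "integrable lebesgue G" "\<And>x. 0 \<le> G x" "0 \<le> C" 
    "AE x in lebesgue. \<bar>f x\<bar> \<le> G x + C" and [measurable]: "f \<in> borel_measurable lebesgue"
    using regular_FunPot_majorant[OF assms] by metis
  show ?thesis unfolding loc_integrable_def set_integrable_def
  proof (intro conjI allI)
    fix R
    have [measurable]: "ball 0 R \<in> sets (lebesgue :: 'a measure)" by auto
    have "integrable lebesgue (\<lambda>x. G x + indicator (ball 0 R) x * C)"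
      using G(1) emeasure_lborel_ball_finite[of "0::'a" R] 
      by (intro Bochner_Integration.integrable_add integrable_mult_left) (auto intro!: integrable_real_indicator simp: less_top)
    then show "integrable lebesgue (\<lambda>x. indicat_real (ball 0 R) x *\<^sub>R f x)"
    proof (rule Bochner_Integration.integrable_bound)
      show "AE x in lebesgue. norm (indicat_real (ball 0 R) x *\<^sub>R f x) \<le> norm (G x + indicator (ball 0 R) x * C)"
        using G(4)
      proof eventually_elim
        case (elim x)
        then show ?case using G(2)[of x] G(3) by (auto simp: indicator_def)
      qed
    qed measurable
  qed measurable
qed

text \<open>Real test functions are admissible in the quadratic form, and they localize its
  sign.\<close>

lemma FunPot_AE_nonpos:
  assumes "regular_potential (FunPot f)" "nonpositive_potential (FunPot f)"
  shows "AE x in lebesgue. f x \<le> 0"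
proof (rule AE_nonpos_if_test_nonpos[OF FunPot_loc_integrable[OF assms(1)]])
  fix \<eta> :: "'a \<Rightarrow> real" assume "test_function \<eta>"
  from test_function_H1[OF this] assms(2) have "pot_quad (FunPot f) (\<lambda>x. complex_of_real (\<eta> x)) \<le> 0"
    unfolding nonpositive_potential_def by blast
  then show "(\<integral>x. (\<eta> x)\<^sup>2 * f x \<partial>lebesgue) \<le> 0" by (simp add: mult.commute)
qed

text \<open>The integrable part of the majorant is paired with the sup bound of u, the constant part
  with the integral of |u|^2.\<close>

lemma FunPot_integrable_bounded:
  assumes "regular_potential (FunPot f)" "u \<in> Lp_space 2" "\<And>x. cmod (u x) \<le> B"
  shows "integrable lebesgue (\<lambda>x. f x * (cmod (u x))\<^sup>2)"
proof -
  obtain G C where G: "integrable lebesgue G" "\<And>x. 0 \<le> G x" "0 \<le> C" 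
    "AE x in lebesgue. \<bar>f x\<bar> \<le> G x + C" and [measurable]: "f \<in> borel_measurable lebesgue"
    using regular_FunPot_majorant[OF assms(1)] by metis
  have [measurable]: "u \<in> borel_measurable lebesgue" and i: "integrable lebesgue (\<lambda>x. (cmod (u x))\<^sup>2)"
    using assms(2) by (auto simp: Lp_space_2_iff)
  have "integrable lebesgue (\<lambda>x. G x * B\<^sup>2 + C * (cmod (u x))\<^sup>2)" using i G(1) by auto
  then show ?thesis
  proof (rule Bochner_Integration.integrable_bound)
    show "AE x in lebesgue. norm (f x * (cmod (u x))\<^sup>2) \<le> norm (G x * B\<^sup>2 + C * (cmod (u x))\<^sup>2)"
      using G(4)
    proof eventually_elim
      case (elim x)
      have "\<bar>f x\<bar> * (cmod (u x))\<^sup>2 \<le> (G x + C) * (cmod (u x))\<^sup>2" using elim by (intro mult_right_mono) auto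
      also have "\<dots> \<le> G x * B\<^sup>2 + C * (cmod (u x))\<^sup>2"
        using assms(3)[of x] G(2)[of x] by (auto simp: distrib_right intro!: mult_left_mono power_mono)
      finally show ?case by (simp add: abs_mult)
    qed
  qed measurable
qed

section \<open>Continuous representatives in dimension one\<close>

lemma cont_rep_eqI:
  assumes "continuous_on UNIV g" "AE x in lebesgue. g x = \<phi> x"
  shows "cont_rep \<phi> = g"
  unfolding cont_rep_def
proof (rule the_equality)
  show "continuous_on UNIV g \<and> (AE x in lebesgue. g x = \<phi> x)" using assms by simp
  fix h assume h: "continuous_on UNIV h \<and> (AE x in lebesgue. h x = \<phi> x)"
  \<comment> \<open>Two continuous functions differ on an open set; being negligible as well, it is
    empty. This settles the uniqueness in \<open>THE\<close>.\<close>
  have "open {x. g x \<noteq> h x}"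
    using assms(1) h by (intro open_Collect_neq) auto
  moreover have "AE x in lebesgue. g x = h x" using assms(2) conjunct2[OF h] by eventually_elim simp
  then have "negligible {x. g x \<noteq> h x}" 
    using \<open>open {x. g x \<noteq> h x}\<close> by (simp add: negligible_iff_null_sets AE_iff_null_sets)
  ultimately have "{x. g x \<noteq> h x} = {}" using open_not_negligible by blast
  then show "h = g" by auto
qed

lemma Basis_singleton:
  assumes "DIM('a::euclidean_space) = 1"
  obtains b :: "'a::euclidean_space" where "Basis = {b}" "norm b = 1" "\<And>x::'a::euclidean_space. x = (x \<bullet> b) *\<^sub>R b"
proof -
  obtain b :: 'a where b: "Basis = {b}" using assms card_1_singletonE by blast
  have "x = (x \<bullet> b) *\<^sub>R b" for x :: 'a using euclidean_representation[of x] unfolding b by simp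
  moreover have "norm b = 1" by (intro norm_Basis) (simp only: b singletonI)
  ultimately show thesis using b that by blast
qed

text \<open>In dimension one the space is the real line spanned by b; this makes affine substitution
  in real integrals available.\<close>

lemma lborel_eq_distr_line:
  fixes b :: "'a::euclidean_space"
  assumes "Basis = {b}"
  shows "(lborel :: 'a measure) = distr lborel borel (\<lambda>t::real. t *\<^sub>R b)"
proof (rule lborel_eqI)
  fix l u :: 'a assume "\<And>i. i \<in> Basis \<Longrightarrow> l \<bullet> i \<le> u \<bullet> i"
  then have le: "l \<bullet> b \<le> u \<bullet> b" using assms by auto
  have "b \<bullet> b = 1" using assms by (metis inner_Basis singletonI)
  then have "(\<lambda>t. t *\<^sub>R b) -` box l u = {l \<bullet> b <..< u \<bullet> b}"
    unfolding mem_box vimage_def assms by auto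
  then show "emeasure (distr lborel borel (\<lambda>t. t *\<^sub>R b)) (box l u) = ennreal (\<Prod>b\<in>Basis. (u - l) \<bullet> b)"
    unfolding assms using le by (subst emeasure_distr) (auto simp: inner_diff_left)
qed simp

lemma nn_integral_segment_measure:
  assumes [measurable]: "h \<in> borel_measurable borel"
  shows "(\<integral>\<^sup>+z. h z \<partial>segment_measure y) = (\<integral>\<^sup>+s. indicator {0..1} s * h (s *\<^sub>R y) \<partial>lborel)"
proof -
  have "(\<integral>\<^sup>+z. h z \<partial>segment_measure y) = (\<integral>\<^sup>+s. h (s *\<^sub>R y) \<partial>density lborel (\<lambda>s::real. ennreal (indicator {0..1} s)))"
    unfolding segment_measure_def by (rule nn_integral_distr) measurable
  also have "\<dots> = (\<integral>\<^sup>+s. ennreal (indicator {0..1} s) * h (s *\<^sub>R y) \<partial>lborel)"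
    by (rule nn_integral_density) measurable
  finally show ?thesis by (simp only: ennreal_indicator)
qed

text \<open>The increment is t times a mean of the derivative over a segment of length |t|. Jensen
  for the mean leaves |t| times the integral of the squared derivative over that segment, which the
  whole line bounds by \<open>energy\<close>.\<close>

lemma (in borel_H1) holder_estimate:
  assumes "DIM('a) = 1"
  shows "AE x in lborel. (cmod (\<phi> (x + y) - \<phi> x))\<^sup>2 \<le> norm y * energy"
proof -
  obtain b :: 'a where b: "Basis = {b}" "norm b = 1" and rep: "\<And>x::'a. x = (x \<bullet> b) *\<^sub>R b" using Basis_singleton[OF assms] by metis
  interpret averaging "segment_measure y" by (rule averaging_segment)
  have bB: "b \<in> Basis" unfolding b by simp
  note [measurable] = borel_g[OF bB]
  have E: "energy = (\<integral>x. (cmod (g b x))\<^sup>2 \<partial>lebesgue)" unfolding energy_def b(1) by simp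
  have Eint: "ennreal energy = (\<integral>\<^sup>+x. ennreal ((cmod (g b x))\<^sup>2) \<partial>lborel)"
    unfolding E by (rule borel_L2_nn_integral[OF borel_g[OF bB] L2_g[OF bB], symmetric])
  define t where "t = y \<bullet> b"
  have y: "y = t *\<^sub>R b" unfolding t_def by (rule rep)
  have ny: "norm y = \<bar>t\<bar>" unfolding y using b by simp
  show ?thesis
    using increment_eq_average[of y]
  proof eventually_elim
    case (elim x)
    have "\<bar>t\<bar> * ennreal ((cmod (average (segment_measure y) (g b) x))\<^sup>2)
       \<le> \<bar>t\<bar> * (\<integral>\<^sup>+z. ennreal ((cmod (g b (x + z)))\<^sup>2) \<partial>segment_measure y)"
      by (intro mult_left_mono average_sq_le) auto
    also have "(\<integral>\<^sup>+z. ennreal ((cmod (g b (x + z)))\<^sup>2) \<partial>segment_measure y)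
       = (\<integral>\<^sup>+s. indicator {0..1} s * ennreal ((cmod (g b (x + s *\<^sub>R y)))\<^sup>2) \<partial>lborel)"
      by (rule nn_integral_segment_measure) measurable
    also have "\<bar>t\<bar> * \<dots> \<le> \<bar>t\<bar> * (\<integral>\<^sup>+s. ennreal ((cmod (g b (x + s *\<^sub>R y)))\<^sup>2) \<partial>lborel)"
      by (intro mult_left_mono nn_integral_mono) (auto simp: indicator_def)
    also have "\<dots> \<le> ennreal energy"
    proof (cases "t = 0")
      case False
      have "ennreal energy = (\<integral>\<^sup>+s. ennreal ((cmod (g b (s *\<^sub>R b)))\<^sup>2) \<partial>lborel)"
        unfolding Eint by (subst lborel_eq_distr_line[OF b(1)], subst nn_integral_distr) auto
      \<comment> \<open>The substitution x . b + t s maps the parameter line onto the whole line,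
        consumes exactly one factor |t|, and removes the dependence on x.\<close>
      also have "\<dots> = \<bar>t\<bar> * (\<integral>\<^sup>+s. ennreal ((cmod (g b ((x \<bullet> b + t * s) *\<^sub>R b)))\<^sup>2) \<partial>lborel)"
        by (rule nn_integral_real_affine[OF _ False]) measurable
      also have "(\<lambda>s. ennreal ((cmod (g b ((x \<bullet> b + t * s) *\<^sub>R b)))\<^sup>2)) = (\<lambda>s. ennreal ((cmod (g b (x + s *\<^sub>R y)))\<^sup>2))"
        unfolding scaleR_add_left rep[of x, symmetric] y by (simp add: mult.commute)
      finally show ?thesis by simp
    qed simp
    finally have "ennreal (\<bar>t\<bar> * (cmod (average (segment_measure y) (g b) x))\<^sup>2) \<le> ennreal energy"
      by (simp add: ennreal_mult)
    then have le: "\<bar>t\<bar> * (cmod (average (segment_measure y) (g b) x))\<^sup>2 \<le> energy"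
      using energy_nonneg by (subst (asm) ennreal_le_iff) auto
    have "(cmod (\<phi> (x + y) - \<phi> x))\<^sup>2 = \<bar>t\<bar> * (\<bar>t\<bar> * (cmod (average (segment_measure y) (g b) x))\<^sup>2)"
      unfolding elim b(1) by (simp add: t_def[symmetric] power_mult_distrib power2_eq_square)
    also have "\<dots> \<le> \<bar>t\<bar> * energy" using le by (intro mult_left_mono) auto
    finally show ?case unfolding ny .
  qed
qed

lemma AE_lborel_translate:
  fixes a :: "'a::euclidean_space"
  assumes "AE y in lborel. P y" and [measurable]: "Measurable.pred borel P"
  shows "AE z in lborel. P (z - a)"
proof -
  have "AE z in distr lborel borel ((+) (- a)). P z"
    unfolding lborel_distr_plus by (rule assms)
  then have "AE z in lborel. P (- a + z)" by (subst (asm) AE_distr_iff) auto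
  then show ?thesis by simp
qed

lemma AE_lborel_witness:
  fixes c :: "'a::euclidean_space"
  assumes "AE x in lborel. P x" "r > 0"
  obtains x where "x \<in> ball c r" "P x"
proof -
  have "\<exists>x\<in>ball c r. P x"
  proof (rule ccontr)
    assume "\<not> ?thesis"
    then have "AE x in lborel. x \<notin> ball c r" using assms(1) by (auto elim: eventually_mono)
    then have "ball c r \<in> null_sets lborel" by (subst AE_iff_null_sets) auto
    then show False using emeasure_lborel_ball_neq_0[OF assms(2), of c] by auto
  qed
  with that show thesis by blast
qed

text \<open>On a set S of full measure, hence dense, the Borel representative is Hoelder continuous
  and bounded; its uniformly continuous extension is the continuous representative and inherits the
  bound.\<close>

lemma cont_rep_H1:
  fixes \<phi>0 :: "'a::euclidean_space \<Rightarrow> complex"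
  assumes "DIM('a) = 1" "\<phi>0 \<in> H1"
  shows "continuous_on UNIV (cont_rep \<phi>0)" "AE x in lebesgue. cont_rep \<phi>0 x = \<phi>0 x"
    "\<exists>B. \<forall>x. cmod (cont_rep \<phi>0 x) \<le> B"
proof -
  obtain \<phi> g where "borel_H1 \<phi> g" and eq: "AE x in lebesgue. \<phi>0 x = \<phi> x"
    using H1_borel_representative[OF assms(2)] by metis
  interpret borel_H1 \<phi> g by fact
  let ?\<nu> = "uniform_measure lborel (ball (0::'a) 1)"
  interpret averaging ?\<nu> by (rule averaging_ball) simp
  obtain B where B: "\<And>x. cmod (average ?\<nu> \<phi> x) \<le> B" using ball_average_bounded[of 1] by auto
  define H where "H = (\<lambda>x y. (cmod (\<phi> (x + y) - \<phi> x))\<^sup>2 \<le> norm y * energy)"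
  have [measurable]: "Measurable.pred (borel \<Otimes>\<^sub>M borel) (\<lambda>p. H (fst p) (snd p))" unfolding H_def by measurable
  \<comment> \<open>The null set of the Hoelder estimate depends on the increment y. Fubini
    exchanges the quantifiers, so that almost every x is good for almost every y.\<close>
  have "AE x in lborel. AE y in lborel. H x y"
  proof (subst lborel_pair.AE_commute)
    show "{x \<in> space (lborel \<Otimes>\<^sub>M lborel). H (fst x) (snd x)} \<in> sets (lborel \<Otimes>\<^sub>M lborel)" 
      unfolding H_def by measurable
    show "AE y in lborel. AE x in lborel. H x y"
      unfolding H_def using holder_estimate[OF assms(1)] by simp
  qed
  then have ae: "AE x in lborel. (AE y in lborel. H x y) \<and> integrable ?\<nu> (\<lambda>z. \<phi> (x + z))"
    using average_L2(3)[OF borel_\<phi> L2_\<phi>] by simp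
  define S where "S = {x. (AE y in lborel. H x y) \<and> integrable ?\<nu> (\<lambda>z. \<phi> (x + z))}"
  have aeS: "AE x in lborel. x \<in> S" using ae by (simp add: S_def)
  have Sz: "AE z in lborel. (cmod (\<phi> z - \<phi> x))\<^sup>2 \<le> norm (z - x) * energy" if "x \<in> S" for x
  proof -
    have "AE y in lborel. H x y" using that by (simp add: S_def)
    then have "AE z in lborel. H x (z - x)" by (rule AE_lborel_translate[where P="H x"]) (unfold H_def, measurable)
    then show ?thesis by (simp add: H_def)
  qed
  have hoelder: "cmod (\<phi> x - \<phi> x') \<le> 3 * sqrt (norm (x - x') * energy)" if x: "x \<in> S" "x' \<in> S" for x x'
  proof (cases "x = x'")
    case False
    define d where "d = norm (x - x')"
    have d: "d > 0" using False by (simp add: d_def)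
    \<comment> \<open>The estimate need not hold for the pair x, x' itself, since x' - x may be
      exceptional for x. Both points are compared with a common z near x instead.\<close>
    have "AE z in lborel. (cmod (\<phi> z - \<phi> x))\<^sup>2 \<le> norm (z - x) * energy \<and> (cmod (\<phi> z - \<phi> x'))\<^sup>2 \<le> norm (z - x') * energy"
      using Sz[OF x(1)] Sz[OF x(2)] by simp
    from AE_lborel_witness[OF this d, of x] obtain z where z: "z \<in> ball x d" "(cmod (\<phi> z - \<phi> x))\<^sup>2 \<le> norm (z - x) * energy" "(cmod (\<phi> z - \<phi> x'))\<^sup>2 \<le> norm (z - x') * energy"
      by blast
    have zx: "norm (z - x) \<le> d" using z(1) by (simp add: dist_norm norm_minus_commute)
    \<comment> \<open>The triangle inequality gives 2 d; the weaker 4 d has the convenient root 2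
      sqrt d, whence the constant 3 = 1 + 2.\<close>
    have zx': "norm (z - x') \<le> 4 * d"
      using norm_triangle_ineq[of "z - x" "x - x'"] zx d unfolding d_def[symmetric] by simp
    have "(cmod (\<phi> z - \<phi> x))\<^sup>2 \<le> d * energy"
      using z(2) mult_right_mono[OF zx energy_nonneg] by linarith
    then have 1: "cmod (\<phi> z - \<phi> x) \<le> sqrt (d * energy)" by (rule real_le_rsqrt)
    have "(cmod (\<phi> z - \<phi> x'))\<^sup>2 \<le> 4 * (d * energy)"
      using z(3) mult_right_mono[OF zx' energy_nonneg] by linarith
    then have "cmod (\<phi> z - \<phi> x') \<le> sqrt (4 * (d * energy))" by (rule real_le_rsqrt)
    then have 2: "cmod (\<phi> z - \<phi> x') \<le> 2 * sqrt (d * energy)" by (simp add: real_sqrt_mult)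
    have "cmod (\<phi> x - \<phi> x') \<le> cmod (\<phi> z - \<phi> x') + cmod (\<phi> z - \<phi> x)"
      using norm_triangle_ineq4[of "\<phi> z - \<phi> x'" "\<phi> z - \<phi> x"] by simp
    with 1 2 show ?thesis by (simp add: d_def)
  qed simp
  \<comment> \<open>The unit-ball average around x is bounded, and by the estimate on that ball
    \<open>\<phi> x\<close> differs from it by at most \<open>sqrt energy\<close>.\<close>
  have bounded: "cmod (\<phi> x) \<le> B + sqrt energy" if x: "x \<in> S" for x
  proof -
    have i: "integrable ?\<nu> (\<lambda>z. \<phi> (x + z))" and H: "AE y in lborel. H x y" using x by (auto simp: S_def)
    have P1[simp]: "prob UNIV = 1" using prob_space by simp
    have "(\<integral>z. \<phi> (x + z) - \<phi> x \<partial>?\<nu>) = average ?\<nu> \<phi> x - \<phi> x"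
      unfolding average_def using i by (subst Bochner_Integration.integral_diff) auto
    then have "ennreal ((cmod (average ?\<nu> \<phi> x - \<phi> x))\<^sup>2) \<le> (\<integral>\<^sup>+z. ennreal ((cmod (\<phi> (x + z) - \<phi> x))\<^sup>2) \<partial>?\<nu>)"
      using norm_integral_sq_le(1)[of "\<lambda>z. \<phi> (x + z) - \<phi> x"] by simp
    also have "\<dots> \<le> (\<integral>\<^sup>+z. ennreal energy \<partial>?\<nu>)"
    proof (rule nn_integral_mono_AE, rule AE_uniform_measureI)
      show "AE z in lborel. z \<in> ball 0 1 \<longrightarrow> ennreal ((cmod (\<phi> (x + z) - \<phi> x))\<^sup>2) \<le> ennreal energy"
        using H
      proof eventually_elim
        case (elim z)
        show ?case
        proof
          assume "z \<in> ball 0 1"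
          then have "norm z * energy \<le> 1 * energy" using energy_nonneg by (intro mult_right_mono) auto
          then show "ennreal ((cmod (\<phi> (x + z) - \<phi> x))\<^sup>2) \<le> ennreal energy"
            using elim by (intro ennreal_leI) (simp add: H_def)
        qed
      qed
    qed simp
    also have "\<dots> = ennreal energy" by (simp only: nn_integral_const emeasure_space_1 mult_1_right)
    finally have "(cmod (average ?\<nu> \<phi> x - \<phi> x))\<^sup>2 \<le> energy"
      using energy_nonneg by (subst (asm) ennreal_le_iff) auto
    then have "cmod (average ?\<nu> \<phi> x - \<phi> x) \<le> sqrt energy" by (rule real_le_rsqrt)
    then show ?thesis using B[of x] norm_triangle_ineq4[of "average ?\<nu> \<phi> x" "average ?\<nu> \<phi> x - \<phi> x"] by simp
  qed
  have "closure S = UNIV"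
  proof -
    have "\<exists>y\<in>S. dist y x < e" if "e > 0" for x e
      using AE_lborel_witness[OF aeS that, of x] by (metis mem_ball dist_commute)
    then show ?thesis by (auto simp: closure_approachable)
  qed
  moreover have "uniformly_continuous_on S \<phi>"
    unfolding uniformly_continuous_on_def
  proof (intro allI impI)
    fix e :: real assume e: "e > 0"
    \<comment> \<open>Solves 3 sqrt(\<open>\<delta> * energy\<close>) < e; the summand 1 avoids a
      division by zero when \<open>energy\<close> vanishes.\<close>
    define \<delta> where "\<delta> = (e / 3)\<^sup>2 / (energy + 1)"
    have \<delta>: "\<delta> > 0" using e energy_nonneg by (simp add: \<delta>_def)
    have "dist (\<phi> x') (\<phi> x) < e" if "x \<in> S" "x' \<in> S" "dist x' x < \<delta>" for x x'
    proof -
      have "norm (x' - x) * energy \<le> \<delta> * energy"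
        using that(3) energy_nonneg by (intro mult_right_mono) (auto simp: dist_norm)
      also have "\<dots> < \<delta> * (energy + 1)" using \<delta> by simp
      also have "\<dots> = (e / 3)\<^sup>2" using energy_nonneg by (simp add: \<delta>_def)
      finally have "sqrt (norm (x' - x) * energy) < sqrt ((e / 3)\<^sup>2)" by (rule real_sqrt_less_mono)
      then have "3 * sqrt (norm (x' - x) * energy) < e" using e by simp
      then show ?thesis using hoelder[OF that(2,1)] by (simp add: dist_norm)
    qed
    then show "\<exists>d>0. \<forall>x\<in>S. \<forall>x'\<in>S. dist x' x < d \<longrightarrow> dist (\<phi> x') (\<phi> x) < e" using \<delta> by blast
  qed
  ultimately obtain h where h: "uniformly_continuous_on UNIV h" "\<And>x. x \<in> S \<Longrightarrow> \<phi> x = h x"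
    using uniformly_continuous_on_extension_on_closure by metis
  have cont: "continuous_on UNIV h" using h(1) by (rule uniformly_continuous_imp_continuous)
  have ae: "AE x in lebesgue. h x = \<phi>0 x"
    using AE_completion[OF aeS] eq by eventually_elim (simp add: h(2))
  have "cmod (h x) \<le> B + sqrt energy" for x
  proof -
    have "closed {x. cmod (h x) \<le> B + sqrt energy}" by (intro closed_Collect_le continuous_intros cont)
    then have "closure S \<subseteq> {x. cmod (h x) \<le> B + sqrt energy}"
      by (rule closure_minimal[rotated]) (use bounded h(2) in auto)
    then show ?thesis using \<open>closure S = UNIV\<close> by auto
  qed
  then show "continuous_on UNIV (cont_rep \<phi>0)" "AE x in lebesgue. cont_rep \<phi>0 x = \<phi>0 x"
    "\<exists>B. \<forall>x. cmod (cont_rep \<phi>0 x) \<le> B"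
    using cont ae cont_rep_eqI[OF cont ae] by auto
qed

section \<open>Quadratic forms\<close>

lemma borel_measurable_cnj [measurable]: "cnj \<in> borel_measurable borel"
  by (intro borel_measurable_continuous_onI linear_continuous_on bounded_linear_cnj)

text \<open>The cross term is dominated by |f| (|u|^2 + |v|^2), so integrability of the two weighted
  squares justifies splitting the integral. Weight 1 serves for masses and for integrals against a
  measure.\<close>

lemma integral_sq_diff:
  fixes u v :: "'a \<Rightarrow> complex" and f :: "'a \<Rightarrow> real"
  assumes [measurable]: "f \<in> borel_measurable M" "u \<in> borel_measurable M" "v \<in> borel_measurable M"
    and i: "integrable M (\<lambda>x. f x * (cmod (u x))\<^sup>2)" "integrable M (\<lambda>x. f x * (cmod (v x))\<^sup>2)"
  shows "(\<integral>x. f x * (cmod (v x - u x))\<^sup>2 \<partial>M)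
     = (\<integral>x. f x * (cmod (v x))\<^sup>2 \<partial>M) - 2 * Re (\<integral>x. of_real (f x) * u x * cnj (v x) \<partial>M) + (\<integral>x. f x * (cmod (u x))\<^sup>2 \<partial>M)"
    and "integrable M (\<lambda>x. of_real (f x) * u x * cnj (v x))"
proof -
  have "integrable M (\<lambda>x. \<bar>f x * (cmod (u x))\<^sup>2\<bar> + \<bar>f x * (cmod (v x))\<^sup>2\<bar>)" using i by auto
  then show int: "integrable M (\<lambda>x. of_real (f x) * u x * cnj (v x))"
  proof (rule Bochner_Integration.integrable_bound)
    have "cmod (of_real (f x) * u x * cnj (v x)) \<le> \<bar>f x * (cmod (u x))\<^sup>2\<bar> + \<bar>f x * (cmod (v x))\<^sup>2\<bar>" for x
    proof -
      have "cmod (u x) * cmod (v x) \<le> (cmod (u x))\<^sup>2 + (cmod (v x))\<^sup>2"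
        using zero_le_power2[of "cmod (u x) - cmod (v x)"] mult_nonneg_nonneg[OF norm_ge_zero[of "u x"] norm_ge_zero[of "v x"]]
        unfolding power2_diff by linarith
      from mult_left_mono[OF this abs_ge_zero[of "f x"]]
      show ?thesis by (simp add: norm_mult abs_mult algebra_simps)
    qed
    then show "AE x in M. norm (of_real (f x) * u x * cnj (v x)) \<le> norm (\<bar>f x * (cmod (u x))\<^sup>2\<bar> + \<bar>f x * (cmod (v x))\<^sup>2\<bar>)"
      by (intro AE_I2) simp
  qed measurable
  have eq: "f x * (cmod (v x - u x))\<^sup>2 = f x * (cmod (v x))\<^sup>2 - 2 * Re (of_real (f x) * u x * cnj (v x)) + f x * (cmod (u x))\<^sup>2" for x
  proof -
    have "(cmod (v x - u x))\<^sup>2 = (cmod (v x))\<^sup>2 - 2 * Re (u x * cnj (v x)) + (cmod (u x))\<^sup>2"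
      unfolding cmod_power2 by (simp add: power2_diff)
    moreover have "Re (of_real (f x) * u x * cnj (v x)) = f x * Re (u x * cnj (v x))"
      by (simp add: mult.assoc right_diff_distrib distrib_left)
    moreover have "f x * (a - 2 * r + b) = f x * a - 2 * (f x * r) + f x * b" for a r b :: real
      by (simp add: algebra_simps)
    ultimately show ?thesis by (simp only:)
  qed
  have "(\<integral>x. f x * (cmod (v x - u x))\<^sup>2 \<partial>M)
     = (\<integral>x. f x * (cmod (v x))\<^sup>2 \<partial>M) - (\<integral>x. 2 * Re (of_real (f x) * u x * cnj (v x)) \<partial>M) + (\<integral>x. f x * (cmod (u x))\<^sup>2 \<partial>M)"
    unfolding eq
    by (subst Bochner_Integration.integral_add, intro Bochner_Integration.integrable_diff i integrable_mult_right integrable_Re int, rule i,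
        subst Bochner_Integration.integral_diff, rule i, intro integrable_mult_right integrable_Re int, rule refl)
  also have "(\<integral>x. 2 * Re (of_real (f x) * u x * cnj (v x)) \<partial>M) = 2 * Re (\<integral>x. of_real (f x) * u x * cnj (v x) \<partial>M)"
    using int by (simp only: integral_mult_right_zero integral_Re)
  finally show "(\<integral>x. f x * (cmod (v x - u x))\<^sup>2 \<partial>M)
     = (\<integral>x. f x * (cmod (v x))\<^sup>2 \<partial>M) - 2 * Re (\<integral>x. of_real (f x) * u x * cnj (v x) \<partial>M) + (\<integral>x. f x * (cmod (u x))\<^sup>2 \<partial>M)" .
qed

lemma integral_mult_cnj_self:
  fixes u :: "'a \<Rightarrow> complex"
  shows "(\<integral>x. of_real (f x) * u x * cnj (u x) \<partial>M) = of_real (\<integral>x. f x * (cmod (u x))\<^sup>2 \<partial>M)"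
proof -
  have "of_real (f x) * u x * cnj (u x) = complex_of_real (f x * (cmod (u x))\<^sup>2)" for x
    by (simp add: complex_norm_square mult.assoc del: of_real_power)
  then show ?thesis by (simp only: integral_complex_of_real)
qed

section \<open>Mass, gradient energy and potential energy as quadratic forms\<close>

definition mass :: "('a::euclidean_space \<Rightarrow> complex) \<Rightarrow> real" where
  "mass u = (\<integral>x. (cmod (u x))\<^sup>2 \<partial>lebesgue)"

lemma mass_nonneg: "0 \<le> mass u"
  unfolding mass_def by (intro integral_nonneg_AE) auto

lemma L2_inner_self: "L2_inner u u = of_real (mass u)"
  using integral_mult_cnj_self[where f="\<lambda>_. 1" and u=u and M=lebesgue] by (simp add: L2_inner_def mass_def)

lemma mass_diff:
  assumes "u \<in> Lp_space 2" "v \<in> Lp_space 2"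
  shows "mass (\<lambda>x. v x - u x) = mass v - 2 * Re (L2_inner u v) + mass u"
  using integral_sq_diff(1)[of "\<lambda>_. 1" lebesgue u v] assms 
  by (simp add: L2_inner_def mass_def Lp_space_2_iff)

lemma L2_cnj: "u \<in> Lp_space 2 \<Longrightarrow> (\<lambda>x. cnj (u x)) \<in> Lp_space 2"
  by (auto simp: Lp_space_2_iff)

lemma L2_inner_diff_divide:
  assumes "u \<in> Lp_space 2" "v \<in> Lp_space 2" "w \<in> Lp_space 2"
  shows "L2_inner (\<lambda>x. (u x - v x) / c) w = (L2_inner u w - L2_inner v w) / c"
proof -
  have "(\<integral>x. u x * cnj (w x) - v x * cnj (w x) \<partial>lebesgue) = L2_inner u w - L2_inner v w"
    unfolding L2_inner_def using assms by (intro Bochner_Integration.integral_diff L2_mult_integrable L2_cnj)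
  then show ?thesis unfolding L2_inner_def by (simp add: left_diff_distrib)
qed

lemma Re_L2_inner_commute:
  assumes "u \<in> Lp_space 2" "v \<in> Lp_space 2"
  shows "Re (L2_inner u v) = Re (L2_inner v u)"
proof -
  have "mass (\<lambda>x. v x - u x) = mass (\<lambda>x. u x - v x)" by (simp add: mass_def norm_minus_commute)
  then show ?thesis by (simp add: mass_diff assms)
qed

lemma mass_scaleR: "mass (\<lambda>x. c *\<^sub>R u x) = c\<^sup>2 * mass u"
  by (simp add: mass_def power_mult_distrib)

lemma mass_cong_AE:
  assumes "AE x in lebesgue. u x = v x" "u \<in> borel_measurable lebesgue" "v \<in> borel_measurable lebesgue"
  shows "mass u = mass v"
  unfolding mass_def using assms by (intro integral_cong_AE) auto

lemma mass_eq_0_iff: "u \<in> Lp_space 2 \<Longrightarrow> mass u = 0 \<longleftrightarrow> (AE x in lebesgue. u x = 0)"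
  unfolding mass_def by (subst integral_nonneg_eq_0_iff_AE) (auto simp: Lp_space_2_iff)

lemma grad_norm_sq_eq_mass: "grad_norm_sq u = (\<Sum>b\<in>Basis. mass (weak_partial b u))"
  by (simp add: grad_norm_sq_def mass_def)

lemma grad_norm_sq_nonneg: "0 \<le> grad_norm_sq u"
  unfolding grad_norm_sq_eq_mass by (intro sum_nonneg mass_nonneg)

lemma grad_inner_self: "grad_inner u u = of_real (grad_norm_sq u)"
  by (simp add: grad_inner_def grad_norm_sq_eq_mass L2_inner_self)

lemma grad_norm_sq_diff:
  assumes "u \<in> H1" "v \<in> H1"
  shows "grad_norm_sq (\<lambda>x. v x - u x) = grad_norm_sq v - 2 * Re (grad_inner u v) + grad_norm_sq u"
proof -
  have "mass (weak_partial b (\<lambda>x. v x - u x))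
    = mass (weak_partial b v) - 2 * Re (L2_inner (weak_partial b u) (weak_partial b v)) + mass (weak_partial b u)"
    if b: "b \<in> Basis" for b
  proof -
    note wp = weak_partial_props(1)[OF assms(1) b] weak_partial_props(1)[OF assms(2) b]
      weak_partial_props(1)[OF H1_diff(1)[OF assms(2,1)] b]
    have "mass (weak_partial b (\<lambda>x. v x - u x)) = mass (\<lambda>x. weak_partial b v x - weak_partial b u x)"
      by (rule mass_cong_AE[OF H1_diff(2)[OF assms(2,1) b]]) (use wp in \<open>auto simp: Lp_space_2_iff\<close>)
    then show ?thesis using mass_diff[OF wp(1,2)] by simp
  qed
  then show ?thesis
    by (simp add: grad_norm_sq_eq_mass grad_inner_def sum.distrib sum_subtractf sum_distrib_left)
qed

lemma grad_norm_sq_scaleR: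
  assumes "u \<in> H1"
  shows "grad_norm_sq (\<lambda>x. c *\<^sub>R u x) = c\<^sup>2 * grad_norm_sq u"
proof -
  have "mass (weak_partial b (\<lambda>x. c *\<^sub>R u x)) = c\<^sup>2 * mass (weak_partial b u)" if b: "b \<in> Basis" for b
  proof -
    have "mass (weak_partial b (\<lambda>x. c *\<^sub>R u x)) = mass (\<lambda>x. c *\<^sub>R weak_partial b u x)"
      by (rule mass_cong_AE[OF H1_scaleR(2)[OF assms b]])
        (use weak_partial_props(1)[OF assms b] weak_partial_props(1)[OF H1_scaleR(1)[OF assms] b] in \<open>auto simp: Lp_space_2_iff\<close>)
    then show ?thesis by (simp add: mass_scaleR)
  qed
  then show ?thesis by (simp add: grad_norm_sq_eq_mass sum_distrib_left)
qed

lemma grad_norm_sq_cong_AE: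
  assumes "u \<in> H1" "AE x in lebesgue. u x = v x"
  shows "grad_norm_sq v = grad_norm_sq u"
  unfolding grad_norm_sq_eq_mass
proof (rule sum.cong[OF refl])
  fix b :: 'a assume b: "b \<in> Basis"
  show "mass (weak_partial b v) = mass (weak_partial b u)"
    by (rule mass_cong_AE[OF H1_cong_AE(2)[OF assms b]])
      (use weak_partial_props(1)[OF assms(1) b] weak_partial_props(1)[OF H1_cong_AE(1)[OF assms] b] in \<open>auto simp: Lp_space_2_iff\<close>)
qed

lemma cont_rep_cong_AE:
  assumes "AE x in lebesgue. u x = v x"
  shows "cont_rep u = cont_rep v"
proof -
  have "(AE x in lebesgue. g x = u x) \<longleftrightarrow> (AE x in lebesgue. g x = v x)" for g
    using assms by (auto elim: eventually_elim2)
  then show ?thesis by (simp add: cont_rep_def)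
qed

lemma cont_rep_scaleR:
  fixes u :: "'a::euclidean_space \<Rightarrow> complex"
  assumes "DIM('a) = 1" "u \<in> H1"
  shows "cont_rep (\<lambda>x. c *\<^sub>R u x) = (\<lambda>x. c *\<^sub>R cont_rep u x)"
  by (rule cont_rep_eqI) (use cont_rep_H1[OF assms] in \<open>auto intro!: continuous_intros elim: eventually_mono\<close>)

lemma cont_rep_diff:
  fixes u v :: "'a::euclidean_space \<Rightarrow> complex"
  assumes "DIM('a) = 1" "u \<in> H1" "v \<in> H1"
  shows "cont_rep (\<lambda>x. v x - u x) = (\<lambda>x. cont_rep v x - cont_rep u x)"
proof (rule cont_rep_eqI)
  show "continuous_on UNIV (\<lambda>x. cont_rep v x - cont_rep u x)"
    using cont_rep_H1[OF assms(1,2)] cont_rep_H1[OF assms(1,3)] by (auto intro!: continuous_intros)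
  show "AE x in lebesgue. cont_rep v x - cont_rep u x = v x - u x"
    using cont_rep_H1(2)[OF assms(1,2)] cont_rep_H1(2)[OF assms(1,3)] by eventually_elim simp
qed

lemma cont_rep_sq_integrable:
  fixes u :: "'a::euclidean_space \<Rightarrow> complex"
  assumes "DIM('a) = 1" "u \<in> H1" "finite_borel_measure \<mu>"
  shows "cont_rep u \<in> borel_measurable \<mu>" "integrable \<mu> (\<lambda>x. (cmod (cont_rep u x))\<^sup>2)"
proof -
  interpret finite_measure \<mu> using assms(3) by (simp add: finite_borel_measure_def)
  have [measurable_cong]: "sets \<mu> = sets borel" using assms(3) by (simp add: finite_borel_measure_def)
  have [measurable]: "cont_rep u \<in> borel_measurable borel"
    by (intro borel_measurable_continuous_onI cont_rep_H1 assms)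
  obtain B where B: "\<And>x. cmod (cont_rep u x) \<le> B" using cont_rep_H1(3)[OF assms(1,2)] by blast
  show "cont_rep u \<in> borel_measurable \<mu>" by measurable
  show "integrable \<mu> (\<lambda>x. (cmod (cont_rep u x))\<^sup>2)"
    by (rule integrable_const_bound[of _ "B\<^sup>2"]) (use B in \<open>auto intro!: power_mono\<close>)
qed

lemma pot_quad_scaleR:
  fixes V :: "'a::euclidean_space potential"
  assumes "regular_potential V" "u \<in> H1"
  shows "pot_quad V (\<lambda>x. c *\<^sub>R u x) = c\<^sup>2 * pot_quad V u"
proof (cases V)
  case (FunPot f)
  have *: "f x * (cmod (c *\<^sub>R u x))\<^sup>2 = c\<^sup>2 * (f x * (cmod (u x))\<^sup>2)" for x
    by (simp add: power_mult_distrib)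
  show ?thesis by (simp only: FunPot pot_quad.simps * integral_mult_right_zero)
next
  case (MeasPot \<mu> \<nu> W)
  have "DIM('a) = 1" using assms MeasPot by simp
  moreover have *: "W x * (cmod (c *\<^sub>R u x))\<^sup>2 = c\<^sup>2 * (W x * (cmod (u x))\<^sup>2)" for x
    by (simp add: power_mult_distrib)
  ultimately show ?thesis using cont_rep_scaleR[OF _ assms(2)]
    unfolding MeasPot pot_quad.simps * by (simp add: power_mult_distrib distrib_left right_diff_distrib)
qed

lemma FunPot_measurable: "regular_potential (FunPot f) \<Longrightarrow> f \<in> borel_measurable lebesgue"
  by (erule regular_FunPot_majorant)

lemma pot_quad_cong_AE:
  fixes V :: "'a::euclidean_space potential"
  assumes "regular_potential V" "AE x in lebesgue. u x = v x" "u \<in> borel_measurable lebesgue" "v \<in> borel_measurable lebesgue"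
  shows "pot_quad V u = pot_quad V v"
proof -
  have "(\<integral>x. f x * (cmod (u x))\<^sup>2 \<partial>lebesgue) = (\<integral>x. f x * (cmod (v x))\<^sup>2 \<partial>lebesgue)"
    if "f \<in> borel_measurable lebesgue" for f
    using assms(2-) that by (intro integral_cong_AE) auto
  then show ?thesis using assms(1) FunPot_measurable cont_rep_cong_AE[OF assms(2)]
    by (cases V) (auto simp: Linf_space_def)
qed

section \<open>Positivity of the quadratic part and expansion of the potential energy\<close>

locale Nehari_setting =
  fixes V :: "'a::euclidean_space potential" and \<omega> :: real
  assumes regular: "regular_potential V" and nonpositive: "nonpositive_potential V"
    and omega0_nonneg: "0 \<le> omega0 V" and omega0_less: "omega0 V < ereal \<omega>"
begin

lemma omega_pos: "0 < \<omega>"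
  using order.strict_trans1[OF omega0_nonneg omega0_less] by simp

lemma Istar_eq: "Istar V \<omega> u = grad_norm_sq u + pot_quad V u + \<omega> * mass u"
  by (simp add: Istar_def mass_def)

text \<open>Both energies are homogeneous of degree 2, so u is rescaled to mass 1, where the infimum
  in \<open>omega0\<close> bounds the energy below by a value above
  \<open>- \<omega>\<close>.\<close>

lemma Istar_pos:
  assumes "u \<in> H1" "mass u \<noteq> 0"
  shows "0 < Istar V \<omega> u"
proof -
  have m: "mass u > 0" using assms(2) mass_nonneg[of u] by linarith
  define c where "c = 1 / sqrt (mass u)"
  have c2: "c\<^sup>2 * mass u = 1" using m by (simp add: c_def power_divide)
  let ?u = "\<lambda>x. c *\<^sub>R u x"
  have "Lp_norm 2 ?u = mass ?u powr (1 / 2)" by (simp add: Lp_norm_def mass_def)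
  also have "\<dots> = 1" by (simp add: mass_scaleR c2)
  finally have "?u \<in> {\<phi> \<in> H1. Lp_norm 2 \<phi> = 1}" using H1_scaleR(1)[OF assms(1)] by simp
  then have "(INF \<phi> \<in> {\<phi> \<in> H1. Lp_norm 2 \<phi> = 1}. ereal (grad_norm_sq \<phi> + pot_quad V \<phi>)) \<le> ereal (grad_norm_sq ?u + pot_quad V ?u)"
    by (rule INF_lower)
  moreover have "ereal (- \<omega>) < (INF \<phi> \<in> {\<phi> \<in> H1. Lp_norm 2 \<phi> = 1}. ereal (grad_norm_sq \<phi> + pot_quad V \<phi>))"
    using omega0_less unfolding omega0_def by (metis ereal_uminus_less_reorder uminus_ereal.simps(1))
  ultimately have "ereal (- \<omega>) < ereal (grad_norm_sq ?u + pot_quad V ?u)" by (rule less_le_trans[rotated])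
  then have "- \<omega> < c\<^sup>2 * (grad_norm_sq u + pot_quad V u)"
    by (simp add: grad_norm_sq_scaleR[OF assms(1)] pot_quad_scaleR[OF regular assms(1)] distrib_left)
  then have "0 < c\<^sup>2 * (grad_norm_sq u + pot_quad V u) + \<omega> * (c\<^sup>2 * mass u)" using c2 by simp
  also have "\<dots> = c\<^sup>2 * Istar V \<omega> u" unfolding Istar_eq by (simp add: algebra_simps)
  finally show ?thesis by (simp add: zero_less_mult_iff)
qed

lemma Istar_nonneg:
  assumes "u \<in> H1"
  shows "0 \<le> Istar V \<omega> u"
proof (cases "mass u = 0")
  case True
  then have ae: "AE x in lebesgue. u x = 0 *\<^sub>R u x" using mass_eq_0_iff[OF H1_L2[OF assms]] by simp
  have "pot_quad V u = pot_quad V (\<lambda>x. 0 *\<^sub>R u x)"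
    by (rule pot_quad_cong_AE[OF regular ae]) (use H1_L2[OF assms] in \<open>auto simp: Lp_space_2_iff\<close>)
  then have "pot_quad V u = 0" using pot_quad_scaleR[OF regular assms, of 0] by simp
  then show ?thesis unfolding Istar_eq True using grad_norm_sq_nonneg by simp
next
  case False
  then show ?thesis using Istar_pos[OF assms] by simp
qed

lemma FunPot_integrable:
  assumes V: "V = FunPot f" and u: "u \<in> H1"
  shows "integrable lebesgue (\<lambda>x. f x * (cmod (u x))\<^sup>2)"
proof -
  have reg: "regular_potential (FunPot f)" and np: "nonpositive_potential (FunPot f)"
    using regular nonpositive V by auto
  have [measurable]: "f \<in> borel_measurable lebesgue" by (rule FunPot_measurable[OF reg])
  have neg: "AE x in lebesgue. f x \<le> 0" by (rule FunPot_AE_nonpos[OF reg np])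
  obtain w :: "nat \<Rightarrow> 'a \<Rightarrow> complex" where w: "\<And>n. w n \<in> H1" "\<And>n. \<exists>B. \<forall>x. cmod (w n x) \<le> B"
    "\<And>n. mass (w n) \<le> mass u" "\<And>n. grad_norm_sq (w n) \<le> grad_norm_sq u"
    "AE x in lebesgue. (\<lambda>n. w n x) \<longlonglongrightarrow> u x"
    by (rule H1_bounded_approximation[OF u, folded mass_def]) (rule that)
  have [measurable]: "w n \<in> borel_measurable lebesgue" "u \<in> borel_measurable lebesgue" for n
    using H1_L2[OF w(1)] H1_L2[OF u] by (auto simp: Lp_space_2_iff)
  let ?K = "grad_norm_sq u + \<omega> * mass u"
  have bound: "(\<integral>\<^sup>+x. ennreal (\<bar>f x\<bar> * (cmod (w n x))\<^sup>2) \<partial>lebesgue) \<le> ennreal ?K" for n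
  proof -
    have i: "integrable lebesgue (\<lambda>x. f x * (cmod (w n x))\<^sup>2)"
      using FunPot_integrable_bounded[OF reg H1_L2[OF w(1)]] w(2)[of n] by blast
    have "(\<integral>\<^sup>+x. ennreal (\<bar>f x\<bar> * (cmod (w n x))\<^sup>2) \<partial>lebesgue) = (\<integral>\<^sup>+x. ennreal (- (f x * (cmod (w n x))\<^sup>2)) \<partial>lebesgue)"
      using neg by (intro nn_integral_cong_AE) (auto elim!: eventually_mono)
    also have "\<dots> = ennreal (\<integral>x. - (f x * (cmod (w n x))\<^sup>2) \<partial>lebesgue)"
      using neg i by (intro nn_integral_eq_integral) (auto elim!: eventually_mono intro: mult_nonpos_nonneg)
    also have "\<dots> = ennreal (- pot_quad V (w n))" by (simp add: V)
    also have "\<dots> \<le> ennreal ?K"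
    proof (rule ennreal_leI)
      \<comment> \<open>Nonnegativity of \<open>Istar\<close> at the approximant, rearranged;
        monotonicity of mass and gradient energy then frees the bound from n.\<close>
      have "- pot_quad V (w n) \<le> grad_norm_sq (w n) + \<omega> * mass (w n)"
        using Istar_nonneg[OF w(1)[of n]] unfolding Istar_eq by linarith
      also have "\<dots> \<le> ?K" using w(3,4)[of n] omega_pos by (intro add_mono mult_left_mono) auto
      finally show "- pot_quad V (w n) \<le> ?K" .
    qed
    finally show ?thesis .
  qed
  have "(\<integral>\<^sup>+x. ennreal (\<bar>f x\<bar> * (cmod (u x))\<^sup>2) \<partial>lebesgue) = (\<integral>\<^sup>+x. liminf (\<lambda>n. ennreal (\<bar>f x\<bar> * (cmod (w n x))\<^sup>2)) \<partial>lebesgue)"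
  proof (intro nn_integral_cong_AE, use w(5) in eventually_elim)
    fix x assume "(\<lambda>n. w n x) \<longlonglongrightarrow> u x"
    then have "(\<lambda>n. ennreal (\<bar>f x\<bar> * (cmod (w n x))\<^sup>2)) \<longlonglongrightarrow> ennreal (\<bar>f x\<bar> * (cmod (u x))\<^sup>2)"
      by (intro tendsto_intros tendsto_ennrealI)
    then show "ennreal (\<bar>f x\<bar> * (cmod (u x))\<^sup>2) = liminf (\<lambda>n. ennreal (\<bar>f x\<bar> * (cmod (w n x))\<^sup>2))"
      by (rule lim_imp_Liminf[OF sequentially_bot, symmetric])
  qed
  also have "\<dots> \<le> liminf (\<lambda>n. \<integral>\<^sup>+x. ennreal (\<bar>f x\<bar> * (cmod (w n x))\<^sup>2) \<partial>lebesgue)"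
    by (rule nn_integral_liminf) measurable
  also have "\<dots> \<le> liminf (\<lambda>n. ennreal ?K)" by (intro Liminf_mono always_eventually allI bound)
  also have "\<dots> < \<infinity>" by (simp add: Liminf_const)
  finally show ?thesis by (simp add: integrable_iff_bounded abs_mult)
qed

text \<open>Integrability has three sources: Fatou's lemma for a function potential, boundedness of
  continuous representatives for the finite measures, and essential boundedness for the remaining
  function \<open>W\<close>.\<close>

lemma pot_quad_diff:
  assumes u: "u \<in> H1" and v: "v \<in> H1"
  shows "pot_quad V (\<lambda>x. v x - u x) = pot_quad V v - 2 * Re (pot_pairing V u v) + pot_quad V u"
proof -
  have m: "u \<in> borel_measurable lebesgue" "v \<in> borel_measurable lebesgue"
    using H1_L2[OF u] H1_L2[OF v] by (auto simp: Lp_space_2_iff)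
  show ?thesis
  proof (cases V)
    case (FunPot f)
    then have "f \<in> borel_measurable lebesgue" using FunPot_measurable regular by metis
    from integral_sq_diff(1)[OF this m FunPot_integrable[OF FunPot u] FunPot_integrable[OF FunPot v]]
    show ?thesis by (simp add: FunPot)
  next
    case (MeasPot \<mu> \<nu> W)
    have d: "DIM('a) = 1" and f: "finite_borel_measure \<mu>" "finite_borel_measure \<nu>" and W: "W \<in> Linf_space"
      using regular MeasPot by auto
    obtain K where K: "AE x in lebesgue. norm (W x) \<le> K" and [measurable]: "W \<in> borel_measurable lebesgue"
      using W by (auto simp: Linf_space_def)
    have iW: "integrable lebesgue (\<lambda>x. W x * (cmod (z x))\<^sup>2)" if "z \<in> H1" for z
    proof (rule Bochner_Integration.integrable_bound)
      have [measurable]: "z \<in> borel_measurable lebesgue" using H1_L2[OF that] by (simp add: Lp_space_2_iff)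
      show "integrable lebesgue (\<lambda>x. K * (cmod (z x))\<^sup>2)" using H1_L2[OF that] by (auto simp: Lp_space_2_iff)
      show "AE x in lebesgue. norm (W x * (cmod (z x))\<^sup>2) \<le> norm (K * (cmod (z x))\<^sup>2)"
        using K by eventually_elim (auto simp: abs_mult intro!: mult_right_mono)
      show "(\<lambda>x. W x * (cmod (z x))\<^sup>2) \<in> borel_measurable lebesgue" by measurable
    qed
    have meas: "(\<integral>x. (cmod (cont_rep (\<lambda>x. v x - u x) x))\<^sup>2 \<partial>\<kappa>) = (\<integral>x. (cmod (cont_rep v x))\<^sup>2 \<partial>\<kappa>)
       - 2 * Re (\<integral>x. cont_rep u x * cnj (cont_rep v x) \<partial>\<kappa>) + (\<integral>x. (cmod (cont_rep u x))\<^sup>2 \<partial>\<kappa>)"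
      if "finite_borel_measure \<kappa>" for \<kappa>
      unfolding cont_rep_diff[OF d u v]
      using integral_sq_diff(1)[of "\<lambda>_. 1" \<kappa> "cont_rep u" "cont_rep v"] 
        cont_rep_sq_integrable[OF d u that] cont_rep_sq_integrable[OF d v that] by simp
    show ?thesis unfolding MeasPot
      using integral_sq_diff(1)[OF \<open>W \<in> borel_measurable lebesgue\<close> m iW[OF u] iW[OF v]] meas[OF f(1)] meas[OF f(2)]
      by simp
  qed
qed

lemma pot_pairing_self: "pot_pairing V u u = of_real (pot_quad V u)"
proof (cases V)
  case (FunPot f)
  show ?thesis unfolding FunPot pot_pairing.simps pot_quad.simps by (rule integral_mult_cnj_self)
next
  case (MeasPot \<mu> \<nu> W)
  have "(\<integral>x. cont_rep u x * cnj (cont_rep u x) \<partial>\<kappa>) = of_real (\<integral>x. (cmod (cont_rep u x))\<^sup>2 \<partial>\<kappa>)" for \<kappa>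
    using integral_mult_cnj_self[where f="\<lambda>_. 1" and u="cont_rep u" and M=\<kappa>] by simp
  then show ?thesis unfolding MeasPot pot_pairing.simps pot_quad.simps integral_mult_cnj_self by simp
qed

end

section \<open>Energy decay\<close>

definition power_integral :: "real \<Rightarrow> ('a::euclidean_space \<Rightarrow> complex) \<Rightarrow> real" where
  "power_integral p u = (\<integral>x. cmod (u x) powr p \<partial>lebesgue)"

lemma power_integral_nonneg: "0 \<le> power_integral p u"
  unfolding power_integral_def by (intro integral_nonneg_AE) auto

lemma Lp_norm_powr: "p > 0 \<Longrightarrow> Lp_norm p u powr p = power_integral p u"
  unfolding Lp_norm_def using power_integral_nonneg[of p u] by (simp add: powr_powr power_integral_def)

lemma power_integral_scaleR: "power_integral p (\<lambda>x. c *\<^sub>R u x) = \<bar>c\<bar> powr p * power_integral p u"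
  by (simp add: power_integral_def powr_mult)

lemma power_integral_cong_AE:
  assumes "AE x in lebesgue. u x = v x" "u \<in> borel_measurable lebesgue" "v \<in> borel_measurable lebesgue"
  shows "power_integral p u = power_integral p v"
  unfolding power_integral_def using assms by (intro integral_cong_AE) auto

lemma power_integral_eq_0:
  assumes "integrable lebesgue (\<lambda>x. cmod (u x) powr p)" "power_integral p u = 0"
  shows "AE x in lebesgue. u x = 0"
  using assms unfolding power_integral_def by (subst (asm) integral_nonneg_eq_0_iff_AE) auto

text \<open>Young's inequality with the conjugate exponents p/(2\<open>\<alpha>\<close> + 1) and p,
  applied to functions normalized to norm 1. A vanishing norm cannot be normalized, but then the
  integrand vanishes almost everywhere.\<close>

lemma Holder_power_pairing:
  fixes u v :: "'a::euclidean_space \<Rightarrow> complex"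
  assumes \<alpha>: "0 < \<alpha>"
    and [measurable]: "u \<in> borel_measurable lebesgue" "v \<in> borel_measurable lebesgue"
    and iu: "integrable lebesgue (\<lambda>x. cmod (u x) powr (2 * \<alpha> + 2))"
    and iv: "integrable lebesgue (\<lambda>x. cmod (v x) powr (2 * \<alpha> + 2))"
  shows "Re (L2_inner (\<lambda>x. of_real (cmod (u x) powr (2 * \<alpha>)) * u x) v)
     \<le> Lp_norm (2 * \<alpha> + 2) u powr (2 * \<alpha> + 1) * Lp_norm (2 * \<alpha> + 2) v"
proof (cases "power_integral (2 * \<alpha> + 2) u = 0 \<or> power_integral (2 * \<alpha> + 2) v = 0")
  case True
  then have "AE x in lebesgue. u x = 0 \<or> v x = 0"
    using power_integral_eq_0[OF iu] power_integral_eq_0[OF iv] by (auto elim: eventually_mono)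
  then have "AE x in lebesgue. of_real (cmod (u x) powr (2 * \<alpha>)) * u x * cnj (v x) = 0"
    by eventually_elim auto
  then have "L2_inner (\<lambda>x. of_real (cmod (u x) powr (2 * \<alpha>)) * u x) v = 0"
    unfolding L2_inner_def by (rule integral_eq_zero_AE)
  then show ?thesis by (simp add: Lp_norm_def)
next
  case False
  define p where "p = 2 * \<alpha> + 2"
  define q where "q = p / (2 * \<alpha> + 1)"
  define Y where "Y = Lp_norm p u"
  define X where "X = Lp_norm p v"
  have p: "p > 1" "p > 0" "2 * \<alpha> + 1 > 0" using \<alpha> by (auto simp: p_def)
  have q: "q > 1" using \<alpha> by (simp add: q_def p_def)
  have pq: "1 / q + 1 / p = 1" using \<alpha> by (simp add: q_def p_def field_simps)
  have qe: "(2 * \<alpha> + 1) * q = p" using p by (simp add: q_def)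
  have pos: "power_integral p u > 0" "power_integral p v > 0"
    using False power_integral_nonneg[of p u] power_integral_nonneg[of p v] by (auto simp: p_def less_le)
  then have YX: "Y > 0" "X > 0" by (simp_all add: Y_def X_def Lp_norm_def power_integral_def)
  have Yp: "Y powr p = power_integral p u" "X powr p = power_integral p v"
    using p by (simp_all add: Y_def X_def Lp_norm_powr)
  let ?C = "Y powr (2 * \<alpha> + 1) * X"
  let ?B = "\<lambda>x. ?C * (cmod (u x) powr p / power_integral p u / q + cmod (v x) powr p / power_integral p v / p)"
  have iB: "integrable lebesgue ?B"
    using iu iv by (auto simp: p_def intro!: integrable_mult_right)
  have bound: "cmod (of_real (cmod (u x) powr (2 * \<alpha>)) * u x * cnj (v x)) \<le> ?B x" for x
  proof -
    let ?a = "cmod (u x) powr (2 * \<alpha> + 1) / Y powr (2 * \<alpha> + 1)" and ?b = "cmod (v x) / X"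
    have "?a * ?b \<le> ?a powr q / q + ?b powr p / p"
      using YX by (intro Youngs_inequality q p pq) auto
    also have "?a powr q = cmod (u x) powr p / power_integral p u"
      using YX by (simp add: powr_divide powr_powr qe Yp)
    also have "?b powr p = cmod (v x) powr p / power_integral p v"
      using YX by (simp add: powr_divide Yp)
    finally have "?C * (?a * ?b) \<le> ?B x" using YX by (intro mult_left_mono) auto
    moreover have "?C * (?a * ?b) = cmod (u x) powr (2 * \<alpha> + 1) * cmod (v x)" using YX by simp
    moreover have "cmod (u x) powr (2 * \<alpha> + 1) = cmod (u x) powr (2 * \<alpha>) * cmod (u x)"
      by (cases "u x = 0") (simp_all add: powr_add)
    ultimately show ?thesis by (simp add: norm_mult)
  qed
  have "Re (L2_inner (\<lambda>x. of_real (cmod (u x) powr (2 * \<alpha>)) * u x) v)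
    \<le> cmod (\<integral>x. of_real (cmod (u x) powr (2 * \<alpha>)) * u x * cnj (v x) \<partial>lebesgue)"
    unfolding L2_inner_def by (rule complex_Re_le_cmod)
  also have "\<dots> \<le> (\<integral>x. cmod (of_real (cmod (u x) powr (2 * \<alpha>)) * u x * cnj (v x)) \<partial>lebesgue)"
    by (rule integral_norm_bound)
  also have "\<dots> \<le> (\<integral>x. ?B x \<partial>lebesgue)"
    by (rule integral_mono'[OF iB bound order_trans[OF norm_ge_zero bound]])
  also have "\<dots> = ?C * (power_integral p u / power_integral p u / q + power_integral p v / power_integral p v / p)"
    unfolding power_integral_def using iu iv 
    by (simp only: integral_mult_right_zero p_def[symmetric] integral_divide_zero
        Bochner_Integration.integral_add integrable_divide)
  also have "\<dots> = ?C" using pos pq by simp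
  finally show ?thesis unfolding Y_def X_def p_def .
qed

context Nehari_setting
begin

lemma Ifun_eq: "0 < \<alpha> \<Longrightarrow> Ifun V \<alpha> \<omega> u = Istar V \<omega> u - power_integral (2 * \<alpha> + 2) u"
  by (simp add: Ifun_def Lp_norm_powr)

lemma action_eq: "action V \<alpha> \<omega> u = Istar V \<omega> u - 1 / (\<alpha> + 1) * power_integral (2 * \<alpha> + 2) u"
  by (simp add: action_def Istar_def power_integral_def)

lemma Istar_scaleR: "u \<in> H1 \<Longrightarrow> Istar V \<omega> (\<lambda>x. c *\<^sub>R u x) = c\<^sup>2 * Istar V \<omega> u"
  by (simp add: Istar_eq grad_norm_sq_scaleR pot_quad_scaleR[OF regular] mass_scaleR algebra_simps)

lemma Istar_cong_AE:
  assumes "u \<in> H1" "AE x in lebesgue. u x = v x"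
  shows "Istar V \<omega> v = Istar V \<omega> u"
proof -
  have m: "u \<in> borel_measurable lebesgue" "v \<in> borel_measurable lebesgue"
    using H1_L2[OF assms(1)] H1_L2[OF H1_cong_AE(1)[OF assms]] by (auto simp: Lp_space_2_iff)
  show ?thesis
    using grad_norm_sq_cong_AE[OF assms] pot_quad_cong_AE[OF regular assms(2) m] mass_cong_AE[OF assms(2) m]
    by (simp add: Istar_eq)
qed

text \<open>If the integral diverged, its formal value 0 would force
  \<open>Istar V \<omega> u = 0\<close>; positivity then makes u zero almost everywhere, and the
  integral converges after all.\<close>

lemma power_integrable_if_Ifun_0:
  assumes "0 < \<alpha>" "u \<in> H1" "Ifun V \<alpha> \<omega> u = 0"
  shows "integrable lebesgue (\<lambda>x. cmod (u x) powr (2 * \<alpha> + 2))"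
proof (rule ccontr)
  assume not: "\<not> ?thesis"
  then have "power_integral (2 * \<alpha> + 2) u = 0" by (simp add: power_integral_def not_integrable_integral_eq)
  then have "Istar V \<omega> u = 0" using assms by (simp add: Ifun_eq)
  then have "mass u = 0" using Istar_pos[OF assms(2)] by auto
  then have "AE x in lebesgue. u x = 0" using mass_eq_0_iff H1_L2[OF assms(2)] by blast
  then have "AE x in lebesgue. cmod (u x) powr (2 * \<alpha> + 2) = 0" by eventually_elim simp
  moreover have "u \<in> borel_measurable lebesgue" using H1_L2[OF assms(2)] by (simp add: Lp_space_2_iff)
  ultimately have "integrable lebesgue (\<lambda>x. cmod (u x) powr (2 * \<alpha> + 2)) \<longleftrightarrow> integrable lebesgue (\<lambda>x::'a. 0::real)"
    by (intro integrable_cong_AE) auto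
  then show False using not by simp
qed

text \<open>In effect the equation is tested with v - u and doubled. Implicit terms polarize as 2<v,
  v - u> = |v|^2 - |u|^2 + |v - u|^2; the explicit potential term leaves the integral of V |v - u|^2
  with the same favourable sign.\<close>

lemma Istar_step_le:
  assumes \<alpha>: "0 < \<alpha>" and \<tau>: "0 < \<tau>" and u: "u \<in> H1" and I: "Ifun V \<alpha> \<omega> u = 0"
    and step: "weak_step V \<alpha> \<omega> \<tau> u v"
  shows "Istar V \<omega> v \<le> 2 * Re (L2_inner (\<lambda>x. of_real (cmod (u x) powr (2 * \<alpha>)) * u x) v)
    - power_integral (2 * \<alpha> + 2) u"
proof -
  let ?F = "\<lambda>x. of_real (cmod (u x) powr (2 * \<alpha>)) * u x"
  let ?P = "power_integral (2 * \<alpha> + 2) u"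
  define k where "k = 1 / \<tau>"
  have k: "k > 0" using \<tau> by (simp add: k_def)
  have v: "v \<in> H1" using step by (simp add: weak_step_def)
  note L2 = H1_L2[OF u] H1_L2[OF v]
  have eq: "k * (Re (L2_inner v w) - Re (L2_inner u w)) = - Re (grad_inner v w) - \<omega> * Re (L2_inner v w)
      - Re (pot_pairing V u w) + Re (L2_inner ?F w)" if w: "w \<in> H1" for w
  proof -
    have "(L2_inner v w - L2_inner u w) / of_real \<tau> = - grad_inner v w - of_real \<omega> * L2_inner v w
        - pot_pairing V u w + L2_inner ?F w"
      using step w L2_inner_diff_divide[OF L2(2,1) H1_L2[OF w], of "of_real \<tau>"] by (simp add: weak_step_def)
    from arg_cong[OF this, of Re] show ?thesis by (simp add: k_def Re_divide_of_real)
  qed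
  have F: "Re (L2_inner ?F u) = ?P"
  proof -
    have "?F x * cnj (u x) = of_real (cmod (u x) powr (2 * \<alpha> + 2))" for x
    proof -
      have "cmod (u x) powr (2 * \<alpha> + 2) = cmod (u x) powr (2 * \<alpha>) * (cmod (u x))\<^sup>2"
        by (cases "u x = 0") (simp_all add: powr_add)
      then show ?thesis by (simp add: complex_norm_square mult.assoc del: of_real_power)
    qed
    then show ?thesis by (simp add: L2_inner_def power_integral_def)
  qed
  define e where "e = (\<lambda>x. v x - u x)"
  have e: "e \<in> H1" unfolding e_def by (rule H1_diff(1)[OF v u])
  have G: "grad_norm_sq e = grad_norm_sq v - 2 * Re (grad_inner v u) + grad_norm_sq u"
  proof -
    have "grad_norm_sq e = grad_norm_sq (\<lambda>x. u x - v x)"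
    proof -
      have "e = (\<lambda>x. (-1) *\<^sub>R (u x - v x))" by (simp add: e_def)
      then show ?thesis using grad_norm_sq_scaleR[OF H1_diff(1)[OF u v], of "-1"] by simp
    qed
    then show ?thesis using grad_norm_sq_diff[OF v u] by simp
  qed
  have M: "mass e = mass v - 2 * Re (L2_inner v u) + mass u"
    using mass_diff[OF L2] Re_L2_inner_commute[OF L2] by (simp add: e_def)
  have Q: "pot_quad V e = pot_quad V v - 2 * Re (pot_pairing V u v) + pot_quad V u"
    unfolding e_def by (rule pot_quad_diff[OF u v])
  have Q_le: "pot_quad V e \<le> 0" using nonpositive e by (simp add: nonpositive_potential_def)
  have test_u: "k * (Re (L2_inner v u) - mass u) = - Re (grad_inner v u) - \<omega> * Re (L2_inner v u) - pot_quad V u + ?P"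
    using eq[OF u] F by (simp add: L2_inner_self pot_pairing_self)
  have test_v: "k * (mass v - Re (L2_inner v u)) = - grad_norm_sq v - \<omega> * mass v - Re (pot_pairing V u v) + Re (L2_inner ?F v)"
    using eq[OF v] Re_L2_inner_commute[OF L2] by (simp add: L2_inner_self grad_inner_self)
  have P: "?P = grad_norm_sq u + pot_quad V u + \<omega> * mass u"
    using I Istar_eq[of u] Ifun_eq[OF \<alpha>, of u] by simp
  \<comment> \<open>These are the terms to be dropped. Inserting twice \<open>test_v\<close> and
    twice \<open>test_u\<close> eliminates \<open>\<tau>\<close> and cancels the mixed gradient and
    mass terms; the mixed potential term completes to \<open>pot_quad V e\<close>, and
    \<open>P\<close> replaces the quadratic part at u.\<close>
  have "0 \<le> grad_norm_sq e + \<omega> * mass e + 2 * (k * mass e)"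
    using grad_norm_sq_nonneg[of e] mass_nonneg[of e] omega_pos k by simp
  also have "\<dots> = grad_norm_sq v - 2 * Re (grad_inner v u) + grad_norm_sq u
     + (\<omega> * mass v - 2 * (\<omega> * Re (L2_inner v u)) + \<omega> * mass u)
     + 2 * (k * (mass v - Re (L2_inner v u))) - 2 * (k * (Re (L2_inner v u) - mass u))"
    unfolding G M by (simp add: algebra_simps)
  finally show ?thesis unfolding Istar_eq using test_u test_v P Q Q_le by linarith
qed

text \<open>The first two claims are what the next step requires. \<open>Ifun = 0\<close> stands in
  place of membership in \<open>Nehari\<close> so that it also covers an iterate that vanishes
  almost everywhere.\<close>

lemma normalized_step:
  fixes u v :: "'a \<Rightarrow> complex"
  assumes \<alpha>: "0 < \<alpha>" and \<tau>: "0 < \<tau>" and u: "u \<in> H1" and I: "Ifun V \<alpha> \<omega> u = 0"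
    and step: "weak_step V \<alpha> \<omega> \<tau> u v"
    and w: "AE x in lebesgue. w x = of_real (norm_factor V \<alpha> \<omega> v) * v x"
  shows "w \<in> H1" "Ifun V \<alpha> \<omega> w = 0" "action V \<alpha> \<omega> w \<le> action V \<alpha> \<omega> u"
proof -
  define p where "p = 2 * \<alpha> + 2"
  define s where "s = norm_factor V \<alpha> \<omega> v"
  have p: "p > 0" using \<alpha> by (simp add: p_def)
  have v: "v \<in> H1" using step by (simp add: weak_step_def)
  have ae: "AE x in lebesgue. s *\<^sub>R v x = w x"
    using w by eventually_elim (simp add: s_def scaleR_conv_of_real)
  note vl = H1_scaleR(1)[OF v, of s]
  show "w \<in> H1" by (rule H1_cong_AE(1)[OF vl ae])
  have meas: "u \<in> borel_measurable lebesgue" "v \<in> borel_measurable lebesgue" "w \<in> borel_measurable lebesgue"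
    "(\<lambda>x. s *\<^sub>R v x) \<in> borel_measurable lebesgue"
    using H1_L2[OF u] H1_L2[OF v] H1_L2[OF \<open>w \<in> H1\<close>] H1_L2[OF vl] by (auto simp: Lp_space_2_iff)
  define A where "A = power_integral p v"
  define P where "P = power_integral p u"
  define H where "H = Istar V \<omega> v"
  have A0: "0 \<le> A" and P0: "0 \<le> P" by (simp_all add: A_def P_def power_integral_nonneg)
  have s_eq: "s = (H / A) powr (1 / (2 * \<alpha>))"
    using Lp_norm_powr[OF p, of v] by (simp add: s_def norm_factor_def H_def A_def p_def)
  have s0: "0 \<le> s" by (simp add: s_eq)
  have Iw: "Istar V \<omega> w = s\<^sup>2 * H" using Istar_cong_AE[OF vl ae] Istar_scaleR[OF v] by (simp add: H_def)
  have Pw: "power_integral p w = s powr p * A"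
    using power_integral_cong_AE[OF ae meas(4,3)] s0 by (simp add: power_integral_scaleR A_def)
  have "s powr p * A = s\<^sup>2 * H \<and> s\<^sup>2 * H \<le> P"
  proof (cases "A = 0")
    case True
    \<comment> \<open>A = 0 covers both v = 0 and a divergent power integral. Then
      \<open>H / A = 0\<close> and \<open>0 powr _ = 0\<close>, so s = 0 and every term except P is
      0.\<close>
    then show ?thesis using P0 by (simp add: s_eq)
  next
    case False
    then have A: "A > 0" using A0 by simp
    have iv: "integrable lebesgue (\<lambda>x. cmod (v x) powr p)"
      using False by (metis A_def power_integral_def not_integrable_integral_eq)
    have iu: "integrable lebesgue (\<lambda>x. cmod (u x) powr p)"
      unfolding p_def by (rule power_integrable_if_Ifun_0[OF \<alpha> u I])
    have "mass v \<noteq> 0"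
    proof
      assume "mass v = 0"
      then have "AE x in lebesgue. v x = 0" using mass_eq_0_iff H1_L2[OF v] by blast
      then have "AE x in lebesgue. cmod (v x) powr p = 0" by eventually_elim simp
      then show False using False unfolding A_def power_integral_def by (simp add: integral_eq_zero_AE)
    qed
    then have H: "H > 0" unfolding H_def by (rule Istar_pos[OF v])
    then have s: "s > 0" using A by (simp add: s_eq)
    define X where "X = Lp_norm p v"
    define Y where "Y = Lp_norm p u"
    have Y0: "Y \<ge> 0" by (simp add: Y_def Lp_norm_def)
    have X: "X > 0" using A unfolding A_def by (simp add: X_def Lp_norm_def power_integral_def)
    have XA: "X powr p = A" and YP: "Y powr p = P"
      using p by (simp_all add: X_def Y_def A_def P_def Lp_norm_powr)
    have split: "t powr p = t powr (2 * \<alpha>) * t\<^sup>2" "t powr (2 * \<alpha> + 1) = t powr (2 * \<alpha>) * t" if "t \<ge> 0" for t :: real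
      using that by (cases "t = 0"; simp add: p_def powr_add)+
    have "H \<le> 2 * (Y powr (2 * \<alpha> + 1) * X) - P"
      using Istar_step_le[OF \<alpha> \<tau> u I step] Holder_power_pairing[OF \<alpha> meas(1,2)] iu iv
      unfolding H_def Y_def X_def P_def p_def by (smt (verit))
    also have "\<dots> = Y powr (2 * \<alpha>) * (2 * Y * X - Y\<^sup>2)"
      unfolding YP[symmetric] split[OF Y0] by (simp add: algebra_simps)
    also have "\<dots> \<le> Y powr (2 * \<alpha>) * X\<^sup>2"
      using zero_le_power2[of "Y - X"] by (intro mult_left_mono) (auto simp: power2_diff)
    finally have HX: "H \<le> Y powr (2 * \<alpha>) * X\<^sup>2" .
    have "H / A \<le> (Y / X) powr (2 * \<alpha>)"
    proof -
      have "H / A \<le> Y powr (2 * \<alpha>) * X\<^sup>2 / A" using HX A by (simp add: divide_right_mono)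
      also have "\<dots> = (Y / X) powr (2 * \<alpha>)"
        unfolding XA[symmetric] split(1)[OF less_imp_le[OF X]] using X by (simp add: powr_divide Y0)
      finally show ?thesis .
    qed
    then have "s \<le> ((Y / X) powr (2 * \<alpha>)) powr (1 / (2 * \<alpha>))"
      unfolding s_eq using H A \<alpha> by (intro powr_mono2) auto
    also have "\<dots> = Y / X" using \<alpha> Y0 X by (simp add: powr_powr)
    finally have "s\<^sup>2 \<le> (Y / X)\<^sup>2" using s0 by (intro power_mono) auto
    then have "s\<^sup>2 * H \<le> (Y / X)\<^sup>2 * (Y powr (2 * \<alpha>) * X\<^sup>2)" using HX H by (intro mult_mono) auto
    \<comment> \<open>The powers of X cancel and those of Y add up to p.\<close>
    also have "\<dots> = P" unfolding YP[symmetric] split(1)[OF Y0] using X by (simp add: power_divide)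
    finally have le: "s\<^sup>2 * H \<le> P" .
    \<comment> \<open>The exponent in \<open>norm_factor\<close> is designed for this: it balances
      degree p against degree 2 and places w on \<open>Ifun = 0\<close>.\<close>
    have "s powr (2 * \<alpha>) = H / A" unfolding s_eq using \<alpha> H A by (simp add: powr_powr)
    then have "s powr p * A = s\<^sup>2 * H" unfolding split(1)[OF s0] using A by simp
    with le show ?thesis by simp
  qed
  then have eq: "power_integral p w = Istar V \<omega> w" and le: "Istar V \<omega> w \<le> P" by (simp_all add: Pw Iw)
  show "Ifun V \<alpha> \<omega> w = 0" using eq by (simp add: Ifun_eq[OF \<alpha>] p_def)
  have "Istar V \<omega> u = P" using I by (simp add: Ifun_eq[OF \<alpha>] p_def P_def)
  then have "action V \<alpha> \<omega> u = (1 - 1 / (\<alpha> + 1)) * P" "action V \<alpha> \<omega> w = (1 - 1 / (\<alpha> + 1)) * Istar V \<omega> w"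
    using eq unfolding action_eq by (simp_all add: P_def p_def algebra_simps)
  then show "action V \<alpha> \<omega> w \<le> action V \<alpha> \<omega> u"
    using le \<alpha> by (simp add: mult_left_mono)
qed

end

theorem proposition4p5:
  fixes V :: "'a::euclidean_space potential"
    and \<alpha> \<omega> \<tau> :: real
    and \<phi>0 :: "'a \<Rightarrow> complex"
    and \<phi> \<phi>t :: "nat \<Rightarrow> 'a \<Rightarrow> complex"
  assumes "0 < \<alpha>"
    and "DIM('a) > 2 \<longrightarrow> \<alpha> < 2 / (real DIM('a) - 2)"
    and "regular_potential V"
    and "nonpositive_potential V"
    and "0 \<le> omega0 V" and "omega0 V < ereal \<omega>"
    and "0 < \<tau>"
    and "\<phi>0 \<in> Nehari V \<alpha> \<omega>"
    and "GFDN_BF V \<alpha> \<omega> \<tau> \<phi>0 \<phi> \<phi>t"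
  shows "\<forall>n. action V \<alpha> \<omega> (\<phi> (Suc n)) \<le> action V \<alpha> \<omega> (\<phi> n)"
proof -
  interpret Nehari_setting V \<omega> using assms(3-6) by (rule Nehari_setting.intro)
  have init: "\<phi> 0 = \<phi>0" and step: "\<And>n. weak_step V \<alpha> \<omega> \<tau> (\<phi> n) (\<phi>t (Suc n))"
    and norm: "\<And>n. AE x in lebesgue. \<phi> (Suc n) x = of_real (norm_factor V \<alpha> \<omega> (\<phi>t (Suc n))) * \<phi>t (Suc n) x"
    using assms(9) by (auto simp: GFDN_BF_def)
  \<comment> \<open>An invariant weaker than membership in \<open>Nehari\<close>: it is preserved
    even when the formal normalization factor is 0.\<close>
  have inv: "\<phi> n \<in> H1 \<and> Ifun V \<alpha> \<omega> (\<phi> n) = 0" for n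
  proof (induction n)
    case 0
    then show ?case using assms(8) init by (simp add: Nehari_def)
  next
    case (Suc n)
    then show ?case using normalized_step(1,2)[OF assms(1,7) _ _ step norm] by blast
  qed
  then show ?thesis using normalized_step(3)[OF assms(1,7) _ _ step norm] by blast
qed

end
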